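(* For each dimension $n$ there exists a constant $c_n > 0$, depending only on $n$, such that for every bounded domain $\Omega \subset \mathbb{R}^n$ with $C^1$-boundary $\partial\Omega$, $$ \int_{\partial \Omega \times \partial \Omega} \frac{\left|\left\langle n(x), y - x \right\rangle \left\langle y - x, n(y) \right\rangle \right|}{\|x - y\|^{n+1}}\, d\sigma(x)\, d\sigma(y) \geq c_n |\partial \Omega|, $$ with equality if and only if $\Omega$ is convex.
   Context: A domain is a nonempty connected open set. $\Omega$ has $C^1$-boundary if, near each boundary point and after a rigid motion, $\Omega$ is the region on one side of the graph of a $C^1$ function. For $x \in \partial\Omega$, $n(x)$ denotes the unit (outward) normal vector to $\partial\Omega$ at $x$. $\sigma$ is the $(n-1)$-dimensional Hausdorff measure restricted to $\partial\Omega$, and $|\partial\Omega| = \sigma(\partial\Omega)$. $\langle\cdot,\cdot\rangle$ and $\|\cdot\|$ are the Euclidean inner product and norm. The integrand is nonnegative and is considered for $x \neq y$; the integral is understood as an element of $[0,\infty]$. *)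

theory Defs
  imports "HOL-Analysis.Analysis"
begin

section \<open>Hausdorff measure\<close>

text \<open>
  The summand of a cover of dimension \<open>d\<close> is \<open>\<omega>\<^sub>d (diam C / 2) ^ d\<close> with \<open>\<omega>\<^sub>d\<close> the volume of
  the unit ball of dimension \<open>d\<close>. The empty set has to be treated separately for \<open>d = 0\<close>, as
  \<open>0 ^ 0 = 1\<close>; boundedness is required because \<^const>\<open>diameter\<close> is unspecified on unbounded sets.
\<close>

definition hausdorff_gauge :: "nat \<Rightarrow> 'a::metric_space set \<Rightarrow> ennreal" where
  "hausdorff_gauge d C =
     (if C = {} then 0 else ennreal (unit_ball_vol (real d) * (diameter C / 2) ^ d))"

definition hausdorff_pre :: "nat \<Rightarrow> real \<Rightarrow> 'a::metric_space set \<Rightarrow> ennreal" where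
  "hausdorff_pre d \<delta> A =
     (INF C\<in>{C :: nat \<Rightarrow> 'a set. A \<subseteq> (\<Union>i. C i) \<and> (\<forall>i. bounded (C i) \<and> diameter (C i) \<le> \<delta>)}.
        \<Sum>i. hausdorff_gauge d (C i))"

definition hausdorff_outer :: "nat \<Rightarrow> 'a::metric_space set \<Rightarrow> ennreal" where
  "hausdorff_outer d A = (SUP \<delta>\<in>{0<..}. hausdorff_pre d \<delta> A)"

definition hausdorff_measure :: "nat \<Rightarrow> 'a::metric_space measure" where
  "hausdorff_measure d = measure_of UNIV (sets borel) (hausdorff_outer d)"

lemma sets_hausdorff_measure [simp, measurable_cong]: "sets (hausdorff_measure d) = sets borel"
  unfolding hausdorff_measure_def
  by (metis sets.sets_measure_of_eq space_borel)

lemma space_hausdorff_measure [simp]: "space (hausdorff_measure d) = UNIV"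
  by (simp add: hausdorff_measure_def space_measure_of_conv)

text \<open>
  \<^const>\<open>measure_of\<close> yields the zero measure unless its argument is countably additive. The
  following facts show that this degenerate case does not occur.
\<close>

lemma hausdorff_gauge_mono:
  assumes "C \<subseteq> D" "bounded D"
  shows "hausdorff_gauge d C \<le> hausdorff_gauge d D"
proof (cases "C = {}")
  case False
  then have "D \<noteq> {}" using assms by auto
  moreover have "0 \<le> diameter C" "diameter C \<le> diameter D"
    using assms diameter_subset diameter_ge_0 bounded_subset by blast+
  moreover have "0 < unit_ball_vol (real d)"
    by simp
  ultimately show ?thesis
    using False unfolding hausdorff_gauge_def
    by (auto intro!: ennreal_leI mult_left_mono power_mono)
qed (simp add: hausdorff_gauge_def)

lemma hausdorff_pre_mono:
  assumes "A \<subseteq> B" "\<epsilon> \<le> \<delta>"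
  shows "hausdorff_pre d \<delta> A \<le> hausdorff_pre d \<epsilon> B"
  unfolding hausdorff_pre_def
  using assms by (intro INF_superset_mono) (auto intro: order_trans)

lemma hausdorff_pre_empty:
  assumes "\<delta> > 0"
  shows "hausdorff_pre d \<delta> {} = 0"
proof -
  have "hausdorff_pre d \<delta> ({}::'a set) \<le> (\<Sum>i::nat. hausdorff_gauge d ({}::'a set))"
    unfolding hausdorff_pre_def
    using assms by (intro INF_lower2[of "\<lambda>_. {}"]) auto
  then show ?thesis by (simp add: hausdorff_gauge_def)
qed

lemma hausdorff_pre_subadditive:
  fixes A :: "nat \<Rightarrow> 'a::metric_space set"
  shows "hausdorff_pre d \<delta> (\<Union>n. A n) \<le> (\<Sum>n. hausdorff_pre d \<delta> (A n))"
proof (rule ennreal_le_epsilon)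
  fix e :: real
  assume e: "0 < e" and fin: "(\<Sum>n. hausdorff_pre d \<delta> (A n)) < top"
  have lt: "hausdorff_pre d \<delta> (A n) < hausdorff_pre d \<delta> (A n) + e * (1/2) ^ Suc n" for n
    using e fin by (auto simp add: less_top dest!: ennreal_suminf_lessD)
  have "\<exists>C. A n \<subseteq> (\<Union>i. C i) \<and> (\<forall>i::nat. bounded (C i) \<and> diameter (C i) \<le> \<delta>) \<and>
            (\<Sum>i. hausdorff_gauge d (C i)) \<le> hausdorff_pre d \<delta> (A n) + e * (1/2) ^ Suc n" for n
  proof -
    obtain C where "A n \<subseteq> (\<Union>i. C i)" "\<forall>i::nat. bounded (C i) \<and> diameter (C i) \<le> \<delta>"
      "(\<Sum>i. hausdorff_gauge d (C i)) < hausdorff_pre d \<delta> (A n) + e * (1/2) ^ Suc n"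
      using lt[of n] unfolding hausdorff_pre_def INF_less_iff by auto
    then show ?thesis using less_imp_le by blast
  qed
  then obtain B where B: "\<And>n. A n \<subseteq> (\<Union>i. B n i)"
    and Bd: "\<And>n i::nat. bounded (B n i) \<and> diameter (B n i) \<le> \<delta>"
    and Ble: "\<And>n. (\<Sum>i. hausdorff_gauge d (B n i)) \<le> hausdorff_pre d \<delta> (A n) + e * (1/2) ^ Suc n"
    by metis
  define C where "C = case_prod B o prod_decode"
  have "(\<Union>n. A n) \<subseteq> (\<Union>i. C i)"
    using B by (auto simp add: C_def subset_eq) (metis prod.case prod_encode_inverse)
  then have "hausdorff_pre d \<delta> (\<Union>n. A n) \<le> (\<Sum>i. hausdorff_gauge d (C i))"
    unfolding hausdorff_pre_def
    by (intro INF_lower) (auto simp: C_def Bd split: prod.splits)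
  also have "\<dots> = (\<Sum>n. \<Sum>i. hausdorff_gauge d (B n i))"
    using suminf_ennreal_2dimen[of "\<lambda>n. \<Sum>i. hausdorff_gauge d (B n i)"
        "\<lambda>(n, i). hausdorff_gauge d (B n i)"]
    by (simp add: C_def comp_def split_def)
  also have "\<dots> \<le> (\<Sum>n. hausdorff_pre d \<delta> (A n) + e * (1/2) ^ Suc n)"
    by (intro suminf_le allI Ble) auto
  also have "\<dots> = (\<Sum>n. hausdorff_pre d \<delta> (A n)) + (\<Sum>n. ennreal e * ennreal ((1/2) ^ Suc n))"
    using e by (subst suminf_add[symmetric])
               (auto simp del: ennreal_suminf_cmult simp add: ennreal_mult[symmetric])
  also have "\<dots> = (\<Sum>n. hausdorff_pre d \<delta> (A n)) + e"
    unfolding ennreal_suminf_cmult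
    by (subst suminf_ennreal_eq[OF zero_le_power power_half_series]) auto
  finally show "hausdorff_pre d \<delta> (\<Union>n. A n) \<le> (\<Sum>n. hausdorff_pre d \<delta> (A n)) + e" .
qed

lemma outer_measure_space_hausdorff_outer:
  "outer_measure_space (Pow UNIV) (hausdorff_outer d :: 'a::metric_space set \<Rightarrow> ennreal)"
  unfolding outer_measure_space_def
proof (intro conjI)
  show "positive (Pow UNIV) (hausdorff_outer d :: 'a set \<Rightarrow> ennreal)"
    by (auto simp: positive_def hausdorff_outer_def hausdorff_pre_empty)
  show "increasing (Pow UNIV) (hausdorff_outer d :: 'a set \<Rightarrow> ennreal)"
    unfolding increasing_def hausdorff_outer_def
    by (auto intro!: SUP_mono' hausdorff_pre_mono)
  show "countably_subadditive (Pow UNIV) (hausdorff_outer d :: 'a set \<Rightarrow> ennreal)"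
    unfolding countably_subadditive_def
  proof (intro allI impI)
    fix A :: "nat \<Rightarrow> 'a set"
    show "hausdorff_outer d (\<Union>i. A i) \<le> (\<Sum>i. hausdorff_outer d (A i))"
      unfolding hausdorff_outer_def[of d "\<Union>i. A i"]
    proof (rule SUP_least)
      fix \<delta> :: real assume \<delta>: "\<delta> \<in> {0<..}"
      have "hausdorff_pre d \<delta> (\<Union>i. A i) \<le> (\<Sum>i. hausdorff_pre d \<delta> (A i))"
        by (rule hausdorff_pre_subadditive)
      also have "\<dots> \<le> (\<Sum>i. hausdorff_outer d (A i))"
        unfolding hausdorff_outer_def using \<delta> by (intro suminf_le SUP_upper) auto
      finally show "hausdorff_pre d \<delta> (\<Union>i. A i) \<le> (\<Sum>i. hausdorff_outer d (A i))" .
    qed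
  qed
qed

lemma hausdorff_outer_separated:
  fixes A B :: "'a::metric_space set"
  assumes "\<epsilon> > 0" and sep: "\<And>x y. x \<in> A \<Longrightarrow> y \<in> B \<Longrightarrow> \<epsilon> \<le> dist x y"
  shows "hausdorff_outer d A + hausdorff_outer d B \<le> hausdorff_outer d (A \<union> B)"
proof -
  have pre: "hausdorff_pre d \<delta> A + hausdorff_pre d \<delta> B \<le> hausdorff_pre d \<delta> (A \<union> B)"
    if \<delta>: "0 < \<delta>" "\<delta> < \<epsilon>" for \<delta>
    unfolding hausdorff_pre_def[of d \<delta> "A \<union> B"]
  proof (rule INF_greatest)
    fix C :: "nat \<Rightarrow> 'a set"
    assume "C \<in> {C. A \<union> B \<subseteq> (\<Union>i. C i) \<and> (\<forall>i. bounded (C i) \<and> diameter (C i) \<le> \<delta>)}"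
    then have C: "A \<union> B \<subseteq> (\<Union>i. C i)" "\<And>i. bounded (C i)" "\<And>i. diameter (C i) \<le> \<delta>"
      by auto
    define CA where "CA i = (if C i \<inter> A = {} then {} else C i)" for i
    define CB where "CB i = (if C i \<inter> B = {} then {} else C i)" for i
    have "hausdorff_pre d \<delta> A \<le> (\<Sum>i. hausdorff_gauge d (CA i))"
      unfolding hausdorff_pre_def
    proof (rule INF_lower, safe)
      fix x assume "x \<in> A"
      then obtain i where "x \<in> C i" using C by blast
      with \<open>x \<in> A\<close> have "x \<in> CA i" by (auto simp: CA_def)
      then show "x \<in> (\<Union>i. CA i)" by blast
    qed (use C \<delta> in \<open>auto simp: CA_def\<close>)
    moreover have "hausdorff_pre d \<delta> B \<le> (\<Sum>i. hausdorff_gauge d (CB i))"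
      unfolding hausdorff_pre_def
    proof (rule INF_lower, safe)
      fix x assume "x \<in> B"
      then obtain i where "x \<in> C i" using C by blast
      with \<open>x \<in> B\<close> have "x \<in> CB i" by (auto simp: CB_def)
      then show "x \<in> (\<Union>i. CB i)" by blast
    qed (use C \<delta> in \<open>auto simp: CB_def\<close>)
    ultimately have "hausdorff_pre d \<delta> A + hausdorff_pre d \<delta> B
        \<le> (\<Sum>i. hausdorff_gauge d (CA i)) + (\<Sum>i. hausdorff_gauge d (CB i))"
      by (rule add_mono)
    also have "\<dots> = (\<Sum>i. hausdorff_gauge d (CA i) + hausdorff_gauge d (CB i))"
      by (rule suminf_add) auto
    also have "\<dots> \<le> (\<Sum>i. hausdorff_gauge d (C i))"
    proof (intro suminf_le allI)
      fix i
      have "C i \<inter> A = {} \<or> C i \<inter> B = {}"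
      proof (rule ccontr)
        assume "\<not> ?thesis"
        then obtain x y where xy: "x \<in> C i" "x \<in> A" "y \<in> C i" "y \<in> B" by blast
        then have "dist x y \<le> \<delta>"
          using C(2,3)[of i] diameter_bounded_bound[of "C i" x y] by linarith
        with sep[of x y] xy \<delta> show False by linarith
      qed
      then show "hausdorff_gauge d (CA i) + hausdorff_gauge d (CB i) \<le> hausdorff_gauge d (C i)"
        by (auto simp: CA_def CB_def hausdorff_gauge_def)
    qed auto
    finally show "hausdorff_pre d \<delta> A + hausdorff_pre d \<delta> B \<le> (\<Sum>i. hausdorff_gauge d (C i))" .
  qed
  have "hausdorff_pre d \<delta>1 A + hausdorff_pre d \<delta>2 B \<le> hausdorff_outer d (A \<union> B)"
    if "\<delta>1 \<in> {0<..}" "\<delta>2 \<in> {0<..}" for \<delta>1 \<delta>2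
  proof -
    define \<delta> where "\<delta> = min (min \<delta>1 \<delta>2) (\<epsilon> / 2)"
    have \<delta>: "0 < \<delta>" "\<delta> < \<epsilon>" "\<delta> \<le> \<delta>1" "\<delta> \<le> \<delta>2"
      using that assms(1) by (auto simp: \<delta>_def)
    have "hausdorff_pre d \<delta>1 A + hausdorff_pre d \<delta>2 B \<le> hausdorff_pre d \<delta> A + hausdorff_pre d \<delta> B"
      using \<delta> by (intro add_mono hausdorff_pre_mono) auto
    also have "\<dots> \<le> hausdorff_pre d \<delta> (A \<union> B)"
      using pre \<delta> by blast
    also have "\<dots> \<le> hausdorff_outer d (A \<union> B)"
      unfolding hausdorff_outer_def using \<delta> by (intro SUP_upper) auto
    finally show ?thesis .
  qed
  then have "hausdorff_pre d \<delta>1 A + hausdorff_outer d B \<le> hausdorff_outer d (A \<union> B)"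
    if "\<delta>1 \<in> {0<..}" for \<delta>1
    unfolding hausdorff_outer_def[of d B] using that
    by (subst ennreal_SUP_add_right) (auto intro: SUP_least)
  then show ?thesis
    unfolding hausdorff_outer_def[of d A]
    by (subst ennreal_SUP_add_left[symmetric]) (auto intro!: SUP_least)
qed

lemma
  shows hausdorff_outer_empty [simp]: "hausdorff_outer d {} = 0"
    and hausdorff_outer_mono: "A \<subseteq> B \<Longrightarrow> hausdorff_outer d A \<le> hausdorff_outer d B"
    and hausdorff_outer_Un: "hausdorff_outer d (A \<union> B) \<le> hausdorff_outer d A + hausdorff_outer d B"
    and hausdorff_outer_UN:
      "hausdorff_outer d (\<Union>i::nat. F i) \<le> (\<Sum>i. hausdorff_outer d (F i))"
proof -
  have pos: "positive (Pow UNIV) (hausdorff_outer d)"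
    and inc: "increasing (Pow UNIV) (hausdorff_outer d)"
    and csa: "countably_subadditive (Pow UNIV) (hausdorff_outer d)"
    using outer_measure_space_hausdorff_outer unfolding outer_measure_space_def by auto
  show empty: "hausdorff_outer d {} = 0"
    using pos by (auto simp: positive_def)
  show "hausdorff_outer d A \<le> hausdorff_outer d B" if "A \<subseteq> B"
    using inc that by (auto simp: increasing_def)
  show UN: "hausdorff_outer d (\<Union>i::nat. F i) \<le> (\<Sum>i. hausdorff_outer d (F i))" for F
  proof -
    have "hausdorff_outer d (\<Union>i. disjointed F i) \<le> (\<Sum>i. hausdorff_outer d (disjointed F i))"
      using csa disjoint_family_disjointed[of F] unfolding countably_subadditive_def by blast
    also have "\<dots> \<le> (\<Sum>i. hausdorff_outer d (F i))"
      using inc disjointed_subset[of F]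
      by (intro suminf_le allI) (auto simp: increasing_def)
    finally show ?thesis by (simp add: UN_disjointed_eq)
  qed
  show "hausdorff_outer d (A \<union> B) \<le> hausdorff_outer d A + hausdorff_outer d B"
  proof -
    have "A \<union> B = (\<Union>i. binaryset A B i)" by (simp add: UN_binaryset_eq)
    then have "hausdorff_outer d (A \<union> B) \<le> (\<Sum>i. hausdorff_outer d (binaryset A B i))"
      using UN by metis
    also have "\<dots> = hausdorff_outer d A + hausdorff_outer d B"
      using suminf_binaryset_eq[of "hausdorff_outer d"] empty by blast
    finally show ?thesis .
  qed
qed

lemma closed_in_lambda_system_hausdorff_outer:
  fixes K :: "'a::metric_space set"
  assumes "closed K"
  shows "K \<in> lambda_system UNIV (Pow UNIV) (hausdorff_outer d)"
proof -
  let ?\<mu> = "hausdorff_outer d"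
  have "?\<mu> (A \<inter> K) + ?\<mu> (A - K) \<le> ?\<mu> A" for A
  proof (cases "K = {} \<or> ?\<mu> A = \<infinity>")
    case False
    then have "K \<noteq> {}" and fin: "?\<mu> A < \<infinity>" by (auto simp: less_top)
    define D where "D x = infdist x K" for x
    have D_lip: "D x - D y \<le> dist x y" for x y
      using infdist_triangle[of x K y] by (simp add: D_def dist_commute)
    define F where "F k = {x \<in> A. D x \<ge> 1 / Suc k}" for k
    define R where "R k = {x \<in> A. 1 / real (k+2) \<le> D x \<and> D x < 1 / real (k+1)}" for k
    have RA: "R k \<subseteq> A" for k by (auto simp: R_def)
    have far: "?\<mu> (A \<inter> K) + ?\<mu> (F k) \<le> ?\<mu> A" for k
    proof -
      have "?\<mu> (A \<inter> K) + ?\<mu> (F k) \<le> ?\<mu> (A \<inter> K \<union> F k)"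
      proof (rule hausdorff_outer_separated[of "1 / Suc k"])
        fix x y assume "x \<in> A \<inter> K" "y \<in> F k"
        then have "D x = 0" "D y \<ge> 1 / Suc k" by (auto simp: D_def F_def)
        then show "1 / Suc k \<le> dist x y"
          using D_lip[of y x] by (simp add: dist_commute)
      qed simp
      also have "\<dots> \<le> ?\<mu> A"
        by (intro hausdorff_outer_mono) (auto simp: F_def)
      finally show ?thesis .
    qed
    have sum2: "(\<Sum>i<n. ?\<mu> (R (2*i+c))) \<le> ?\<mu> (\<Union>i<n. R (2*i+c))" for n c
    proof (induction n)
      case (Suc n)
      define m where "m = max 1 (2*n+c)"
      have "(\<Sum>i<Suc n. ?\<mu> (R (2*i+c))) \<le> ?\<mu> (\<Union>i<n. R (2*i+c)) + ?\<mu> (R (2*n+c))"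
        using Suc by (simp add: add_right_mono)
      also have "\<dots> \<le> ?\<mu> ((\<Union>i<n. R (2*i+c)) \<union> R (2*n+c))"
      proof (rule hausdorff_outer_separated)
        show "0 < 1 / real m - 1 / real (m+1)"
          by (simp add: m_def frac_less2)
        fix x y assume "x \<in> (\<Union>i<n. R (2*i+c))" and y: "y \<in> R (2*n+c)"
        then obtain i where i: "i < n" "x \<in> R (2*i+c)" by blast
        then have m: "m = 2*n+c" by (simp add: m_def)
        have "1 / real m \<le> 1 / real (2*i+c+2)"
          using i by (intro divide_left_mono) (auto simp: m)
        also have "\<dots> \<le> D x" using i by (auto simp: R_def)
        finally have "1 / real m \<le> D x" .
        moreover have "D y < 1 / real (m+1)" using y by (auto simp: R_def m)
        ultimately show "1 / real m - 1 / real (m+1) \<le> dist x y"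
          using D_lip[of x y] by linarith
      qed
      finally show ?case by (simp add: lessThan_Suc Un_commute)
    qed simp
    have half: "(\<Sum>i. ?\<mu> (R (2*i+c))) \<le> ?\<mu> A" for c
    proof (rule suminf_le_const)
      show "(\<Sum>i<n. ?\<mu> (R (2*i+c))) \<le> ?\<mu> A" for n
        using RA by (intro order_trans[OF sum2] hausdorff_outer_mono) auto
    qed simp
    have "(\<Sum>i<n. ?\<mu> (R i)) \<le> ?\<mu> A + ?\<mu> A" for n
    proof -
      have "(\<Sum>i<n. ?\<mu> (R i)) \<le> (\<Sum>i<2*n. ?\<mu> (R i))"
        by (intro sum_mono2) auto
      also have "\<dots> = (\<Sum>i<n. ?\<mu> (R (2*i+0))) + (\<Sum>i<n. ?\<mu> (R (2*i+1)))"
        by (induction n) (auto simp: algebra_simps)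
      also have "\<dots> \<le> (\<Sum>i. ?\<mu> (R (2*i+0))) + (\<Sum>i. ?\<mu> (R (2*i+1)))"
        by (intro add_mono sum_le_suminf) auto
      also have "\<dots> \<le> ?\<mu> A + ?\<mu> A"
        by (intro add_mono half)
      finally show ?thesis .
    qed
    then have "(\<Sum>i. ?\<mu> (R i)) \<le> ?\<mu> A + ?\<mu> A"
      by (intro suminf_le_const) auto
    then have "(\<Sum>i. ?\<mu> (R i)) \<noteq> \<infinity>"
      using fin ennreal_add_less_top[of "?\<mu> A" "?\<mu> A"] by (auto simp: top_unique)
    then have tail: "(\<lambda>k. \<Sum>i. ?\<mu> (R (i + k))) \<longlonglongrightarrow> 0"
    proof -
      have "(\<lambda>k. (\<Sum>i. ?\<mu> (R i)) - (\<Sum>i<k. ?\<mu> (R i))) \<longlonglongrightarrow> (\<Sum>i. ?\<mu> (R i)) - (\<Sum>i. ?\<mu> (R i))"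
        using \<open>(\<Sum>i. ?\<mu> (R i)) \<noteq> \<infinity>\<close>
        by (intro tendsto_diff_ennreal tendsto_const summable_LIMSEQ) auto
      moreover have "(\<Sum>i. ?\<mu> (R i)) - (\<Sum>i<k. ?\<mu> (R i)) = (\<Sum>i. ?\<mu> (R (i + k)))" for k
      proof -
        have "(\<Sum>i<k. ?\<mu> (R i)) \<le> (\<Sum>i. ?\<mu> (R i))"
          by (intro sum_le_suminf) auto
        then have "(\<Sum>i<k. ?\<mu> (R i)) \<noteq> \<infinity>"
          using \<open>(\<Sum>i. ?\<mu> (R i)) \<noteq> \<infinity>\<close> by (metis infinity_ennreal_def top_unique)
        then show ?thesis
          by (subst suminf_offset[of _ k]) simp_all
      qed
      ultimately show ?thesis
        using \<open>(\<Sum>i. ?\<mu> (R i)) \<noteq> \<infinity>\<close> by simp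
    qed
    have split: "?\<mu> (A \<inter> K) + ?\<mu> (A - K) \<le> ?\<mu> A + (\<Sum>i. ?\<mu> (R (i + k)))" for k
    proof -
      have "A - K \<subseteq> F k \<union> (\<Union>i. R (i + k))"
      proof
        fix x assume x: "x \<in> A - K"
        then have "D x > 0"
          using assms \<open>K \<noteq> {}\<close> by (simp add: D_def infdist_pos_not_in_closed)
        show "x \<in> F k \<union> (\<Union>i. R (i + k))"
        proof (cases "D x \<ge> 1 / Suc k")
          case False
          define P where "P m \<longleftrightarrow> 1 / real (m + 2) \<le> D x" for m
          obtain m0 where "inverse (real (Suc m0)) < D x"
            using reals_Archimedean[OF \<open>D x > 0\<close>] by blast
          moreover have "1 / real (m0 + 2) \<le> inverse (real (Suc m0))"
            by (simp add: field_simps)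
          ultimately have "P m0" by (simp add: P_def)
          define m where "m = (LEAST m. P m)"
          have Pm: "P m" and least: "\<And>j. j < m \<Longrightarrow> \<not> P j"
            unfolding m_def using \<open>P m0\<close> by (auto intro: LeastI dest: not_less_Least)
          have "k \<le> m"
          proof (rule ccontr)
            assume "\<not> k \<le> m"
            then have "1 / real (Suc k) \<le> 1 / real (m + 2)"
              by (intro divide_left_mono) auto
            with Pm False show False by (auto simp: P_def)
          qed
          have "D x < 1 / real (m + 1)"
          proof (cases "m = k")
            case True
            then show ?thesis using False by simp
          next
            case False
            then have "\<not> P (m - 1)" using least[of "m - 1"] \<open>k \<le> m\<close> by auto
            then show ?thesis using False \<open>k \<le> m\<close> by (simp add: P_def algebra_simps of_nat_diff)
          qed
          then have "x \<in> R ((m - k) + k)"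
            using Pm x \<open>k \<le> m\<close> by (auto simp: R_def P_def)
          then show ?thesis by blast
        qed (use x in \<open>auto simp: F_def\<close>)
      qed
      then have "?\<mu> (A - K) \<le> ?\<mu> (F k) + ?\<mu> (\<Union>i. R (i + k))"
        by (meson hausdorff_outer_Un hausdorff_outer_mono order_trans)
      also have "\<dots> \<le> ?\<mu> (F k) + (\<Sum>i. ?\<mu> (R (i + k)))"
        by (intro add_left_mono hausdorff_outer_UN)
      finally have "?\<mu> (A \<inter> K) + ?\<mu> (A - K) \<le> (?\<mu> (A \<inter> K) + ?\<mu> (F k)) + (\<Sum>i. ?\<mu> (R (i + k)))"
        by (simp add: add.assoc add_left_mono)
      also have "\<dots> \<le> ?\<mu> A + (\<Sum>i. ?\<mu> (R (i + k)))"
        by (intro add_right_mono far)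
      finally show ?thesis .
    qed
    have "(\<lambda>k. ?\<mu> A + (\<Sum>i. ?\<mu> (R (i + k)))) \<longlonglongrightarrow> ?\<mu> A + 0"
      by (intro tendsto_add tendsto_const tail)
    then show ?thesis
      using split by (intro LIMSEQ_le_const[where X = "\<lambda>k. ?\<mu> A + (\<Sum>i. ?\<mu> (R (i + k)))"]) auto
  qed (auto simp: top_unique)
  moreover have "?\<mu> A \<le> ?\<mu> (A \<inter> K) + ?\<mu> (A - K)" for A
    using hausdorff_outer_Un[of d "A \<inter> K" "A - K"] by (simp add: Int_Diff_Un)
  ultimately have "?\<mu> (A \<inter> K) + ?\<mu> (A - K) = ?\<mu> A" for A
    by (intro antisym)
  then show ?thesis
    unfolding algebra.lambda_system_eq[OF algebra_Pow] by simp
qed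

lemma measure_space_hausdorff_outer:
  "measure_space UNIV (sets borel) (hausdorff_outer d :: 'a::metric_space set \<Rightarrow> ennreal)"
proof -
  let ?L = "lambda_system UNIV (Pow UNIV) (hausdorff_outer d :: 'a set \<Rightarrow> ennreal)"
  have ms: "measure_space UNIV ?L (hausdorff_outer d)"
    using sigma_algebra.caratheodory_lemma[OF sigma_algebra_Pow outer_measure_space_hausdorff_outer] .
  then have "sigma_algebra UNIV ?L" by (simp add: measure_space_def)
  moreover have "Collect closed \<subseteq> ?L"
    using closed_in_lambda_system_hausdorff_outer by blast
  ultimately have "sigma_sets UNIV (Collect closed) \<subseteq> ?L"
    by (rule sigma_algebra.sigma_sets_subset)
  then have "sets (borel :: 'a measure) \<subseteq> ?L"
    by (simp add: borel_eq_closed)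
  then show ?thesis
    using measure_down[OF ms] sets.sigma_algebra_axioms[of "borel :: 'a measure"] by auto
qed

lemma emeasure_hausdorff_measure:
  assumes "A \<in> sets borel"
  shows "emeasure (hausdorff_measure d) A = hausdorff_outer d A"
  using measure_space_hausdorff_outer[of d] assms
  unfolding hausdorff_measure_def
  by (intro emeasure_measure_of_sigma) (auto simp: measure_space_def)


section \<open>Domains with continuously differentiable boundary\<close>

definition is_domain :: "'a::topological_space set \<Rightarrow> bool" where
  "is_domain \<Omega> \<longleftrightarrow> \<Omega> \<noteq> {} \<and> connected \<Omega> \<and> open \<Omega>"

definition C1_fun :: "('a::real_inner \<Rightarrow> real) \<Rightarrow> bool" where
  "C1_fun g \<longleftrightarrow> (\<exists>G. (\<forall>z. GDERIV g z :> G z) \<and> continuous_on UNIV G)"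

definition rigid_motion :: "('a::real_inner \<Rightarrow> 'a) \<Rightarrow> bool" where
  "rigid_motion T \<longleftrightarrow> (\<exists>a f. orthogonal_transformation f \<and> T = (\<lambda>x. a + f x))"

definition zero_coord :: "'n \<Rightarrow> real ^ 'n \<Rightarrow> real ^ 'n" where
  "zero_coord k z = (\<chi> i. if i = k then 0 else z $ i)"

text \<open>
  A \<open>C\<^sup>1\<close> function of the \<open>n - 1\<close> coordinates other than the \<open>k\<close>-th is given as a \<open>C\<^sup>1\<close> function
  \<open>g\<close> on the whole space which is only evaluated on the hyperplane \<open>z $ k = 0\<close>.
\<close>

definition C1_boundary :: "(real ^ 'n) set \<Rightarrow> bool" where
  "C1_boundary \<Omega> \<longleftrightarrow>
     (\<forall>x\<in>frontier \<Omega>. \<exists>r>0. \<exists>T k g. rigid_motion T \<and> C1_fun g \<and>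
        \<Omega> \<inter> ball x r = {y \<in> ball x r. T y $ k < g (zero_coord k (T y))})"

definition tangent_vectors :: "'a::real_normed_vector set \<Rightarrow> 'a \<Rightarrow> 'a set" where
  "tangent_vectors S x =
     {v. \<exists>\<gamma> :: real \<Rightarrow> 'a. \<gamma> 0 = x \<and> (\<exists>\<epsilon>>0. \<forall>t. \<bar>t\<bar> < \<epsilon> \<longrightarrow> \<gamma> t \<in> S) \<and>
           (\<gamma> has_vector_derivative v) (at 0)}"

definition outward_unit_normal :: "'a::real_inner set \<Rightarrow> 'a \<Rightarrow> 'a" where
  "outward_unit_normal \<Omega> x =
     (THE \<nu>. norm \<nu> = 1 \<and> (\<forall>v\<in>tangent_vectors (frontier \<Omega>) x. v \<bullet> \<nu> = 0) \<and>
        (\<forall>\<^sub>F t in at_right 0. x - t *\<^sub>R \<nu> \<in> \<Omega> \<and> x + t *\<^sub>R \<nu> \<notin> \<Omega>))"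

definition surface_measure :: "(real ^ 'n) set \<Rightarrow> (real ^ 'n) measure" where
  "surface_measure \<Omega> = restrict_space (hausdorff_measure (CARD('n) - 1)) (frontier \<Omega>)"

text \<open>
  On the diagonal the integrand is \<open>0 / 0 = 0\<close>, so that the integral below is the one over the
  pairs \<open>x \<noteq> y\<close>.
\<close>

definition normal_energy :: "(real ^ 'n) set \<Rightarrow> ennreal" where
  "normal_energy \<Omega> =
     (\<integral>\<^sup>+ (x, y). ennreal
          (\<bar>(outward_unit_normal \<Omega> x \<bullet> (y - x)) * ((y - x) \<bullet> outward_unit_normal \<Omega> y)\<bar>
             / norm (x - y) ^ (CARD('n) + 1))
        \<partial>(surface_measure \<Omega> \<Otimes>\<^sub>M surface_measure \<Omega>))"

end

(*
  Write w = y - x and let n be the dimension. For fixed x the integrand is |<n(x), w>| / |w| times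
  the Jacobian of the radial projection of the boundary from x onto the unit sphere. Hence
  integrating it over a piece A of the boundary gives a constant times the volume of the cone over A
  with apex x, cut off at |z|^(n+1) < |<n(x), z>| and counted with multiplicity. Every ray from x into
  the domain leaves it again, so the cone over the whole boundary contains all z of the truncated half
  space |z|^(n+1) < -<n(x), z>, whose volume does not depend on x. If the domain is convex, nothing
  else occurs and every ray meets the boundary once, so equality holds. If it is not convex, some
  boundary point sees a point of the domain on the outer side of its tangent plane. This persists
  under small perturbations of both points and yields additional volume for a set of boundary points
  of positive measure.

  Hausdorff measure enters only through the area formula for C1 graphs. That formula follows from
  the uniqueness of translation-invariant measures on a hyperplane and from the fact that a C1
  parametrization is locally almost isometric to its derivative.
*)
theory Submission
  imports Defs
begin

section \<open>Hausdorff measure of Lipschitz images\<close>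

text \<open>The weight of a direction is stored in a volume: on the ray in direction w the
  truncation keeps a segment of length rho with rho^n = |<\<nu>,w>| / |w|, and t^(n-1) integrates
  over it to rho^n / n. Hence the constant is \<open>hausdorff_factor\<close> times n times the
  volume of \<open>inner_cone\<close>. The parametrization \<open>param\<close> of a graph ignores
  the coordinate normal to its hyperplane, and \<open>cone_map\<close> uses this idle coordinate as
  the scale along the ray. Cones over graphs thus become differentiable images of n-dimensional
  sets, to which the change of variables in dimension n applies. It bounds the volume of an image by
  the integral of the Jacobian, with equality for injective maps; for cones the inequality yields
  the lower bound for every domain, and equality is invoked for convex domains. Charts use different
  coordinates k but must share one normalization of Hausdorff measure, so the area formula is stated
  with the factor of an arbitrary coordinate j. The equality case compares integrals through the
  pointwise excess. This requires that the boundary has finite measure and that every boundary patch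
  has positive measure.\<close>

lemma hausdorff_outer_Lipschitz_image:
  fixes f :: "'a::metric_space \<Rightarrow> 'b::metric_space"
  assumes c: "c > 0" and lip: "\<And>a b. a \<in> A \<Longrightarrow> b \<in> A \<Longrightarrow> dist (f a) (f b) \<le> c * dist a b"
  shows "hausdorff_outer d (f ` A) \<le> ennreal (c ^ d) * hausdorff_outer d A"
proof -
  have pre: "hausdorff_pre d (c * \<delta>) (f ` A) \<le> ennreal (c ^ d) * hausdorff_pre d \<delta> A" if \<delta>: "\<delta> > 0" for \<delta>
  proof -
    have "hausdorff_pre d (c * \<delta>) (f ` A) \<le> ennreal (c ^ d) * (\<Sum>i. hausdorff_gauge d (C i))"
      if C: "A \<subseteq> (\<Union>i. C i)" "\<forall>i::nat. bounded (C i) \<and> diameter (C i) \<le> \<delta>" for C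
    proof -
      \<comment> \<open>The Lipschitz bound holds on \<open>A\<close> only, so the cover is cut down
        to \<open>A\<close> before it is mapped. Diameters grow by at most the factor
        \<open>c\<close>, hence gauges by at most \<open>c ^ d\<close>.\<close>
      define D where "D i = f ` (C i \<inter> A)" for i
      have dist_D: "dist x y \<le> c * diameter (C i)" if xy: "x \<in> D i" "y \<in> D i" for x y i
      proof -
        obtain a b where ab: "a \<in> C i" "a \<in> A" "b \<in> C i" "b \<in> A" "x = f a" "y = f b"
          using xy by (auto simp: D_def)
        have "dist x y \<le> c * dist a b" using lip ab by simp
        also have "\<dots> \<le> c * diameter (C i)"
          using C(2) ab c by (intro mult_left_mono diameter_bounded_bound) auto
        finally show ?thesis .
      qed
      have bD: "bounded (D i)" for i
      proof (cases "D i = {}")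
        case False
        then obtain x where "x \<in> D i" by blast
        then show ?thesis unfolding bounded_def using dist_D by blast
      qed simp
      have diamD: "diameter (D i) \<le> c * diameter (C i)" if "D i \<noteq> {}" for i
      proof -
        have "(SUP (x, y)\<in>D i \<times> D i. dist x y) \<le> c * diameter (C i)"
        proof (rule cSUP_least)
          fix p assume "p \<in> D i \<times> D i"
          then show "(case p of (x, y) \<Rightarrow> dist x y) \<le> c * diameter (C i)" by (cases p) (simp add: dist_D)
        qed (use that in simp)
        then show ?thesis using that by (simp add: diameter_def)
      qed
      have dC: "0 \<le> diameter (C i)" for i using C(2) diameter_ge_0 by blast
      have "hausdorff_pre d (c * \<delta>) (f ` A) \<le> (\<Sum>i. hausdorff_gauge d (D i))"
        unfolding hausdorff_pre_def
      proof (rule INF_lower, safe)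
        fix a assume "a \<in> A"
        then obtain i where "a \<in> C i" using C(1) by auto
        with \<open>a \<in> A\<close> show "f a \<in> (\<Union>i. D i)" by (auto simp: D_def)
      next
        fix i
        show "bounded (D i)" by fact
        have "diameter (D i) \<le> c * diameter (C i)"
          using diamD[of i] dC[of i] c by (cases "D i = {}") auto
        also have "\<dots> \<le> c * \<delta>" using C(2) c by auto
        finally show "diameter (D i) \<le> c * \<delta>" .
      qed
      also have "\<dots> \<le> (\<Sum>i. ennreal (c ^ d) * hausdorff_gauge d (C i))"
      proof (intro suminf_le allI)
        fix i
        show "hausdorff_gauge d (D i) \<le> ennreal (c ^ d) * hausdorff_gauge d (C i)"
        proof (cases "D i = {}")
          case False
          then have "C i \<noteq> {}" by (auto simp: D_def)
          have "(diameter (D i) / 2) ^ d \<le> (c * (diameter (C i) / 2)) ^ d"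
            using diamD[OF False] diameter_ge_0[OF bD] by (intro power_mono) auto
          then have "(diameter (D i) / 2) ^ d \<le> c ^ d * (diameter (C i) / 2) ^ d"
            by (simp only: power_mult_distrib)
          then have "unit_ball_vol (real d) * (diameter (D i) / 2) ^ d
             \<le> unit_ball_vol (real d) * (c ^ d * (diameter (C i) / 2) ^ d)"
            by (intro mult_left_mono) auto
          then have "unit_ball_vol (real d) * (diameter (D i) / 2) ^ d
             \<le> c ^ d * (unit_ball_vol (real d) * (diameter (C i) / 2) ^ d)"
            by (simp only: mult.left_commute)
          then show ?thesis
            using False \<open>C i \<noteq> {}\<close> c dC[of i]
            by (simp add: hausdorff_gauge_def ennreal_mult[symmetric] del: power_divide)
        qed (simp add: hausdorff_gauge_def)
      qed auto
      finally show ?thesis by simp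
    qed
    then have le: "hausdorff_pre d (c * \<delta>) (f ` A) \<le> ennreal (c ^ d) * (\<Sum>i. hausdorff_gauge d (C i))"
      if "C \<in> {C. A \<subseteq> (\<Union>i. C i) \<and> (\<forall>i::nat. bounded (C i) \<and> diameter (C i) \<le> \<delta>)}" for C
      using that by blast
    have inv: "ennreal (1 / c ^ d) * ennreal (c ^ d) = 1" "ennreal (c ^ d) * ennreal (1 / c ^ d) = 1"
      using c by (simp_all add: ennreal_mult[symmetric])
    \<comment> \<open>The factor is divided out so that \<open>INF_greatest\<close> applies to a
      bare infimum, and multiplied back afterwards.\<close>
    have "ennreal (1 / c ^ d) * hausdorff_pre d (c * \<delta>) (f ` A) \<le> hausdorff_pre d \<delta> A"
      unfolding hausdorff_pre_def[of d \<delta> A]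
    proof (rule INF_greatest)
      fix C assume "C \<in> {C. A \<subseteq> (\<Union>i. C i) \<and> (\<forall>i::nat. bounded (C i) \<and> diameter (C i) \<le> \<delta>)}"
      from mult_left_mono[OF le[OF this], of "ennreal (1 / c ^ d)"]
      show "ennreal (1 / c ^ d) * hausdorff_pre d (c * \<delta>) (f ` A) \<le> (\<Sum>i. hausdorff_gauge d (C i))"
        by (simp only: mult.assoc[symmetric] inv mult_1 zero_le)
    qed
    from mult_left_mono[OF this, of "ennreal (c ^ d)"] show ?thesis
      by (simp only: mult.assoc[symmetric] inv mult_1 zero_le)
  qed
  show ?thesis
    unfolding hausdorff_outer_def[of d "f ` A"]
  proof (rule SUP_least)
    fix \<delta> :: real assume "\<delta> \<in> {0<..}"
    then have "hausdorff_pre d \<delta> (f ` A) \<le> ennreal (c ^ d) * hausdorff_pre d (\<delta> / c) A"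
      using pre[of "\<delta> / c"] c by simp
    also have "\<dots> \<le> ennreal (c ^ d) * hausdorff_outer d A"
      unfolding hausdorff_outer_def using \<open>\<delta> \<in> _\<close> c
      by (intro mult_left_mono SUP_upper) auto
    finally show "hausdorff_pre d \<delta> (f ` A) \<le> ennreal (c ^ d) * hausdorff_outer d A" .
  qed
qed

text \<open>The Lipschitz bound with constant 1 applies to \<open>f\<close> and to its inverse on
  the image.\<close>

lemma hausdorff_outer_isometry_image:
  assumes "\<And>a b. a \<in> A \<Longrightarrow> b \<in> A \<Longrightarrow> dist (f a) (f b) = dist a b"
  shows "hausdorff_outer d (f ` A) = hausdorff_outer d A"
proof (rule antisym)
  show "hausdorff_outer d (f ` A) \<le> hausdorff_outer d A"
    using hausdorff_outer_Lipschitz_image[of 1 A f d] assms by simp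
  have inj: "inj_on f A" using assms by (metis dist_eq_0_iff inj_onI)
  then have "inv_into A f ` f ` A = A" by simp
  moreover have "dist (inv_into A f x) (inv_into A f y) = dist x y" if "x \<in> f ` A" "y \<in> f ` A" for x y
    using that assms by (metis f_inv_into_f inv_into_into)
  ultimately show "hausdorff_outer d A \<le> hausdorff_outer d (f ` A)"
    using hausdorff_outer_Lipschitz_image[of 1 "f ` A" "inv_into A f" d] by simp
qed

lemma hausdorff_outer_translation:
  fixes A :: "'a::real_normed_vector set"
  shows "hausdorff_outer d ((+) a ` A) = hausdorff_outer d A"
  by (rule hausdorff_outer_isometry_image) simp

lemma hausdorff_outer_orthogonal_image:
  assumes "orthogonal_transformation f"
  shows "hausdorff_outer d (f ` A) = hausdorff_outer d A"
  using assms
  by (intro hausdorff_outer_isometry_image)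
    (simp add: orthogonal_transformation dist_norm flip: linear_diff)

section \<open>Volume of differentiable images\<close>

abbreviation jacobian_integral :: "(real ^ 'n \<Rightarrow> real ^ 'n \<Rightarrow> real ^ 'n) \<Rightarrow> (real ^ 'n) set \<Rightarrow> ennreal" where
  "jacobian_integral f' S \<equiv> (\<integral>\<^sup>+x. ennreal \<bar>det (matrix (f' x))\<bar> * indicator S x \<partial>lborel)"

text \<open>Proved by exhaustion: on \<open>T m\<close> both the norm of the point and the Jacobian
  are at most \<open>m\<close>, so the Jacobian is integrable there, and monotone convergence passes
  to all of \<open>S\<close>.\<close>

lemma emeasure_differentiable_image_aux:
  fixes f :: "real^'n::{finite,wellorder} \<Rightarrow> real^'n::_"
  assumes S: "S \<in> sets lebesgue"
    and f': "\<And>x. x \<in> S \<Longrightarrow> (f has_derivative f' x) (at x within S)"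
  shows "f ` S \<in> sets lebesgue \<and>
     emeasure lebesgue (f ` S) \<le> jacobian_integral f' S \<and>
     (inj_on f S \<longrightarrow>
       emeasure lebesgue (f ` S) = jacobian_integral f' S)"
proof -
  define J where "J x = \<bar>det (matrix (f' x))\<bar>" for x
  define T where "T m = {x \<in> S. norm x \<le> real m \<and> J x \<le> real m}" for m :: nat
  have TS: "T m \<subseteq> S" for m by (auto simp: T_def)
  have incT: "incseq T"
    unfolding incseq_def T_def by (auto intro: order_trans)
  have UT: "(\<Union>m. T m) = S"
  proof -
    have "\<exists>m. x \<in> T m" if "x \<in> S" for x
    proof -
      obtain m :: nat where "max (norm x) (J x) \<le> real m" using real_arch_simple by blast
      then show ?thesis using that by (auto simp: T_def)
    qed
    then show ?thesis using TS by blast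
  qed
  have Jm: "J \<in> borel_measurable (lebesgue_on S)"
    unfolding J_def using borel_measurable_det_Jacobian[OF S f'] by simp
  have Tl: "T m \<in> sets lebesgue" for m
  proof -
    have "{x \<in> space (lebesgue_on S). norm x \<le> real m \<and> J x \<le> real m} \<in> sets (lebesgue_on S)"
    proof -
      note Jm [measurable]
      have [measurable]: "norm \<in> borel_measurable (lebesgue_on S)"
        by (intro measurable_restrict_space1 measurable_completion) auto
      show ?thesis by measurable
    qed
    then show ?thesis
      using S by (auto simp: T_def sets_restrict_space_iff space_restrict_space)
  qed
  have bT: "bounded (T m)" for m
    unfolding bounded_iff T_def by auto
  have Tlm: "T m \<in> lmeasurable" for m
    using Tl bT by (rule bounded_set_imp_lmeasurable[rotated])
  have der: "(f has_derivative f' x) (at x within T m)" if "x \<in> T m" for x m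
    using that TS f' by (blast intro: has_derivative_subset)
  have int: "J integrable_on T m" for m
  proof (rule measurable_bounded_by_integrable_imp_integrable)
    show "J \<in> borel_measurable (lebesgue_on (T m))"
      using Jm TS by (blast intro: measurable_restrict_mono)
    show "(\<lambda>x. real m) integrable_on T m"
      using Tlm by (simp add: integrable_on_const)
  qed (use Tl in \<open>auto simp: T_def J_def\<close>)
  have nn: "ennreal (integral (T m) J) = (\<integral>\<^sup>+x. ennreal (J x) * indicator (T m) x \<partial>lborel)" for m
  proof (rule nn_integral_has_integral_lebesgue'[symmetric])
    show "(J has_integral integral (T m) J) (T m)" using int by (rule integrable_integral)
  qed (simp add: J_def)
  have im: "f ` T m \<in> lmeasurable" for m
    using measurable_differentiable_image[OF Tl der] int by (simp add: J_def[abs_def])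
  have le: "emeasure lebesgue (f ` T m) \<le> (\<integral>\<^sup>+x. ennreal (J x) * indicator (T m) x \<partial>lborel)" for m
    using measure_differentiable_image[OF Tl der] int
    by (simp add: J_def[abs_def] emeasure_eq_measure2[OF im] nn[unfolded J_def, symmetric] ennreal_leI)
  have eq: "emeasure lebesgue (f ` T m) = (\<integral>\<^sup>+x. ennreal (J x) * indicator (T m) x \<partial>lborel)"
    if "inj_on f S" for m
    using measure_differentiable_image_eq[OF Tl der inj_on_subset[OF that TS]] int
    by (simp add: J_def[abs_def] emeasure_eq_measure2[OF im] nn[unfolded J_def, symmetric])
  have fS: "f ` S = (\<Union>m. f ` T m)" using UT by blast
  have ems: "emeasure lebesgue (f ` S) = (SUP m. emeasure lebesgue (f ` T m))"
    unfolding fS using im incT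
    by (intro SUP_emeasure_incseq[symmetric]) (auto simp: incseq_def fmeasurableD intro!: image_mono)
  have sup: "(\<integral>\<^sup>+x. ennreal (J x) * indicator S x \<partial>lborel)
      = (SUP m. (\<integral>\<^sup>+x. ennreal (J x) * indicator (T m) x \<partial>lborel))"
  proof -
    have "(\<lambda>x. ennreal (J x) * indicator (T m) x) \<in> borel_measurable lebesgue" for m
    proof -
      have "(\<lambda>x. ennreal (J x)) \<in> borel_measurable (lebesgue_on (T m))"
        using measurable_restrict_mono[OF Jm TS] by simp
      then show ?thesis
        by (rule borel_measurable_restrict_space_iff_ennreal[THEN iffD1, rotated]) (use Tl in simp)
    qed
    moreover have "incseq (\<lambda>m x. ennreal (J x) * indicator (T m) x)"
      using incT by (auto simp: incseq_def le_fun_def indicator_def)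
    ultimately have "(\<integral>\<^sup>+x. (SUP m. ennreal (J x) * indicator (T m) x) \<partial>lebesgue)
       = (SUP m. (\<integral>\<^sup>+x. ennreal (J x) * indicator (T m) x \<partial>lebesgue))"
      by (intro nn_integral_monotone_convergence_SUP) auto
    moreover have "(SUP m. ennreal (J x) * indicator (T m) x) = ennreal (J x) * indicator S x" for x
    proof -
      have "(SUP m. ennreal (J x) * indicator (T m) x) = ennreal (J x) * (SUP m. indicator (T m) x)"
        by (rule SUP_mult_left_ennreal[symmetric])
      also have "(SUP m. indicator (T m) x :: ennreal) = indicator S x"
      proof (cases "x \<in> S")
        case True
        then obtain m where "x \<in> T m" using UT by blast
        then show ?thesis using True
          by (intro antisym SUP_least SUP_upper2[of m]) (auto simp: indicator_def)
      next
        case False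
        then have "\<And>m. x \<notin> T m" using TS by blast
        then show ?thesis using False by simp
      qed
      finally show ?thesis .
    qed
    ultimately show ?thesis by (simp add: nn_integral_completion)
  qed
  have "f ` S \<in> sets lebesgue" unfolding fS using im by (auto simp: fmeasurableD)
  moreover have "emeasure lebesgue (f ` S) \<le> (\<integral>\<^sup>+x. ennreal (J x) * indicator S x \<partial>lborel)"
    unfolding ems sup by (intro SUP_mono') (rule le)
  ultimately show ?thesis
    using ems sup eq by (auto simp: J_def)
qed

text \<open>
  The change of variables theorem of the library is stated for index types that carry a well-order.
  A copy of a finite type with an order borrowed from the natural numbers removes this restriction.
\<close>

typedef 'a ordered_copy = "UNIV :: 'a::finite set" by simp

instance ordered_copy :: (finite) finite
proof
  have "UNIV \<subseteq> range (Abs_ordered_copy :: 'a \<Rightarrow> _)"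
  proof
    fix x :: "'a ordered_copy"
    show "x \<in> range Abs_ordered_copy"
      by (cases x) blast
  qed
  then show "finite (UNIV :: 'a ordered_copy set)"
    by (rule finite_subset) simp
qed

instantiation ordered_copy :: (finite) wellorder
begin

definition less_eq_ordered_copy :: "'a ordered_copy \<Rightarrow> 'a ordered_copy \<Rightarrow> bool" where
  "less_eq_ordered_copy x y \<longleftrightarrow> to_nat (Rep_ordered_copy x) \<le> to_nat (Rep_ordered_copy y)"

definition less_ordered_copy :: "'a ordered_copy \<Rightarrow> 'a ordered_copy \<Rightarrow> bool" where
  "less_ordered_copy x y \<longleftrightarrow> to_nat (Rep_ordered_copy x) < to_nat (Rep_ordered_copy y)"

instance
proof
  fix P :: "'a ordered_copy \<Rightarrow> bool" and a
  assume step: "\<And>x. (\<And>y. y < x \<Longrightarrow> P y) \<Longrightarrow> P x"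
  show "P a"
  proof (induction a rule: measure_induct_rule[of "\<lambda>x. to_nat (Rep_ordered_copy x)"])
    case (less x)
    show ?case by (rule step, rule less) (simp add: less_ordered_copy_def)
  qed
next
  fix x y :: "'a ordered_copy"
  assume "x \<le> y" "y \<le> x"
  then show "x = y"
    by (simp add: less_eq_ordered_copy_def Rep_ordered_copy_inject)
qed (auto simp: less_eq_ordered_copy_def less_ordered_copy_def)

end

definition relabel :: "real ^ ('n::finite ordered_copy) \<Rightarrow> real ^ 'n" where
  "relabel x = (\<chi> i. x $ Abs_ordered_copy i)"

definition unrelabel :: "real ^ 'n::finite \<Rightarrow> real ^ ('n ordered_copy)" where
  "unrelabel x = (\<chi> i. x $ Rep_ordered_copy i)"

lemma relabel_unrelabel [simp]: "relabel (unrelabel x) = x" "unrelabel (relabel y) = y"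
  by (simp_all add: relabel_def unrelabel_def vec_eq_iff Abs_ordered_copy_inverse Rep_ordered_copy_inverse)

lemma all_ordered_copy: "(\<forall>j. P j) \<longleftrightarrow> (\<forall>i. P (Abs_ordered_copy i))"
  by (metis Rep_ordered_copy_inverse)

lemma bij_Rep_ordered_copy: "bij Rep_ordered_copy"
  by (metis Abs_ordered_copy_inverse Rep_ordered_copy_inverse UNIV_I bijI')

lemma bij_Abs_ordered_copy: "bij Abs_ordered_copy"
  by (metis Abs_ordered_copy_inverse Rep_ordered_copy_inverse UNIV_I bijI')

lemma bounded_linear_relabel: "bounded_linear relabel" "bounded_linear unrelabel"
  by (auto intro!: linear_conv_bounded_linear[THEN iffD1] linearI
      simp: relabel_def unrelabel_def vec_eq_iff)

lemma prod_Basis_cart: "(\<Prod>b\<in>(Basis :: (real ^ 'n) set). f b) = (\<Prod>i\<in>UNIV. f (axis i 1))"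
proof -
  have B: "(Basis :: (real ^ 'n) set) = range (\<lambda>i. axis i 1)"
    by (auto simp: Basis_vec_def)
  have "inj (\<lambda>i. axis i 1 :: real ^ 'n)"
    by (simp add: inj_on_def axis_eq_axis)
  from prod.reindex[OF this, of f] show ?thesis
    unfolding B o_def .
qed

text \<open>Relabelling coordinates maps boxes to boxes with the same side lengths, and boxes
  determine Lebesgue measure.\<close>

lemma distr_unrelabel: "distr lborel borel unrelabel = (lborel :: (real ^ ('n::finite ordered_copy)) measure)"
proof (rule lborel_eqI[symmetric])
  have [measurable]: "(unrelabel :: real ^ 'n \<Rightarrow> _) \<in> borel_measurable borel"
    using bounded_linear_relabel(2) by (intro borel_measurable_continuous_onI linear_continuous_on)
  fix l u :: "real ^ ('n ordered_copy)"
  assume le: "\<And>b. b \<in> Basis \<Longrightarrow> l \<bullet> b \<le> u \<bullet> b"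
  have lu: "l $ i \<le> u $ i" for i
    using le[of "axis i 1"] by (simp add: axis_in_Basis_iff inner_axis)
  have "unrelabel -` box l u = box (relabel l) (relabel u)"
    by (auto simp: mem_box_cart relabel_def unrelabel_def all_ordered_copy Abs_ordered_copy_inverse)
  then have "emeasure (distr lborel borel unrelabel) (box l u) = emeasure lborel (box (relabel l) (relabel u))"
    by (simp add: emeasure_distr)
  also have "\<dots> = (\<Prod>b\<in>Basis. (relabel u - relabel l) \<bullet> b)"
    using lu by (intro emeasure_lborel_box) (auto simp: Basis_vec_def inner_axis relabel_def)
  also have "(\<Prod>b\<in>Basis. (relabel u - relabel l) \<bullet> b) = (\<Prod>i\<in>UNIV. (u - l) $ Abs_ordered_copy i)"
    by (simp add: prod_Basis_cart inner_axis relabel_def)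
  also have "\<dots> = (\<Prod>j\<in>UNIV. (u - l) $ j)"
    by (rule prod.reindex_bij_witness[of _ Rep_ordered_copy Abs_ordered_copy])
       (auto simp: Rep_ordered_copy_inverse Abs_ordered_copy_inverse)
  also have "\<dots> = (\<Prod>b\<in>Basis. (u - l) \<bullet> b)"
    by (simp add: prod_Basis_cart inner_axis)
  finally show "emeasure (distr lborel borel unrelabel) (box l u) = (\<Prod>b\<in>Basis. (u - l) \<bullet> b)" .
qed simp

lemma distr_relabel: "distr lborel borel relabel = (lborel :: (real ^ 'n::finite) measure)"
proof -
  have [measurable]: "(unrelabel :: real ^ 'n \<Rightarrow> _) \<in> borel_measurable borel" "(relabel :: _ \<Rightarrow> real ^ 'n) \<in> borel_measurable borel"
    using bounded_linear_relabel by (auto intro!: borel_measurable_continuous_onI linear_continuous_on)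
  have "distr lborel borel (relabel :: _ \<Rightarrow> real ^ 'n) = distr (distr lborel borel unrelabel) borel relabel"
    by (simp add: distr_unrelabel)
  also have "\<dots> = distr lborel lborel (relabel \<circ> unrelabel)"
    by (subst distr_distr) (auto cong: distr_cong)
  finally show ?thesis by (simp add: o_def distr_id)
qed

text \<open>A measure-preserving Borel map pulls null sets back to null sets, so it stays measurable
  and measure preserving for the completed measures.\<close>

lemma
  fixes f :: "'a::euclidean_space \<Rightarrow> 'b::euclidean_space"
  assumes f: "f \<in> borel_measurable borel" and d: "distr lborel borel f = lborel"
  shows measurable_lebesgue_if_distr_lborel: "f \<in> lebesgue \<rightarrow>\<^sub>M lebesgue"
    and distr_lebesgue_if_distr_lborel: "distr lebesgue lebesgue f = lebesgue"
proof -
  have b: "f \<in> lborel \<rightarrow>\<^sub>M lborel" using f by simp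
  then have m: "f \<in> lebesgue \<rightarrow>\<^sub>M lborel" by (rule measurable_completion)
  have d': "distr lebesgue lborel f = lborel"
    unfolding distr_completion[OF b] using d by (simp cong: distr_cong)
  show "distr lebesgue lebesgue f = lebesgue"
    using completion.completion_distr_eq[OF m] d' by simp
  show "f \<in> lebesgue \<rightarrow>\<^sub>M lebesgue"
    using completion.measurable_completion2[OF m] d' by simp
qed

text \<open>Conjugation with the relabelling is a sign-preserving bijection between the permutations
  of the two index types; it matches the Leibniz sums term by term.\<close>

lemma det_relabel:
  fixes A :: "real ^ 'n ^ 'n"
  shows "det (\<chi> i j. A $ Rep_ordered_copy i $ Rep_ordered_copy j :: real ^ ('n::finite ordered_copy) ^ ('n ordered_copy)) = det A"
proof -
  let ?R = "Rep_ordered_copy :: 'n ordered_copy \<Rightarrow> 'n"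
  let ?m = "map_permutation UNIV ?R"
  have inj: "inj ?R" and surj: "range ?R = UNIV" using bij_Rep_ordered_copy by (auto simp: bij_def)
  have ap: "?m p (?R i) = ?R (p i)" for p i
    using inj by (simp add: map_permutation_apply)
  have "det A = (\<Sum>q | q permutes UNIV. of_int (sign q) * (\<Prod>i\<in>UNIV. A $ i $ q i))"
    by (simp add: det_def)
  also have "\<dots> = (\<Sum>p | p permutes UNIV. of_int (sign (?m p)) * (\<Prod>i\<in>UNIV. A $ i $ ?m p i))"
  proof (rule sum.reindex_bij_betw[symmetric])
    show "bij_betw ?m {p. p permutes UNIV} {q. q permutes UNIV}"
    proof (rule bij_betw_byWitness[where f' = "map_permutation UNIV Abs_ordered_copy"])
      show "\<forall>p\<in>{p. p permutes UNIV}. map_permutation UNIV Abs_ordered_copy (?m p) = p"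
        by (auto intro!: map_permutation_compose_inv[OF bij_Rep_ordered_copy] Rep_ordered_copy_inverse)
      show "\<forall>q\<in>{q. q permutes UNIV}. ?m (map_permutation UNIV Abs_ordered_copy q) = q"
        by (auto intro!: map_permutation_compose_inv[OF bij_Abs_ordered_copy] Abs_ordered_copy_inverse)
    qed (use bij_Rep_ordered_copy bij_Abs_ordered_copy in \<open>auto intro!: map_permutation_permutes\<close>)
  qed
  also have "\<dots> = (\<Sum>p | p permutes UNIV. of_int (sign p) * (\<Prod>i\<in>UNIV. A $ ?R i $ ?R (p i)))"
  proof (rule sum.cong)
    fix p :: "'n ordered_copy \<Rightarrow> _" assume "p \<in> {p. p permutes UNIV}"
    then have "sign (?m p) = sign p" using inj by (intro sign_map_permutation) auto
    moreover have "(\<Prod>i\<in>UNIV. A $ i $ ?m p i) = (\<Prod>i\<in>UNIV. A $ ?R i $ ?m p (?R i))"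
      using bij_Rep_ordered_copy by (intro prod.reindex_bij_betw[symmetric]) auto
    ultimately show "of_int (sign (?m p)) * (\<Prod>i\<in>UNIV. A $ i $ ?m p i)
        = of_int (sign p) * (\<Prod>i\<in>UNIV. A $ ?R i $ ?R (p i))"
      by (simp add: ap)
  qed simp
  finally show ?thesis by (simp add: det_def)
qed


lemma matrix_relabel:
  fixes L :: "real ^ 'n \<Rightarrow> real ^ 'n::finite"
  assumes "linear L"
  shows "matrix (\<lambda>x. unrelabel (L (relabel x))) =
    (\<chi> i j. matrix L $ Rep_ordered_copy i $ Rep_ordered_copy j)"
proof -
  have "relabel (axis j 1) = axis (Rep_ordered_copy j) (1 :: real)" for j :: "'n ordered_copy"
    by (simp add: relabel_def axis_def vec_eq_iff)
       (metis Abs_ordered_copy_inverse Rep_ordered_copy_inverse UNIV_I)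
  then show ?thesis
    by (simp add: matrix_def unrelabel_def)
qed

text \<open>Conjugating \<open>f\<close> with the relabelling of coordinates changes neither
  Lebesgue measure nor the Jacobian determinant, so the version for ordered index types carries
  over.\<close>

theorem
  fixes f :: "real ^ 'n::finite \<Rightarrow> real ^ 'n"
  assumes S: "S \<in> sets lebesgue"
    and f': "\<And>x. x \<in> S \<Longrightarrow> (f has_derivative f' x) (at x within S)"
  shows sets_differentiable_image: "f ` S \<in> sets lebesgue"
    and emeasure_differentiable_image_le:
      "emeasure lebesgue (f ` S) \<le> jacobian_integral f' S"
    and emeasure_differentiable_image_eq: "inj_on f S \<Longrightarrow>
      emeasure lebesgue (f ` S) = jacobian_integral f' S"
proof -
  interpret R: bounded_linear relabel by (rule bounded_linear_relabel)
  interpret U: bounded_linear unrelabel by (rule bounded_linear_relabel)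
  define g where "g y = unrelabel (f (relabel y))" for y
  define g' where "g' y = (\<lambda>h. unrelabel (f' (relabel y) (relabel h)))" for y
  define T where "T = relabel -` S"
  have vT: "unrelabel -` T = S" by (auto simp: T_def)
  have "unrelabel \<in> borel_measurable borel" "relabel \<in> borel_measurable borel"
    by (auto intro!: borel_measurable_continuous_onI linear_continuous_on U.bounded_linear_axioms R.bounded_linear_axioms)
  note relabel_m = measurable_lebesgue_if_distr_lborel[OF this(2) distr_relabel]
    and unrelabel_m = measurable_lebesgue_if_distr_lborel[OF this(1) distr_unrelabel]
    and unrelabel_d = distr_lebesgue_if_distr_lborel[OF this(1) distr_unrelabel]
  have vimage_relabel_sets: "relabel -` A \<in> sets lebesgue" if "A \<in> sets lebesgue" for A :: "(real ^ 'n) set"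
    using measurable_sets[OF relabel_m that] by simp
  have T: "T \<in> sets lebesgue" unfolding T_def using vimage_relabel_sets S by blast
  have der: "(g has_derivative g' y) (at y within T)" if "y \<in> T" for y
  proof -
    have "(f has_derivative f' (relabel y)) (at (relabel y) within relabel ` T)"
      using f' that by (auto simp: T_def intro: has_derivative_subset)
    from diff_chain_within[OF R.has_derivative[OF has_derivative_ident] this]
    have "((\<lambda>y. f (relabel y)) has_derivative (\<lambda>h. f' (relabel y) (relabel h))) (at y within T)"
      by (simp add: o_def)
    from U.has_derivative[OF this] show ?thesis
      by (simp add: g_def[abs_def] g'_def)
  qed
  have det: "det (matrix (g' y)) = det (matrix (f' (relabel y)))" if "y \<in> T" for y
  proof -
    have "linear (f' (relabel y))" using f'[of "relabel y"] that has_derivative_linear by (auto simp: T_def)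
    then show ?thesis unfolding g'_def by (simp add: matrix_relabel det_relabel)
  qed
  have aux: "g ` T \<in> sets lebesgue"
    "emeasure lebesgue (g ` T) \<le> jacobian_integral g' T"
    "inj_on g T \<Longrightarrow>
      emeasure lebesgue (g ` T) = jacobian_integral g' T"
    using emeasure_differentiable_image_aux[OF T der] by blast+
  have "f ` S \<subseteq> unrelabel -` (g ` T)"
  proof
    fix z assume "z \<in> f ` S"
    then obtain x where "x \<in> S" "z = f x" by blast
    then have "unrelabel x \<in> T" "unrelabel z = g (unrelabel x)" by (auto simp: g_def T_def)
    then show "z \<in> unrelabel -` (g ` T)" by blast
  qed
  moreover have "unrelabel -` (g ` T) \<subseteq> f ` S"
  proof
    fix z assume "z \<in> unrelabel -` (g ` T)"
    then obtain y where "y \<in> T" "unrelabel z = unrelabel (f (relabel y))" by (auto simp: g_def)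
    then have "relabel (unrelabel z) = relabel (unrelabel (f (relabel y)))" by simp
    then have "z = f (relabel y)" by simp
    with \<open>y \<in> T\<close> show "z \<in> f ` S" by (simp add: T_def)
  qed
  ultimately have im: "unrelabel -` (g ` T) = f ` S" by blast
  have gT: "g ` T \<in> sets lebesgue" by (rule aux)
  show "f ` S \<in> sets lebesgue"
    using measurable_sets[OF unrelabel_m gT] im by simp
  have em: "emeasure lebesgue (f ` S) = emeasure lebesgue (g ` T)"
    using emeasure_distr[OF unrelabel_m gT] im unfolding unrelabel_d by simp
  have "(\<lambda>x. det (matrix (g' x))) \<in> borel_measurable (lebesgue_on T)"
    by (rule borel_measurable_det_Jacobian[OF T der])
  then have "(\<lambda>x. ennreal \<bar>det (matrix (g' x))\<bar>) \<in> borel_measurable (lebesgue_on T)"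
    by measurable
  then have F: "(\<lambda>x. ennreal \<bar>det (matrix (g' x))\<bar> * indicator T x) \<in> borel_measurable lebesgue"
    by (rule borel_measurable_restrict_space_iff_ennreal[THEN iffD1, rotated]) (use T in simp)
  have "(\<integral>\<^sup>+x. ennreal \<bar>det (matrix (g' x))\<bar> * indicator T x \<partial>lebesgue)
     = (\<integral>\<^sup>+x. ennreal \<bar>det (matrix (g' (unrelabel x)))\<bar> * indicator T (unrelabel x) \<partial>lebesgue)"
    by (subst unrelabel_d[symmetric], rule nn_integral_distr[OF unrelabel_m]) (use F in simp)
  also have "\<dots> = (\<integral>\<^sup>+x. ennreal \<bar>det (matrix (f' x))\<bar> * indicator S x \<partial>lebesgue)"
  proof (intro nn_integral_cong)
    fix x
    have "unrelabel x \<in> T \<longleftrightarrow> x \<in> S" by (simp add: T_def)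
    then show "ennreal \<bar>det (matrix (g' (unrelabel x)))\<bar> * indicator T (unrelabel x)
      = ennreal \<bar>det (matrix (f' x))\<bar> * indicator S x"
      using det[of "unrelabel x"] by (auto simp: indicator_def)
  qed
  finally have int: "jacobian_integral g' T
    = jacobian_integral f' S"
    by (simp add: nn_integral_completion)
  show "emeasure lebesgue (f ` S) \<le> jacobian_integral f' S"
    unfolding em int[symmetric] by (rule aux)
  show "emeasure lebesgue (f ` S) = jacobian_integral f' S"
    if "inj_on f S"
  proof -
    have "inj_on g T"
    proof (rule inj_onI)
      fix x y assume xy: "x \<in> T" "y \<in> T" "g x = g y"
      then have "relabel (g x) = relabel (g y)" by simp
      then have "f (relabel x) = f (relabel y)" by (simp add: g_def)
      then have "relabel x = relabel y" using that xy by (auto simp: T_def inj_on_def)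
      then have "unrelabel (relabel x) = unrelabel (relabel y)" by simp
      then show "x = y" by simp
    qed
    then show ?thesis
      unfolding em int[symmetric] by (rule aux)
  qed
qed


section \<open>Linear algebra of the coordinate projection and of the cone Jacobian\<close>

lemma linear_zero_coord: "linear (zero_coord k)"
  by (auto intro!: linearI simp: zero_coord_def vec_eq_iff)

lemma zero_coord_simps [simp]:
  "zero_coord k z $ k = 0"
  "zero_coord k (axis k a) = 0"
  "zero_coord k (zero_coord k z) = zero_coord k z"
  "zero_coord k (x + y) = zero_coord k x + zero_coord k y"
  "zero_coord k (x - y) = zero_coord k x - zero_coord k y"
  "zero_coord k (a *\<^sub>R x) = a *\<^sub>R zero_coord k x"
  "zero_coord k 0 = 0"
  by (auto simp: zero_coord_def vec_eq_iff axis_def)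

lemma zero_coord_decomp: "zero_coord k z + (z $ k) *\<^sub>R axis k 1 = z"
  by (simp add: zero_coord_def vec_eq_iff axis_def)

lemma zero_coord_id: "z $ k = 0 \<Longrightarrow> zero_coord k z = z"
  by (simp add: zero_coord_def vec_eq_iff)

text \<open>Up to a rotation the map is the derivative of the cone over a graph: \<open>p\<close> is
  the gradient of the graph function, \<open>c\<close> the scale along the ray and \<open>w\<close>
  the ray vector. It factors into \<open>D\<close>, which scales the hyperplane by \<open>c\<close>,
  then \<open>C\<close>, which moves the axis to \<open>w'\<close>, then the shear \<open>B\<close>,
  which tilts the hyperplane to the tangent plane.\<close>

lemma det_graph_cone:
  fixes p w :: "real ^ 'n"
  assumes p: "p $ k = 0"
  shows "det (matrix (\<lambda>h. c *\<^sub>R (zero_coord k h + (p \<bullet> h) *\<^sub>R axis k 1) + (h $ k) *\<^sub>R w))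
    = c ^ (CARD('n) - 1) * (w \<bullet> (axis k 1 - p))"
proof -
  interpret Z: linear "zero_coord k :: real ^ 'n \<Rightarrow> _" by (rule linear_zero_coord)
  \<comment> \<open>Chosen so that the shear \<open>B\<close> maps \<open>w'\<close> to
    \<open>w\<close>; this uses \<open>p $ k = 0\<close>.\<close>
  define w' where "w' = w - (p \<bullet> w) *\<^sub>R axis k 1"
  define B where "B h = h + (p \<bullet> h) *\<^sub>R axis k 1" for h :: "real ^ 'n"
  define C where "C h = zero_coord k h + (h $ k) *\<^sub>R w'" for h :: "real ^ 'n"
  define D where "D h = c *\<^sub>R zero_coord k h + (h $ k) *\<^sub>R axis k 1" for h :: "real ^ 'n"
  have lin: "linear B" "linear C" "linear D"
    unfolding B_def C_def D_def
    by (auto intro!: linearI simp: algebra_simps inner_right_distrib)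
  have pk: "p \<bullet> axis k 1 = 0" using p by (simp add: inner_axis)
  have pz: "p \<bullet> zero_coord k h = p \<bullet> h" for h
  proof -
    have "p \<bullet> (zero_coord k h + (h $ k) *\<^sub>R axis k 1) = p \<bullet> zero_coord k h"
      by (simp only: inner_right_distrib inner_scaleR_right pk)
    then show ?thesis by (simp add: zero_coord_decomp)
  qed
  have "(\<lambda>h. c *\<^sub>R (zero_coord k h + (p \<bullet> h) *\<^sub>R axis k 1) + (h $ k) *\<^sub>R w) = B \<circ> (C \<circ> D)"
    by (auto simp: fun_eq_iff B_def C_def D_def w'_def algebra_simps inner_right_distrib inner_diff_right pz pk)
  then have "matrix (\<lambda>h. c *\<^sub>R (zero_coord k h + (p \<bullet> h) *\<^sub>R axis k 1) + (h $ k) *\<^sub>R w)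
     = matrix B ** (matrix C ** matrix D)"
    using lin by (simp add: matrix_compose linear_compose)
  moreover have "det (matrix B) = 1"
  proof -
    have mB: "matrix B = (\<chi> i j. axis j 1 $ i + p $ j * axis k 1 $ i)"
      by (simp add: matrix_def B_def inner_axis)
    have row1: "row i (mat 1) = axis i (1 :: real)" for i :: 'n
      by (auto simp: row_def mat_def axis_def vec_eq_iff)
    \<comment> \<open>The identity with row \<open>k\<close> replaced by
      \<open>p + axis k 1\<close>; Cramer's rule reads off its determinant as the
      \<open>k\<close>-th entry of that row, which is 1.\<close>
    have "matrix B = (\<chi> i. if i = k then p + axis k 1 else axis i 1)"
      unfolding mB using p by (auto simp: vec_eq_iff axis_def)
    then have "matrix B = (\<chi> i. if i = k then sum (\<lambda>i. (p + axis k 1) $ i *s row i (mat 1)) UNIV else row i (mat 1))"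
      unfolding row1 basis_expansion .
    then show ?thesis
      using cramer_lemma_transpose[of k "p + axis k 1" "mat 1"] p by simp
  qed
  moreover have "det (matrix C) = w \<bullet> (axis k 1 - p)"
  proof -
    have "matrix C = (\<chi> i j. if j = k then (mat 1 *v w') $ i else mat 1 $ i $ j)"
      unfolding matrix_vector_mul_lid
      by (auto simp: matrix_def C_def vec_eq_iff mat_def axis_def zero_coord_def)
    then have "det (matrix C) = w' $ k"
      using cramer_lemma[of k "mat 1" w'] by simp
    then show ?thesis
      by (simp add: w'_def inner_diff_right inner_axis inner_commute)
  qed
  moreover have "det (matrix D) = c ^ (CARD('n) - 1)"
  proof -
    have "det (matrix D) = (\<Prod>i\<in>UNIV. matrix D $ i $ i)"
      by (rule det_diagonal) (auto simp: matrix_def D_def axis_def zero_coord_def)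
    also have "\<dots> = (\<Prod>i\<in>UNIV. if i = k then 1 else c)"
      by (intro prod.cong) (auto simp: matrix_def D_def axis_def zero_coord_def)
    also have "\<dots> = (\<Prod>i\<in>UNIV - {k}. c)"
      by (rule prod.mono_neutral_cong_right) auto
    also have "\<dots> = c ^ (CARD('n) - 1)" by (simp add: card_Diff_singleton)
    finally show ?thesis .
  qed
  ultimately show ?thesis by (simp add: det_mul)
qed

section \<open>Lebesgue measure on coordinate hyperplanes\<close>

text \<open>
  Lebesgue measure on the hyperplane \<open>z $ k = 0\<close>, obtained from the slab \<open>0 < z $ k < 1\<close> of
  thickness one so that no space of lower dimension is needed.
\<close>

definition hyperplane_measure :: "'n::finite \<Rightarrow> (real ^ 'n) measure" where
  "hyperplane_measure k =
     distr (density lborel (indicator {z. 0 < z $ k \<and> z $ k < 1})) borel (zero_coord k)"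

lemma measurable_vec_nth_borel [measurable]: "(\<lambda>z :: real ^ 'n. z $ k) \<in> borel_measurable borel"
  by (intro borel_measurable_continuous_onI continuous_intros)

lemma measurable_zero_coord [measurable]: "zero_coord k \<in> borel_measurable borel"
  by (intro borel_measurable_continuous_onI linear_continuous_on linear_conv_bounded_linear[THEN iffD1]
      linear_zero_coord)

lemma vimage_plus_borel:
  fixes A :: "'a::euclidean_space set"
  shows "A \<in> sets borel \<Longrightarrow> (+) p -` A \<in> sets borel"
  by (rule measurable_sets_borel[of "(+) p" borel]) auto

lemma sets_hyperplane_measure [simp, measurable_cong]: "sets (hyperplane_measure k) = sets borel"
  by (simp add: hyperplane_measure_def)

lemma space_hyperplane_measure [simp]: "space (hyperplane_measure k) = UNIV"
  by (simp add: hyperplane_measure_def)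

lemma emeasure_hyperplane_measure:
  assumes [measurable]: "B \<in> sets borel"
  shows "emeasure (hyperplane_measure k) B = emeasure lborel {z. zero_coord k z \<in> B \<and> 0 < z $ k \<and> z $ k < 1}"
proof -
  have "emeasure (hyperplane_measure k) B
      = emeasure (density lborel (indicator {z. 0 < z $ k \<and> z $ k < 1})) (zero_coord k -` B)"
    by (simp add: hyperplane_measure_def emeasure_distr)
  also have "\<dots> = (\<integral>\<^sup>+z. indicator {z. 0 < z $ k \<and> z $ k < 1} z * indicator (zero_coord k -` B) z \<partial>lborel)"
    by (rule emeasure_density) (use assms in \<open>auto intro: measurable_sets_borel[OF measurable_zero_coord]\<close>)
  also have "\<dots> = (\<integral>\<^sup>+z. indicator {z. zero_coord k z \<in> B \<and> 0 < z $ k \<and> z $ k < 1} z \<partial>lborel)"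
    by (intro nn_integral_cong) (auto simp: indicator_def)
  also have "\<dots> = emeasure lborel {z. zero_coord k z \<in> B \<and> 0 < z $ k \<and> z $ k < 1}"
    by (rule nn_integral_indicator) measurable
  finally show ?thesis .
qed

lemma nn_integral_hyperplane_measure:
  assumes [measurable]: "f \<in> borel_measurable borel"
  shows "(\<integral>\<^sup>+u. f u \<partial>hyperplane_measure k)
    = (\<integral>\<^sup>+z. f (zero_coord k z) * indicator {z. 0 < z $ k \<and> z $ k < 1} z \<partial>lborel)"
proof -
  have "(\<integral>\<^sup>+u. f u \<partial>hyperplane_measure k)
      = (\<integral>\<^sup>+z. f (zero_coord k z) \<partial>density lborel (indicator {z. 0 < z $ k \<and> z $ k < 1}))"
    unfolding hyperplane_measure_def by (rule nn_integral_distr) auto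
  also have "\<dots> = (\<integral>\<^sup>+z. indicator {z. 0 < z $ k \<and> z $ k < 1} z * f (zero_coord k z) \<partial>lborel)"
    by (rule nn_integral_density) measurable
  finally show ?thesis by (simp add: mult.commute)
qed

text \<open>The measure is defined on the whole space and concentrated on the hyperplane, so
  almost-everywhere arguments take the place of a restricted space.\<close>

lemma AE_hyperplane_measure: "AE u in hyperplane_measure k. u $ k = 0"
proof (rule AE_I')
  have "emeasure (hyperplane_measure k) {u. u $ k \<noteq> 0} = 0"
    by (subst emeasure_hyperplane_measure) auto
  then show "{u. u $ k \<noteq> 0} \<in> null_sets (hyperplane_measure k)"
    by (intro null_setsI) auto
qed auto

lemma norm_le_zero_coord: "norm z \<le> norm (zero_coord k z) + \<bar>z $ k\<bar>" for z :: "real ^ 'n"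
  using norm_triangle_ineq[of "zero_coord k z" "(z $ k) *\<^sub>R axis k 1"]
  by (simp add: zero_coord_decomp)

lemma emeasure_hyperplane_measure_cball_finite:
  "emeasure (hyperplane_measure k) (cball (0 :: real ^ 'n) c) < \<infinity>"
proof -
  have "{z :: real ^ 'n. zero_coord k z \<in> cball 0 c \<and> 0 < z $ k \<and> z $ k < 1} \<subseteq> cball 0 (c + 1)"
  proof safe
    fix z :: "real ^ 'n"
    assume "zero_coord k z \<in> cball 0 c" "0 < z $ k" "z $ k < 1"
    then show "z \<in> cball 0 (c + 1)"
      using norm_le_zero_coord[of z k] by simp
  qed
  then have "emeasure (hyperplane_measure k) (cball 0 c) \<le> emeasure lborel (cball 0 (c + 1) :: (real ^ 'n) set)"
    by (subst emeasure_hyperplane_measure) (auto intro!: emeasure_mono)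
  also have "\<dots> < \<infinity>" by (rule emeasure_bounded_finite) simp
  finally show ?thesis .
qed

lemma sigma_finite_hyperplane_measure: "sigma_finite_measure (hyperplane_measure k)"
proof
  have fin: "emeasure (hyperplane_measure k) (cball 0 (real m)) \<noteq> \<infinity>" for m
    using emeasure_hyperplane_measure_cball_finite[of k "real m"] by simp
  show "\<exists>A. countable A \<and> A \<subseteq> sets (hyperplane_measure k) \<and> \<Union> A = space (hyperplane_measure k) \<and>
      (\<forall>a\<in>A. emeasure (hyperplane_measure k) a \<noteq> \<infinity>)"
    using fin real_arch_simple
    by (intro exI[of _ "range (\<lambda>m :: nat. cball 0 (real m))"]) auto
qed

lemma emeasure_hyperplane_measure_box:
  fixes l u :: "real ^ 'n"
  assumes "\<And>i. i \<noteq> k \<Longrightarrow> l $ i \<le> u $ i"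
  shows "emeasure (hyperplane_measure k) {v. \<forall>i. i \<noteq> k \<longrightarrow> l $ i < v $ i \<and> v $ i < u $ i}
     = ennreal (\<Prod>i\<in>UNIV - {k}. u $ i - l $ i)"
proof -
  \<comment> \<open>Side \<open>k\<close> is the interval (0, 1): the slab has unit thickness and
    contributes a factor 1.\<close>
  define l' u' where "l' = (\<chi> i. if i = k then 0 else l $ i)" and "u' = (\<chi> i. if i = k then 1 else u $ i)"
  have eq: "{z. zero_coord k z \<in> {v. \<forall>i. i \<noteq> k \<longrightarrow> l $ i < v $ i \<and> v $ i < u $ i} \<and> 0 < z $ k \<and> z $ k < 1}
      = box l' u'"
  proof (intro set_eqI)
    fix z :: "real ^ 'n"
    have "z \<in> box l' u' \<longleftrightarrow> (0 < z $ k \<and> z $ k < 1) \<and> (\<forall>i. i \<noteq> k \<longrightarrow> l $ i < z $ i \<and> z $ i < u $ i)"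
      unfolding mem_box_cart l'_def u'_def by (simp, metis)
    then show "z \<in> {z. zero_coord k z \<in> {v. \<forall>i. i \<noteq> k \<longrightarrow> l $ i < v $ i \<and> v $ i < u $ i} \<and> 0 < z $ k \<and> z $ k < 1}
      \<longleftrightarrow> z \<in> box l' u'"
      by (auto simp: zero_coord_def)
  qed
  have "emeasure (hyperplane_measure k) {v. \<forall>i. i \<noteq> k \<longrightarrow> l $ i < v $ i \<and> v $ i < u $ i}
      = emeasure lborel (box l' u')"
    by (subst emeasure_hyperplane_measure) (simp_all only: eq, measurable)
  also have "\<dots> = ennreal (\<Prod>b\<in>Basis. (u' - l') \<bullet> b)"
    using assms by (intro emeasure_lborel_box) (auto simp: Basis_vec_def inner_axis l'_def u'_def)
  also have "(\<Prod>b\<in>Basis. (u' - l') \<bullet> b) = (\<Prod>i\<in>UNIV. if i = k then 1 else u $ i - l $ i)"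
    unfolding prod_Basis_cart by (intro prod.cong) (auto simp: inner_axis l'_def u'_def)
  also have "\<dots> = (\<Prod>i\<in>UNIV - {k}. u $ i - l $ i)"
    by (rule prod.mono_neutral_cong_right) auto
  finally show ?thesis .
qed

text \<open>The product decomposition behind Fubini's theorem. Writing \<open>zero_coord k v\<close>
  in place of \<open>v\<close> makes the preimage of a box an exact product, also for
  \<open>v\<close> off the hyperplane.\<close>

lemma lborel_eq_hyperplane_pair:
  "(lborel :: (real ^ 'n) measure) =
     distr (hyperplane_measure k \<Otimes>\<^sub>M lborel) borel (\<lambda>(v, t). zero_coord k v + t *\<^sub>R axis k 1)"
proof (rule lborel_eqI)
  interpret H: sigma_finite_measure "hyperplane_measure k" by (rule sigma_finite_hyperplane_measure)
  interpret pair_sigma_finite "hyperplane_measure k" lborel ..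
  fix l u :: "real ^ 'n"
  assume le: "\<And>b. b \<in> Basis \<Longrightarrow> l \<bullet> b \<le> u \<bullet> b"
  have lu: "l $ i \<le> u $ i" for i
    using le[of "axis i 1"] by (simp add: axis_in_Basis_iff inner_axis)
  let ?A = "{v. \<forall>i. i \<noteq> k \<longrightarrow> l $ i < v $ i \<and> v $ i < u $ i}"
  have A: "?A \<in> sets (hyperplane_measure k)" by simp
  have eq: "(\<lambda>(v, t). zero_coord k v + t *\<^sub>R axis k 1) -` box l u = ?A \<times> {l $ k<..<u $ k}"
    by (auto simp: mem_box_cart zero_coord_def axis_def split: if_splits)
  have "emeasure (distr (hyperplane_measure k \<Otimes>\<^sub>M lborel) borel (\<lambda>(v, t). zero_coord k v + t *\<^sub>R axis k 1)) (box l u)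
      = emeasure (hyperplane_measure k \<Otimes>\<^sub>M lborel) (?A \<times> {l $ k<..<u $ k})"
    by (subst emeasure_distr) (auto simp: eq[symmetric] space_pair_measure)
  also have "\<dots> = emeasure (hyperplane_measure k) ?A * emeasure lborel {l $ k<..<u $ k}"
    using A by (intro lborel.emeasure_pair_measure_Times) auto
  also have "\<dots> = ennreal (\<Prod>i\<in>UNIV - {k}. u $ i - l $ i) * ennreal (u $ k - l $ k)"
    using lu by (simp add: emeasure_hyperplane_measure_box)
  also have "\<dots> = ennreal ((\<Prod>i\<in>UNIV - {k}. u $ i - l $ i) * (u $ k - l $ k))"
    using lu by (simp add: ennreal_mult prod_nonneg)
  also have "(\<Prod>i\<in>UNIV - {k}. u $ i - l $ i) * (u $ k - l $ k) = (\<Prod>i\<in>UNIV. u $ i - l $ i)"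
    by (simp add: prod.remove[of UNIV k] mult.commute)
  also have "\<dots> = (\<Prod>b\<in>Basis. (u - l) \<bullet> b)"
    unfolding prod_Basis_cart by (simp add: inner_axis)
  finally show "emeasure (distr (hyperplane_measure k \<Otimes>\<^sub>M lborel) borel
      (\<lambda>(v, t). zero_coord k v + t *\<^sub>R axis k 1)) (box l u) = (\<Prod>b\<in>Basis. (u - l) \<bullet> b)" .
qed simp

lemma nn_integral_lborel_hyperplane_pair:
  fixes f :: "real ^ 'n \<Rightarrow> ennreal"
  assumes [measurable]: "f \<in> borel_measurable borel"
  shows "(\<integral>\<^sup>+z. f z \<partial>lborel) = (\<integral>\<^sup>+v. \<integral>\<^sup>+t. f (v + t *\<^sub>R axis k 1) \<partial>lborel \<partial>hyperplane_measure k)"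
proof -
  interpret H: sigma_finite_measure "hyperplane_measure k" by (rule sigma_finite_hyperplane_measure)
  interpret pair_sigma_finite "hyperplane_measure k" lborel ..
  have "(\<integral>\<^sup>+z. f z \<partial>lborel)
     = (\<integral>\<^sup>+p. f (case p of (v, t) \<Rightarrow> zero_coord k v + t *\<^sub>R axis k 1) \<partial>(hyperplane_measure k \<Otimes>\<^sub>M lborel))"
    by (subst lborel_eq_hyperplane_pair[of k], rule nn_integral_distr) auto
  also have "\<dots> = (\<integral>\<^sup>+v. \<integral>\<^sup>+t. f (zero_coord k v + t *\<^sub>R axis k 1) \<partial>lborel \<partial>hyperplane_measure k)"
    by (subst lborel.nn_integral_fst[symmetric]) auto
  also have "\<dots> = (\<integral>\<^sup>+v. \<integral>\<^sup>+t. f (v + t *\<^sub>R axis k 1) \<partial>lborel \<partial>hyperplane_measure k)"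
    using AE_hyperplane_measure[of k]
    by (intro nn_integral_cong_AE) (auto elim!: eventually_mono simp: zero_coord_id)
  finally show ?thesis .
qed

lemma emeasure_hyperplane_measure_translation:
  assumes p: "p $ k = 0" and [measurable]: "A \<in> sets borel"
  shows "emeasure (hyperplane_measure k) ((+) p -` A) = emeasure (hyperplane_measure k) A"
proof -
  have "emeasure (hyperplane_measure k) ((+) p -` A)
      = emeasure lborel {z. zero_coord k z \<in> ((+) p -` A) \<and> 0 < z $ k \<and> z $ k < 1}"
    by (rule emeasure_hyperplane_measure) (rule vimage_plus_borel, fact)
  also have "{z. zero_coord k z \<in> ((+) p -` A) \<and> 0 < z $ k \<and> z $ k < 1}
      = (+) p -` {z. zero_coord k z \<in> A \<and> 0 < z $ k \<and> z $ k < 1}"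
    using p by (auto simp: zero_coord_id)
  also have "emeasure lborel \<dots> = emeasure (distr lborel borel ((+) p)) {z. zero_coord k z \<in> A \<and> 0 < z $ k \<and> z $ k < 1}"
    by (subst emeasure_distr) auto
  also have "\<dots> = emeasure (hyperplane_measure k) A"
    by (simp add: lborel_distr_plus emeasure_hyperplane_measure)
  finally show ?thesis .
qed

section \<open>Uniqueness of translation-invariant measures\<close>

text \<open>Fubini's theorem, with the substitutions \<open>y \<mapsto> x + y\<close> and then \<open>x \<mapsto> x - y\<close>.\<close>

lemma translation_invariant_swap:
  fixes M N :: "'a::euclidean_space measure"
  assumes [measurable_cong, simp]: "sets M = sets borel" "sets N = sets borel"
    and "sigma_finite_measure M" "sigma_finite_measure N"
    and P: "AE x in M. x \<in> P" "AE x in N. x \<in> P" "\<And>x. x \<in> P \<Longrightarrow> - x \<in> P"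
    and M: "\<And>p A. p \<in> P \<Longrightarrow> A \<in> sets borel \<Longrightarrow> emeasure M ((+) p -` A) = emeasure M A"
    and N: "\<And>p A. p \<in> P \<Longrightarrow> A \<in> sets borel \<Longrightarrow> emeasure N ((+) p -` A) = emeasure N A"
    and A[measurable]: "A \<in> sets borel" and B[measurable]: "B \<in> sets borel"
  shows "emeasure M A * emeasure N B = emeasure N (uminus -` A) * emeasure M B"
proof -
  interpret M: sigma_finite_measure M by fact
  interpret N: sigma_finite_measure N by fact
  interpret pair_sigma_finite M N ..
  have spaces [simp]: "space M = UNIV" "space N = UNIV"
    using sets_eq_imp_space_eq[of M borel] sets_eq_imp_space_eq[of N borel] by auto
  have distrM: "distr M M ((+) p) = M" if "p \<in> P" for p
    by (rule measure_eqI) (auto simp: emeasure_distr M[OF that])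
  have "emeasure M A * emeasure N B = (\<integral>\<^sup>+x. indicator A x * emeasure N B \<partial>M)"
    by (simp add: nn_integral_multc)
  also have "\<dots> = (\<integral>\<^sup>+x. \<integral>\<^sup>+y. indicator A x * indicator B (x + y) \<partial>N \<partial>M)"
  proof (rule nn_integral_cong_AE)
    show "AE x in M. indicator A x * emeasure N B = (\<integral>\<^sup>+y. indicator A x * indicator B (x + y) \<partial>N)"
      using P(1)
    proof eventually_elim
      case (elim x)
      have "(\<integral>\<^sup>+y. indicator A x * indicator B (x + y) \<partial>N) = indicator A x * (\<integral>\<^sup>+y. indicator ((+) x -` B) y \<partial>N)"
        by (subst nn_integral_cmult[symmetric]) (auto intro!: nn_integral_cong simp: indicator_def)
      also have "\<dots> = indicator A x * emeasure N ((+) x -` B)"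
        by (subst nn_integral_indicator) (use B in \<open>auto intro: vimage_plus_borel\<close>)
      finally show ?case using N[OF elim B] by simp
    qed
  qed
  also have "\<dots> = (\<integral>\<^sup>+y. \<integral>\<^sup>+x. indicator A x * indicator B (x + y) \<partial>M \<partial>N)"
    by (rule Fubini'[symmetric]) measurable
  also have "\<dots> = (\<integral>\<^sup>+y. \<integral>\<^sup>+x. indicator A (x - y) * indicator B x \<partial>M \<partial>N)"
  proof (rule nn_integral_cong_AE)
    show "AE y in N. (\<integral>\<^sup>+x. indicator A x * indicator B (x + y) \<partial>M) = (\<integral>\<^sup>+x. indicator A (x - y) * indicator B x \<partial>M)"
      using P(2)
    proof eventually_elim
      case (elim y)
      have "(\<integral>\<^sup>+x. indicator A x * indicator B (x + y) \<partial>M)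
        = (\<integral>\<^sup>+x. indicator A x * indicator B (x + y) \<partial>distr M M ((+) (- y)))"
        using P(3)[OF elim] by (simp add: distrM)
      also have "\<dots> = (\<integral>\<^sup>+x. indicator A (x - y) * indicator B x \<partial>M)"
        by (subst nn_integral_distr) (auto simp: algebra_simps)
      finally show ?case .
    qed
  qed
  also have "\<dots> = (\<integral>\<^sup>+x. \<integral>\<^sup>+y. indicator A (x - y) * indicator B x \<partial>N \<partial>M)"
    by (rule Fubini') measurable
  also have "\<dots> = (\<integral>\<^sup>+x. emeasure N (uminus -` A) * indicator B x \<partial>M)"
  proof (rule nn_integral_cong_AE)
    show "AE x in M. (\<integral>\<^sup>+y. indicator A (x - y) * indicator B x \<partial>N) = emeasure N (uminus -` A) * indicator B x"
      using P(1)
    proof eventually_elim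
      case (elim x)
      have m: "uminus -` A \<in> sets borel"
        by (rule measurable_sets_borel[of uminus borel]) (use A in auto)
      have "(\<integral>\<^sup>+y. indicator A (x - y) * indicator B x \<partial>N) = (\<integral>\<^sup>+y. indicator ((+) (- x) -` uminus -` A) y \<partial>N) * indicator B x"
        by (subst nn_integral_multc[symmetric])
          (use m in \<open>auto intro!: nn_integral_cong vimage_plus_borel borel_measurable_indicator simp: indicator_def\<close>)
      also have "\<dots> = emeasure N ((+) (- x) -` uminus -` A) * indicator B x"
        using m by (subst nn_integral_indicator) (auto intro: vimage_plus_borel)
      finally show ?case using N[OF P(3)[OF elim] m] by simp
    qed
  qed
  also have "\<dots> = emeasure N (uminus -` A) * emeasure M B"
    by (simp add: nn_integral_cmult)
  finally show ?thesis .
qed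

text \<open>\<open>P\<close> collects the admissible translations and carries both measures. The
  swap formula for \<open>N\<close> with itself shows that \<open>N\<close> is invariant under
  reflection; the one for \<open>M\<close> and \<open>N\<close> then gives the
  proportionality.\<close>

lemma translation_invariant_unique:
  fixes M N :: "'a::euclidean_space measure"
  assumes M: "sets M = sets borel" "sigma_finite_measure M" "AE x in M. x \<in> P"
      "\<And>p A. p \<in> P \<Longrightarrow> A \<in> sets borel \<Longrightarrow> emeasure M ((+) p -` A) = emeasure M A"
    and N: "sets N = sets borel" "sigma_finite_measure N" "AE x in N. x \<in> P"
      "\<And>p A. p \<in> P \<Longrightarrow> A \<in> sets borel \<Longrightarrow> emeasure N ((+) p -` A) = emeasure N A"
    and P: "\<And>x. x \<in> P \<Longrightarrow> - x \<in> P"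
    and A: "A \<in> sets borel" and B: "B \<in> sets borel" "emeasure N B = 1"
  shows "emeasure M A = emeasure M B * emeasure N A"
proof -
  have "emeasure N A * emeasure N B = emeasure N (uminus -` A) * emeasure N B"
    by (rule translation_invariant_swap[of N N P]) (use assms in auto)
  moreover have "emeasure M A * emeasure N B = emeasure N (uminus -` A) * emeasure M B"
    by (rule translation_invariant_swap[of M N P]) (use assms in auto)
  ultimately show ?thesis using B by (simp add: mult.commute)
qed

section \<open>Hausdorff measure on hyperplanes\<close>

lemma hausdorff_pre_le_finite_cover:
  assumes V: "finite V" and cov: "A \<subseteq> (\<Union>v\<in>V. C v)"
    and C: "\<And>v. v \<in> V \<Longrightarrow> bounded (C v) \<and> diameter (C v) \<le> \<delta>" and \<delta>: "\<delta> \<ge> 0"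
  shows "hausdorff_pre d \<delta> A \<le> (\<Sum>v\<in>V. hausdorff_gauge d (C v))"
proof -
  obtain h where h: "bij_betw h {0..<card V} V" using ex_bij_betw_nat_finite[OF V] by blast
  \<comment> \<open>Padding by the empty set costs nothing, as its gauge is 0 even for
    \<open>d = 0\<close>.\<close>
  define D where "D i = (if i < card V then C (h i) else {})" for i
  have hV: "h i \<in> V" if "i < card V" for i using h that by (auto simp: bij_betw_def)
  have "hausdorff_pre d \<delta> A \<le> (\<Sum>i. hausdorff_gauge d (D i))"
    unfolding hausdorff_pre_def
  proof (rule INF_lower, safe)
    fix x assume "x \<in> A"
    then obtain v where v: "v \<in> V" "x \<in> C v" using cov by blast
    then have "v \<in> h ` {0..<card V}" using h by (simp add: bij_betw_def)
    then obtain i where "i < card V" "h i = v" by auto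
    then have "x \<in> D i" using v by (simp add: D_def)
    then show "x \<in> (\<Union>i. D i)" by blast
  qed (use C hV \<delta> in \<open>auto simp: D_def\<close>)
  also have "\<dots> = (\<Sum>i<card V. hausdorff_gauge d (D i))"
    by (rule suminf_finite) (auto simp: D_def hausdorff_gauge_def)
  also have "\<dots> = (\<Sum>i\<in>{0..<card V}. hausdorff_gauge d (C (h i)))"
    by (intro sum.cong) (auto simp: D_def)
  also have "\<dots> = (\<Sum>v\<in>V. hausdorff_gauge d (C v))"
    by (rule sum.reindex_bij_betw[OF h])
  finally show ?thesis .
qed

definition hyperplane_cube :: "'n \<Rightarrow> (real ^ 'n) set" where
  "hyperplane_cube k = {v. v $ k = 0 \<and> (\<forall>i. i \<noteq> k \<longrightarrow> 0 < v $ i \<and> v $ i < 1)}"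

text \<open>A grid of mesh 1/N consists of N^d pieces of diameter at most n/N, by comparison with
  the l1 norm. The powers of N cancel in the sum of the gauges, which leaves the bound
  \<open>b\<close> for every \<delta>.\<close>

lemma hausdorff_hyperplane_cube_finite:
  "hausdorff_outer (CARD('n) - 1) (hyperplane_cube (k :: 'n::finite)) < \<infinity>"
proof -
  define d where "d = CARD('n) - 1"
  define b where "b = unit_ball_vol (real d) * (real CARD('n) / 2) ^ d"
  have "hausdorff_pre d \<delta> (hyperplane_cube k) \<le> ennreal b" if "\<delta> > 0" for \<delta>
  proof -
    obtain N :: nat where N0: "real CARD('n) / \<delta> < real N" using reals_Archimedean2 by blast
    then have "0 < real N" using \<open>\<delta> > 0\<close> by (meson divide_nonneg_pos le_less_trans of_nat_0_le_iff)
    then have N: "N > 0" by simp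
    have N\<delta>: "real CARD('n) / real N \<le> \<delta>" using N0 N \<open>\<delta> > 0\<close> by (simp add: field_simps)
    define V where "V = (UNIV - {k}) \<rightarrow>\<^sub>E {..<N}"
    define C where "C \<phi> = {v. v $ k = 0 \<and> (\<forall>i. i \<noteq> k \<longrightarrow> real (\<phi> i) / N \<le> v $ i \<and> v $ i \<le> (real (\<phi> i) + 1) / N)}"
      for \<phi> :: "'n \<Rightarrow> nat"
    have finV: "finite V" unfolding V_def by (intro finite_PiE) auto
    have cardV: "card V = N ^ d" by (simp add: V_def card_PiE d_def card_Diff_singleton)
    have dist: "dist x y \<le> real CARD('n) / N" if "x \<in> C \<phi>" "y \<in> C \<phi>" for x y \<phi>
    proof -
      have "dist x y \<le> (\<Sum>i\<in>UNIV. \<bar>(x - y) $ i\<bar>)"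
        unfolding dist_norm by (rule norm_le_l1_cart)
      also have "\<dots> \<le> (\<Sum>i\<in>(UNIV :: 'n set). 1 / N)"
      proof (rule sum_mono)
        fix i
        show "\<bar>(x - y) $ i\<bar> \<le> 1 / N"
        proof (cases "i = k")
          case False
          then have "real (\<phi> i) / N \<le> x $ i" "x $ i \<le> (real (\<phi> i) + 1) / N"
            "real (\<phi> i) / N \<le> y $ i" "y $ i \<le> (real (\<phi> i) + 1) / N"
            using that by (auto simp: C_def)
          then show ?thesis by (simp add: add_divide_distrib abs_le_iff)
        qed (use that in \<open>simp add: C_def\<close>)
      qed
      finally show ?thesis by simp
    qed
    have bdd: "bounded (C \<phi>)" for \<phi>
    proof (cases "C \<phi> = {}")
      case False
      then obtain x where "x \<in> C \<phi>" by blast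
      then show ?thesis unfolding bounded_def using dist by blast
    qed simp
    have diam: "diameter (C \<phi>) \<le> real CARD('n) / N" for \<phi>
      using dist by (intro diameter_le) (auto simp: dist_norm)
    have "hausdorff_pre d \<delta> (hyperplane_cube k) \<le> (\<Sum>\<phi>\<in>V. hausdorff_gauge d (C \<phi>))"
    proof (rule hausdorff_pre_le_finite_cover[OF finV])
      show "hyperplane_cube k \<subseteq> (\<Union>\<phi>\<in>V. C \<phi>)"
      proof
        fix v assume v: "v \<in> hyperplane_cube k"
        define \<phi> where "\<phi> = (\<lambda>i\<in>UNIV - {k}. nat \<lfloor>N * v $ i\<rfloor>)"
        have "\<phi> \<in> V"
          unfolding V_def \<phi>_def restrict_PiE_iff
        proof (intro ballI)
          fix i assume "i \<in> UNIV - {k}"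
          then have "0 < v $ i" "v $ i < 1" using v by (auto simp: hyperplane_cube_def)
          then have "0 \<le> N * v $ i" "N * v $ i < N" using N by auto
          then show "nat \<lfloor>N * v $ i\<rfloor> \<in> {..<N}" unfolding lessThan_iff by linarith
        qed
        moreover have "v \<in> C \<phi>"
          unfolding C_def
        proof (intro CollectI conjI allI impI)
          show "v $ k = 0" using v by (simp add: hyperplane_cube_def)
          fix i assume i: "i \<noteq> k"
          then have "0 \<le> N * v $ i" using v by (auto simp: hyperplane_cube_def intro: less_imp_le)
          then have "real (\<phi> i) \<le> N * v $ i" "N * v $ i \<le> real (\<phi> i) + 1"
            using i by (simp_all add: \<phi>_def)
          then show "real (\<phi> i) / N \<le> v $ i" "v $ i \<le> (real (\<phi> i) + 1) / N"
            using N by (simp_all add: field_simps)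
        qed
        ultimately show "v \<in> (\<Union>\<phi>\<in>V. C \<phi>)" by blast
      qed
    qed (use bdd diam N\<delta> that in \<open>auto intro: order_trans\<close>)
    also have "\<dots> \<le> (\<Sum>\<phi>\<in>V. ennreal (unit_ball_vol (real d) * (real CARD('n) / N / 2) ^ d))"
    proof (rule sum_mono)
      fix \<phi>
      have "diameter (C \<phi>) / 2 \<le> real CARD('n) / N / 2" using diam[of \<phi>] by simp
      then have "(diameter (C \<phi>) / 2) ^ d \<le> (real CARD('n) / N / 2) ^ d"
        using diameter_ge_0[OF bdd] by (intro power_mono) auto
      then show "hausdorff_gauge d (C \<phi>) \<le> ennreal (unit_ball_vol (real d) * (real CARD('n) / N / 2) ^ d)"
        unfolding hausdorff_gauge_def by (auto intro!: ennreal_leI mult_left_mono)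
    qed
    also have "\<dots> = ennreal (real (N ^ d) * (unit_ball_vol (real d) * (real CARD('n) / N / 2) ^ d))"
      by (simp only: sum_constant cardV ennreal_of_nat_eq_real_of_nat) (subst ennreal_mult, auto)
    also have "real (N ^ d) * (unit_ball_vol (real d) * (real CARD('n) / N / 2) ^ d) = b"
      using N by (simp add: b_def power_divide field_simps)
    finally show ?thesis .
  qed
  then have "hausdorff_outer d (hyperplane_cube k) \<le> ennreal b"
    unfolding hausdorff_outer_def by (auto intro: SUP_least)
  also have "\<dots> < \<infinity>" by simp
  finally show ?thesis by (simp add: d_def)
qed

text \<open>A covering set of diameter r lies in a box of side 2r, and the hyperplane measures of
  these boxes must add up to at least 1. This bounds the gauge sum of every cover from
  below.\<close>

lemma hausdorff_hyperplane_cube_pos: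
  "0 < hausdorff_outer (CARD('n) - 1) (hyperplane_cube (k :: 'n::finite))"
proof -
  define d where "d = CARD('n) - 1"
  \<comment> \<open>Ratio of the bound (2r)^d for the measure of such a box to the gauge of a set of
    diameter r.\<close>
  define c where "c = 4 ^ d / unit_ball_vol (real d)"
  have c: "c > 0" by (simp add: c_def)
  have main: "1 \<le> ennreal c * (\<Sum>i. hausdorff_gauge d (C i))"
    if C: "hyperplane_cube k \<subseteq> (\<Union>i. C i)" "\<forall>i::nat. bounded (C i) \<and> diameter (C i) \<le> 1" for C
  proof -
    define a where "a i = (SOME x. x \<in> C i)" for i
    define r where "r i = diameter (C i)" for i
    define D where "D i = (if C i = {} then {} else {v :: real ^ 'n. \<forall>j. \<bar>v $ j - a i $ j\<bar> \<le> r i})" for i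
    have "closed {v :: real ^ 'n. \<forall>j. \<bar>v $ j - a i $ j\<bar> \<le> r i}" for i
      by (intro closed_Collect_all closed_Collect_le continuous_intros)
    then have Dm: "D i \<in> sets borel" for i by (simp add: D_def)
    have CD: "C i \<subseteq> D i" for i
    proof
      fix v assume v: "v \<in> C i"
      then have a: "a i \<in> C i" unfolding a_def by (rule someI)
      have "\<bar>v $ j - a i $ j\<bar> \<le> r i" for j
        using component_le_norm_cart[of "v - a i" j] diameter_bounded_bound[OF _ v a] C(2)
        by (simp add: r_def dist_norm)
      then show "v \<in> D i" using v by (auto simp: D_def)
    qed
    have emD: "emeasure (hyperplane_measure k) (D i) \<le> ennreal c * hausdorff_gauge d (C i)" for i
    proof (cases "C i = {}")
      case False
      have r: "r i \<ge> 0" using C(2) diameter_ge_0 by (auto simp: r_def)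
      define l u where "l = (\<chi> j. if j = k then 0 else a i $ j - r i)" and "u = (\<chi> j. if j = k then 1 else a i $ j + r i)"
      have "emeasure (hyperplane_measure k) (D i) \<le> emeasure lborel (cbox l u)"
        unfolding emeasure_hyperplane_measure[OF Dm]
      proof (rule emeasure_mono, safe)
        fix z assume z: "zero_coord k z \<in> D i" "0 < z $ k" "z $ k < 1"
        have "\<bar>z $ j - a i $ j\<bar> \<le> r i" if "j \<noteq> k" for j
        proof -
          have "zero_coord k z $ j = z $ j" using that by (simp add: zero_coord_def)
          then show ?thesis using z(1) False unfolding D_def by (auto dest: spec[of _ j])
        qed
        then have "l $ j \<le> z $ j \<and> z $ j \<le> u $ j" for j
          using z by (cases "j = k") (auto simp: l_def u_def abs_le_iff algebra_simps)
        then show "z \<in> cbox l u" by (simp add: mem_box_cart)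
      qed simp
      also have "\<dots> = ennreal (\<Prod>b\<in>Basis. (u - l) \<bullet> b)"
        using r by (intro emeasure_lborel_cbox) (auto simp: Basis_vec_def inner_axis l_def u_def)
      also have "(\<Prod>b\<in>Basis. (u - l) \<bullet> b) = (\<Prod>j\<in>UNIV. if j = k then 1 else 2 * r i)"
        unfolding prod_Basis_cart by (intro prod.cong) (auto simp: inner_axis l_def u_def)
      also have "\<dots> = (\<Prod>j\<in>UNIV - {k}. 2 * r i)"
        by (rule prod.mono_neutral_cong_right) auto
      also have "\<dots> = (2 * r i) ^ d" by (simp add: d_def card_Diff_singleton)
      also have "\<dots> = c * (unit_ball_vol (real d) * (r i / 2) ^ d)"
      proof -
        have "(2 * r i) ^ d = (4 * (r i / 2)) ^ d" by simp
        also have "\<dots> = 4 ^ d * (r i / 2) ^ d" by (simp only: power_mult_distrib)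
        finally have "(2 * r i) ^ d = 4 ^ d * (r i / 2) ^ d" .
        moreover have "x / U * (U * y) = x * y" if "U \<noteq> 0" for x y U :: real using that by simp
        moreover have "unit_ball_vol (real d) \<noteq> 0" by (rule less_imp_neq[symmetric]) simp
        ultimately show ?thesis unfolding c_def by metis
      qed
      also have "ennreal \<dots> = ennreal c * hausdorff_gauge d (C i)"
        using False c r by (simp add: hausdorff_gauge_def r_def ennreal_mult)
      finally show ?thesis .
    qed (simp add: D_def)
    \<comment> \<open>The cube thickened in direction \<open>k\<close>: its measure is 1 by the box
      formula, and almost all of its points lie in the cube itself.\<close>
    define G where "G = {v :: real ^ 'n. \<forall>i. i \<noteq> k \<longrightarrow> 0 < v $ i \<and> v $ i < 1}"
    have G: "v \<in> (\<Union>i. D i)" if "v \<in> G" "v $ k = 0" for v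
    proof -
      have "v \<in> hyperplane_cube k" using that by (simp add: hyperplane_cube_def G_def)
      then show ?thesis using C(1) CD by blast
    qed
    have "1 = emeasure (hyperplane_measure k) G"
      using emeasure_hyperplane_measure_box[of k 0 1] by (simp add: G_def)
    also have "\<dots> \<le> emeasure (hyperplane_measure k) (\<Union>i. D i)"
    proof (rule emeasure_mono_AE)
      show "AE v in hyperplane_measure k. v \<in> G \<longrightarrow> v \<in> (\<Union>i. D i)"
        by (rule eventually_mono[OF AE_hyperplane_measure]) (use G in blast)
    qed (use Dm in auto)
    also have "\<dots> \<le> (\<Sum>i. emeasure (hyperplane_measure k) (D i))"
      using Dm by (intro emeasure_subadditive_countably) auto
    also have "\<dots> \<le> (\<Sum>i. ennreal c * hausdorff_gauge d (C i))"
      by (intro suminf_le allI emD) auto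
    finally show ?thesis by simp
  qed
  have "ennreal (1 / c) \<le> (\<Sum>i. hausdorff_gauge d (C i))"
    if "hyperplane_cube k \<subseteq> (\<Union>i. C i)" "\<forall>i::nat. bounded (C i) \<and> diameter (C i) \<le> 1" for C
  proof -
    have "ennreal (1 / c) * 1 \<le> ennreal (1 / c) * (ennreal c * (\<Sum>i. hausdorff_gauge d (C i)))"
      by (rule mult_left_mono[OF main[OF that]]) simp
    then show ?thesis using c by (simp add: mult.assoc[symmetric] ennreal_mult[symmetric])
  qed
  \<comment> \<open>The single scale 1 is enough for a lower bound, because the outer measure is the
    supremum over all scales.\<close>
  then have "ennreal (1 / c) \<le> hausdorff_pre d 1 (hyperplane_cube k)"
    unfolding hausdorff_pre_def by (intro INF_greatest) auto
  also have "\<dots> \<le> hausdorff_outer d (hyperplane_cube k)"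
    unfolding hausdorff_outer_def by (rule SUP_upper) simp
  finally show ?thesis
    using c by (auto simp: d_def intro: less_le_trans[rotated])
qed

text \<open>
  The factor between Hausdorff and Lebesgue measure. Its value, which is 1 by the isodiametric
  inequality, is irrelevant as it only rescales the constant of the theorem.
\<close>

definition hausdorff_factor :: "'n::finite \<Rightarrow> ennreal" where
  "hausdorff_factor k = hausdorff_outer (CARD('n) - 1) (hyperplane_cube k)"

lemma hausdorff_hyperplane_cball_finite:
  "hausdorff_outer (CARD('n) - 1) ({v. v $ k = 0} \<inter> cball (0 :: real ^ 'n::finite) (real m)) < \<infinity>"
proof -
  define c where "c = real m + 1"
  have c: "c > 0" by (simp add: c_def)
  \<comment> \<open>Affine map that stretches (0, 1) to (-c, c) in every coordinate but
    \<open>k\<close>. Taking \<open>c = m + 1\<close> leaves room for the closed ball of radius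
    \<open>m\<close>.\<close>
  define f where "f v = (2 * c) *\<^sub>R v - (\<chi> i. if i = k then 0 else c)" for v :: "real ^ 'n"
  have "{v. v $ k = 0} \<inter> cball 0 (real m) \<subseteq> f ` hyperplane_cube k"
  proof
    fix v :: "real ^ 'n" assume v: "v \<in> {v. v $ k = 0} \<inter> cball 0 (real m)"
    define u where "u = (\<chi> i. if i = k then 0 else (v $ i + c) / (2 * c))"
    have vi: "- c < v $ i \<and> v $ i < c" for i
      using v component_le_norm_cart[of v i] by (auto simp: c_def)
    have "u \<in> hyperplane_cube k"
      unfolding hyperplane_cube_def
    proof (intro CollectI conjI allI impI)
      fix i assume "i \<noteq> k"
      then have u: "u $ i = (v $ i + c) / (2 * c)" by (simp add: u_def)
      show "0 < u $ i" "u $ i < 1" unfolding u using vi[of i] c by (simp_all add: field_simps)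
    qed (simp add: u_def)
    moreover have "v = f u" using v c by (auto simp: f_def u_def vec_eq_iff field_simps)
    ultimately show "v \<in> f ` hyperplane_cube k" by blast
  qed
  then have "hausdorff_outer (CARD('n) - 1) ({v. v $ k = 0} \<inter> cball (0 :: real ^ 'n) (real m))
     \<le> hausdorff_outer (CARD('n) - 1) (f ` hyperplane_cube k)"
    by (rule hausdorff_outer_mono)
  also have "\<dots> \<le> ennreal ((2 * c) ^ (CARD('n) - 1)) * hausdorff_outer (CARD('n) - 1) (hyperplane_cube k)"
  proof (rule hausdorff_outer_Lipschitz_image)
    fix a b :: "real ^ 'n"
    have "f a - f b = (2 * c) *\<^sub>R (a - b)" by (simp add: f_def algebra_simps)
    then show "dist (f a) (f b) \<le> 2 * c * dist a b" using c by (simp add: dist_norm)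
  qed (use c in simp)
  also have "\<dots> < \<infinity>"
    using hausdorff_hyperplane_cube_finite[of k] by (simp add: ennreal_mult_less_top)
  finally show ?thesis .
qed

text \<open>Hausdorff measure restricted to the hyperplane is sigma-finite and invariant under
  translations along it, hence a multiple of \<open>hyperplane_measure k\<close>; the unit cube
  identifies the multiple.\<close>

lemma hausdorff_hyperplane:
  fixes E :: "(real ^ 'n::finite) set"
  assumes E: "E \<in> sets borel" "\<And>v. v \<in> E \<Longrightarrow> v $ k = 0"
  shows "hausdorff_outer (CARD('n) - 1) E = hausdorff_factor k * emeasure (hyperplane_measure k) E"
proof -
  let ?d = "CARD('n) - 1"
  let ?H = "hausdorff_measure ?d :: (real ^ 'n) measure"
  define P where "P = {v :: real ^ 'n. v $ k = 0}"
  define M where "M = density ?H (indicator P)"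
  have P [measurable]: "P \<in> sets borel" unfolding P_def by measurable
  have setsM: "sets M = sets borel" by (simp add: M_def)
  have emM: "emeasure M A = hausdorff_outer ?d (A \<inter> P)" if A: "A \<in> sets borel" for A
  proof -
    have AH: "A \<in> sets ?H" and APH: "A \<inter> P \<in> sets ?H" and ind: "indicator P \<in> borel_measurable ?H"
      using A P by simp_all
    have "emeasure M A = (\<integral>\<^sup>+v. indicator P v * indicator A v \<partial>?H)"
      unfolding M_def by (rule emeasure_density[OF ind AH])
    also have "\<dots> = (\<integral>\<^sup>+v. indicator (A \<inter> P) v \<partial>?H)"
      by (intro nn_integral_cong) (simp add: indicator_inter_arith mult.commute)
    also have "\<dots> = emeasure ?H (A \<inter> P)" by (rule nn_integral_indicator[OF APH])
    also have "\<dots> = hausdorff_outer ?d (A \<inter> P)" by (rule emeasure_hausdorff_measure) (use A P in blast)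
    finally show ?thesis .
  qed
  define B where "B = {v :: real ^ 'n. \<forall>i. i \<noteq> k \<longrightarrow> 0 < v $ i \<and> v $ i < 1}"
  have B: "B \<in> sets borel" unfolding B_def by measurable
  have sigma: "sigma_finite_measure M"
  proof
    show "\<exists>A. countable A \<and> A \<subseteq> sets M \<and> \<Union> A = space M \<and> (\<forall>a\<in>A. emeasure M a \<noteq> \<infinity>)"
    proof (intro exI[of _ "range (\<lambda>m :: nat. cball 0 (real m))"] conjI ballI)
      show "\<Union> (range (\<lambda>m :: nat. cball 0 (real m))) = space M"
        using real_arch_simple by (auto simp: M_def)
      fix a :: "(real ^ 'n) set" assume "a \<in> range (\<lambda>m :: nat. cball 0 (real m))"
      then obtain m :: nat where a: "a = cball 0 (real m)" by blast
      have "hausdorff_outer ?d (a \<inter> P) < \<infinity>"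
        using hausdorff_hyperplane_cball_finite[of k m] unfolding a P_def by (simp only: Int_commute)
      then show "emeasure M a \<noteq> \<infinity>" by (subst emM) (auto simp: a)
    qed (auto simp: setsM)
  qed
  have AEM: "AE x in M. x \<in> P"
    unfolding M_def by (subst AE_density) (auto simp: indicator_def)
  have transl: "emeasure M ((+) p -` A) = emeasure M A" if p: "p \<in> P" and A: "A \<in> sets borel" for p A
  proof -
    have "((+) p -` A) \<inter> P = (+) (- p) ` (A \<inter> P)"
    proof (intro subset_antisym subsetI)
      fix v assume "v \<in> ((+) p -` A) \<inter> P"
      then have "p + v \<in> A \<inter> P" using p by (simp add: P_def)
      moreover have "v = - p + (p + v)" by simp
      ultimately show "v \<in> (+) (- p) ` (A \<inter> P)" by (rule image_eqI[rotated])
    next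
      fix v assume "v \<in> (+) (- p) ` (A \<inter> P)"
      then show "v \<in> ((+) p -` A) \<inter> P" using p by (auto simp: P_def)
    qed
    from arg_cong[OF this, of "hausdorff_outer ?d"]
    show ?thesis
      unfolding emM[OF A] emM[OF vimage_plus_borel[OF A, of p]] hausdorff_outer_translation .
  qed
  have "emeasure M E = emeasure M B * emeasure (hyperplane_measure k) E"
  proof (rule translation_invariant_unique[where P = P, OF setsM sigma AEM transl])
    show "AE x in hyperplane_measure k. x \<in> P"
      using AE_hyperplane_measure by (simp add: P_def)
    show "emeasure (hyperplane_measure k) B = 1"
      using emeasure_hyperplane_measure_box[of k 0 1] by (simp add: B_def)
    show "emeasure (hyperplane_measure k) ((+) p -` A) = emeasure (hyperplane_measure k) A"
      if "p \<in> P" "A \<in> sets borel" for p A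
      using that by (intro emeasure_hyperplane_measure_translation) (simp_all add: P_def)
    show "- x \<in> P" if "x \<in> P" for x using that by (simp add: P_def)
  qed (use E B sigma_finite_hyperplane_measure in simp_all)
  moreover have "E \<inter> P = E" using E(2) by (auto simp: P_def)
  moreover have "B \<inter> P = hyperplane_cube k" by (auto simp: B_def P_def hyperplane_cube_def)
  ultimately show ?thesis unfolding emM[OF E(1)] emM[OF B] hausdorff_factor_def by simp
qed

lemma emeasure_lborel_linear_image:
  fixes L :: "real ^ 'n \<Rightarrow> real ^ 'n::finite"
  assumes L: "linear L" "inj L" and S: "S \<in> sets borel"
  shows "emeasure lebesgue (L ` S) = ennreal \<bar>det (matrix L)\<bar> * emeasure lborel S"
proof -
  have "emeasure lebesgue (L ` S) = (\<integral>\<^sup>+x. ennreal \<bar>det (matrix L)\<bar> * indicator S x \<partial>lborel)"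
    using L S inj_on_subset[of L UNIV S]
    by (intro emeasure_differentiable_image_eq)
      (auto intro: has_derivative_linear linear_imp_has_derivative)
  also have "\<dots> = ennreal \<bar>det (matrix L)\<bar> * emeasure lborel S"
    using S by (simp add: nn_integral_cmult)
  finally show ?thesis .
qed

text \<open>The image is the preimage under the inverse, which is linear and therefore
  continuous.\<close>

lemma linear_image_borel:
  fixes L :: "real ^ 'n \<Rightarrow> real ^ 'n::finite"
  assumes L: "linear L" "inj L" and S: "S \<in> sets borel"
  shows "L ` S \<in> sets borel"
proof -
  obtain g where g: "linear g" and gL': "g \<circ> L = id"
    using linear_injective_left_inverse[OF L] by blast
  moreover have "L \<circ> g = id"
    using linear_inverse_left[OF L(1) g] gL' by blast
  ultimately have gL: "g (L x) = x" "L (g x) = x" for x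
    by (auto simp: fun_eq_iff)
  have "L ` S = g -` S"
  proof (intro subset_antisym subsetI)
    fix y assume "y \<in> g -` S"
    then have "g y \<in> S" "y = L (g y)" by (auto simp: gL)
    then show "y \<in> L ` S" by (rule image_eqI[rotated])
  qed (auto simp: gL)
  moreover have "g \<in> borel_measurable borel"
    using g by (intro borel_measurable_continuous_onI linear_continuous_on) (simp add: linear_conv_bounded_linear)
  ultimately show ?thesis using measurable_sets_borel[of g borel S] S by simp
qed

text \<open>\<open>L\<close> sends the axis to a unit normal of the image of the hyperplane, so it
  preserves the thickness of slabs and its full determinant is the area factor. The rotation
  \<open>R\<close> brings the image onto the hyperplane of any coordinate \<open>j\<close>, which
  lets charts with different \<open>k\<close> share one factor.\<close>

lemma hausdorff_linear_image:
  fixes L :: "real ^ 'n \<Rightarrow> real ^ 'n::finite"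
  assumes L: "linear L" "inj L"
    and normal: "norm (L (axis k 1)) = 1" "\<And>v. v $ k = 0 \<Longrightarrow> L v \<bullet> L (axis k 1) = 0"
    and E: "E \<in> sets borel" "\<And>v. v \<in> E \<Longrightarrow> v $ k = 0"
  shows "hausdorff_outer (CARD('n) - 1) (L ` E)
    = hausdorff_factor (j :: 'n) * (ennreal \<bar>det (matrix L)\<bar> * emeasure (hyperplane_measure k) E)"
proof -
  have "\<exists>R. orthogonal_transformation R \<and> R (L (axis k 1)) = axis j (1 :: real)"
    by (rule orthogonal_transformation_exists[of "L (axis k 1)" "axis j (1 :: real)"]) (use normal(1) in auto)
  then obtain R :: "real ^ 'n \<Rightarrow> real ^ 'n"
    where R: "orthogonal_transformation R" "R (L (axis k 1)) = axis j 1" by blast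
  define A where "A = R \<circ> L"
  have linR: "linear R" using R(1) by (rule orthogonal_transformation_linear)
  have linA: "linear A" unfolding A_def using L(1) linR by (rule linear_compose)
  have injA: "inj A" unfolding A_def using L(2) orthogonal_transformation_inj[OF R(1)] by (intro inj_compose)
  interpret A: linear A by (rule linA)
  have Ak: "A (axis k 1) = axis j 1" by (simp add: A_def R)
  have A0: "A v $ j = 0" if "v $ k = 0" for v
  proof -
    have "A v $ j = A v \<bullet> axis j 1" by (simp add: inner_axis)
    also have "\<dots> = R (L v) \<bullet> R (L (axis k 1))" by (simp add: A_def R)
    also have "\<dots> = 0" using R(1) normal(2)[OF that] by (simp add: orthogonal_transformation_def)
    finally show ?thesis .
  qed
  have Adec: "A z = A (zero_coord k z) + (z $ k) *\<^sub>R axis j 1" for z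
  proof -
    have "A z = A (zero_coord k z + (z $ k) *\<^sub>R axis k 1)" by (simp only: zero_coord_decomp)
    then show ?thesis by (simp only: A.add A.scale Ak)
  qed
  have zA: "zero_coord j (A z) = A (zero_coord k z)" "A z $ j = z $ k" for z
  proof -
    have "A (zero_coord k z) $ j = 0" by (rule A0) simp
    then show "zero_coord j (A z) = A (zero_coord k z)" "A z $ j = z $ k"
      unfolding Adec[of z] by (simp_all add: zero_coord_id)
  qed
  have AE: "A ` E \<in> sets borel" by (rule linear_image_borel[OF linA injA E(1)])
  have surjA: "surj A" using linear_injective_imp_surjective[OF linA injA] by simp
  have slab: "{w. zero_coord j w \<in> A ` E \<and> 0 < w $ j \<and> w $ j < 1}
      = A ` {z. zero_coord k z \<in> E \<and> 0 < z $ k \<and> z $ k < 1}" (is "?l = A ` ?r")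
  proof
    show "A ` ?r \<subseteq> ?l" by (auto simp: zA)
    show "?l \<subseteq> A ` ?r"
    proof
      fix w assume w: "w \<in> ?l"
      obtain z where z: "w = A z" using surjA by (rule surjE)
      then have "A (zero_coord k z) \<in> A ` E" using w by (simp add: zA)
      then have "zero_coord k z \<in> E" using injA by (simp add: inj_image_mem_iff)
      then have "z \<in> ?r" using w z by (simp add: zA)
      then show "w \<in> A ` ?r" unfolding z by (rule imageI)
    qed
  qed
  have sl: "{z. zero_coord k z \<in> E \<and> 0 < z $ k \<and> z $ k < 1} \<in> sets borel"
  proof -
    note E(1) [measurable]
    show ?thesis by measurable
  qed
  have AE0: "w $ j = 0" if w: "w \<in> A ` E" for w
  proof -
    obtain v where "v \<in> E" "w = A v" using w by blast
    then show ?thesis using A0[OF E(2)] by simp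
  qed
  have "hausdorff_outer (CARD('n) - 1) (L ` E) = hausdorff_outer (CARD('n) - 1) (A ` E)"
    unfolding A_def image_comp[symmetric] hausdorff_outer_orthogonal_image[OF R(1)] by (rule refl)
  also have "\<dots> = hausdorff_factor j * emeasure (hyperplane_measure j) (A ` E)"
    by (rule hausdorff_hyperplane[OF AE AE0])
  also have "emeasure (hyperplane_measure j) (A ` E) = emeasure lborel (A ` {z. zero_coord k z \<in> E \<and> 0 < z $ k \<and> z $ k < 1})"
    unfolding emeasure_hyperplane_measure[OF AE] slab by (rule refl)
  also have "\<dots> = emeasure lebesgue (A ` {z. zero_coord k z \<in> E \<and> 0 < z $ k \<and> z $ k < 1})"
    using linear_image_borel[OF linA injA sl] by simp
  also have "\<dots> = ennreal \<bar>det (matrix A)\<bar> * emeasure (hyperplane_measure k) E"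
    unfolding emeasure_lborel_linear_image[OF linA injA sl] emeasure_hyperplane_measure[OF E(1)] by (rule refl)
  also have "\<bar>det (matrix A)\<bar> = \<bar>det (matrix L)\<bar>"
    using R(1) by (simp add: A_def matrix_compose[OF L(1) linR] det_mul abs_mult)
  finally show ?thesis .
qed

section \<open>The area formula for graphs\<close>

text \<open>Compares two images of the same set, later a graph and its tangent plane:
  \<open>f\<close> after an inverse of \<open>g\<close> is Lipschitz on the image of
  \<open>g\<close>.\<close>

lemma hausdorff_outer_image_le_image:
  assumes c: "c > 0" and lip: "\<And>a b. a \<in> A \<Longrightarrow> b \<in> A \<Longrightarrow> dist (f a) (f b) \<le> c * dist (g a) (g b)"
  shows "hausdorff_outer d (f ` A) \<le> ennreal (c ^ d) * hausdorff_outer d (g ` A)"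
proof -
  \<comment> \<open>The choice of the preimage is immaterial: where \<open>g\<close> takes equal
    values, the bound forces \<open>f\<close> to do so as well.\<close>
  define h where "h y = f (inv_into A g y)" for y
  have h: "h (g a) = f a" if a: "a \<in> A" for a
  proof -
    have "inv_into A g (g a) \<in> A" "g (inv_into A g (g a)) = g a"
      using a by (auto intro: inv_into_into f_inv_into_f)
    then have "dist (h (g a)) (f a) \<le> c * 0" using lip[of "inv_into A g (g a)" a] a by (simp add: h_def)
    then show ?thesis by simp
  qed
  then have "f ` A = h ` (g ` A)" by (force simp: image_image)
  also have "hausdorff_outer d \<dots> \<le> ennreal (c ^ d) * hausdorff_outer d (g ` A)"
    using c by (rule hausdorff_outer_Lipschitz_image) (auto simp: h lip)
  finally show ?thesis .
qed

lemma ennreal_le_if_le_mult: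
  assumes le: "\<And>c. c > 1 \<Longrightarrow> A \<le> ennreal c * B"
  shows "A \<le> B"
proof (cases "B = \<infinity>")
  case False
  then obtain b where b: "B = ennreal b" "b \<ge> 0" by (cases B) auto
  show ?thesis
  proof (rule ennreal_le_epsilon)
    fix e :: real assume e: "e > 0"
    \<comment> \<open>The denominator \<open>b + 1\<close> also covers \<open>b = 0\<close>.\<close>
    define c where "c = 1 + e / (b + 1)"
    have "c > 1" using e b by (simp add: c_def)
    moreover have "c * b \<le> b + e" using e b by (simp add: c_def field_simps)
    ultimately have "A \<le> ennreal (b + e)"
      using le[of c] b by (auto simp: ennreal_mult[symmetric] intro: order_trans ennreal_leI)
    then show "A \<le> B + ennreal e" using b e by simp
  qed
qed auto

lemma ex_ratio_power_le:
  assumes "c > (1 :: real)"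
  obtains \<epsilon> where "0 < \<epsilon>" "\<epsilon> < 1" "((1 + \<epsilon>) / (1 - \<epsilon>)) ^ m \<le> c"
proof -
  have "((\<lambda>\<epsilon> :: real. ((1 + \<epsilon>) / (1 - \<epsilon>)) ^ m) \<longlongrightarrow> ((1 + 0) / (1 - 0)) ^ m) (at_right 0)"
    by (intro tendsto_intros) auto
  then have "eventually (\<lambda>\<epsilon> :: real. ((1 + \<epsilon>) / (1 - \<epsilon>)) ^ m < c) (at_right 0)"
    using assms by (intro order_tendstoD) auto
  moreover have "eventually (\<lambda>\<epsilon> :: real. \<epsilon> \<in> {0<..<1}) (at_right 0)"
    by (rule eventually_at_right_real) simp
  ultimately have "eventually (\<lambda>\<epsilon> :: real. ((1 + \<epsilon>) / (1 - \<epsilon>)) ^ m < c \<and> \<epsilon> \<in> {0<..<1}) (at_right 0)"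
    by (rule eventually_conj)
  then have "\<exists>\<epsilon> :: real. ((1 + \<epsilon>) / (1 - \<epsilon>)) ^ m < c \<and> \<epsilon> \<in> {0<..<1}"
    by (rule eventually_happens'[OF trivial_limit_at_right_real])
  then show ?thesis using that by auto
qed

text \<open>The graph of \<open>g\<close> over the hyperplane of coordinate \<open>k\<close>, placed
  in space by the rotation \<open>R\<close> and the shift \<open>b\<close>.\<close>

locale C1_graph =
  fixes k :: "'n::finite" and R :: "real ^ 'n \<Rightarrow> real ^ 'n" and b :: "real ^ 'n"
    and g :: "real ^ 'n \<Rightarrow> real" and G :: "real ^ 'n \<Rightarrow> real ^ 'n"
  assumes R: "orthogonal_transformation R"
    and g: "\<And>z. GDERIV g z :> G z"
    and G: "continuous_on UNIV G"
begin

text \<open>The \<open>k\<close>-th coordinate of \<open>u\<close> is ignored on purpose: it becomes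
  the radial variable of \<open>cone_map\<close>.\<close>

definition param :: "real ^ 'n \<Rightarrow> real ^ 'n" where
  "param u = b + R (zero_coord k u + g (zero_coord k u) *\<^sub>R axis k 1)"

text \<open>Before rotation, the normal of the graph whose \<open>k\<close>-th entry is 1. Its
  length is the classical surface density, the square root of 1 + |grad g|^2 with the gradient taken
  within the hyperplane.\<close>

definition conormal :: "real ^ 'n \<Rightarrow> real ^ 'n" where
  "conormal u = axis k 1 - zero_coord k (G (zero_coord k u))"

definition dparam :: "real ^ 'n \<Rightarrow> real ^ 'n \<Rightarrow> real ^ 'n" where
  "dparam u h = R (zero_coord k h + (zero_coord k (G (zero_coord k u)) \<bullet> h) *\<^sub>R axis k 1)"

lemma linR: "linear R"
  using R by (rule orthogonal_transformation_linear)

lemma R_inner: "R x \<bullet> R y = x \<bullet> y"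
  using R by (simp add: orthogonal_transformation_def)

lemma R_norm: "norm (R x) = norm x"
  using R by (rule orthogonal_transformation_norm)

lemma zero_coord_inner: "zero_coord k x \<bullet> y = x \<bullet> zero_coord k y"
  by (auto simp: inner_vec_def zero_coord_def intro!: sum.cong)

lemma inner_zero_coord: "x $ k = 0 \<Longrightarrow> x \<bullet> zero_coord k y = x \<bullet> y"
  using zero_coord_inner[of x y] by (simp add: zero_coord_id)

lemma inner_axis_zero: "x $ k = 0 \<Longrightarrow> x \<bullet> axis k 1 = 0"
  by (simp add: inner_axis)

lemma param_zero_coord [simp]: "param (zero_coord k u) = param u"
  by (simp add: param_def)

lemma conormal_zero_coord [simp]: "conormal (zero_coord k u) = conormal u"
  by (simp add: conormal_def)

lemma conormal_nth: "conormal u $ k = 1"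
  by (simp add: conormal_def axis_def)

lemma norm_conormal_ge_1: "norm (conormal u) \<ge> 1"
  using component_le_norm_cart[of "conormal u" k] by (simp add: conormal_nth)

lemma g_has_derivative: "(g has_derivative (\<lambda>h. G z \<bullet> h)) (at z within S)"
  using g[of z] unfolding gderiv_def by (auto simp: inner_commute intro: has_derivative_at_withinI)

lemma continuous_g: "continuous_on S g"
  by (rule has_derivative_continuous_on) (rule g_has_derivative)

lemma continuous_zero_coord: "continuous_on S (zero_coord k)"
  by (intro linear_continuous_on linear_conv_bounded_linear[THEN iffD1] linear_zero_coord)

lemma continuous_R: "continuous_on S R"
  by (intro linear_continuous_on linear_conv_bounded_linear[THEN iffD1] linR)

lemma continuous_param: "continuous_on S param"
  unfolding param_def
  by (intro continuous_intros continuous_on_compose2[OF continuous_R] continuous_on_compose2[OF continuous_g]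
      continuous_zero_coord) auto

lemma continuous_conormal: "continuous_on S conormal"
  unfolding conormal_def
  by (intro continuous_intros continuous_on_compose2[OF continuous_zero_coord] continuous_on_compose2[OF G]
      continuous_zero_coord) auto

lemma measurable_param [measurable]: "param \<in> borel_measurable borel"
  using continuous_param by (rule borel_measurable_continuous_onI)

lemma measurable_conormal [measurable]: "conormal \<in> borel_measurable borel"
  using continuous_conormal by (rule borel_measurable_continuous_onI)

text \<open>The multiple of the axis added by \<open>dparam\<close> is orthogonal to the hyperplane.
  The bound turns errors relative to \<open>u - v\<close> into errors relative to its tangent
  image.\<close>

lemma dist_dparam_ge: "u $ k = 0 \<Longrightarrow> norm u \<le> norm (dparam z u)"
proof -
  assume u: "u $ k = 0"
  have "u \<bullet> u \<le> (u + c *\<^sub>R axis k 1) \<bullet> (u + c *\<^sub>R axis k 1)" for c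
    using inner_axis_zero[OF u] by (simp add: inner_add_left inner_add_right inner_commute inner_axis)
  then show ?thesis
    unfolding dparam_def R_norm zero_coord_id[OF u] by (simp add: norm_le)
qed

text \<open>Strict differentiability: both points vary, with an error that is uniform on the ball.
  Continuity of \<open>G\<close> and the mean value inequality for \<open>g\<close> minus its linear
  part at the centre give the bound.\<close>

lemma param_approx:
  assumes "\<epsilon> > 0"
  obtains \<delta> where "\<delta> > 0"
    "\<And>u v. u $ k = 0 \<Longrightarrow> v $ k = 0 \<Longrightarrow> u \<in> ball z \<delta> \<Longrightarrow> v \<in> ball z \<delta> \<Longrightarrow>
       norm (param u - param v - dparam z (u - v)) \<le> \<epsilon> * norm (u - v)"
    "\<And>u. u \<in> ball z \<delta> \<Longrightarrow> norm (conormal u - conormal z) \<le> \<epsilon>"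
proof -
  let ?z = "zero_coord k z"
  have "isCont G ?z" using G by (simp add: continuous_on_eq_continuous_at)
  then obtain \<delta>1 where \<delta>1: "\<delta>1 > 0" "\<And>x. dist x ?z < \<delta>1 \<Longrightarrow> dist (G x) (G ?z) < \<epsilon>"
    using assms unfolding continuous_at_eps_delta by blast
  have nz: "norm (zero_coord k x) \<le> norm x" for x :: "real ^ 'n"
    by (rule norm_le_componentwise_cart) (simp add: zero_coord_def)
  have bz: "zero_coord k u \<in> ball ?z \<delta>1" if "u \<in> ball z \<delta>1" for u
    using that nz[of "z - u"] by (simp add: dist_norm)
  show ?thesis
  proof (rule that[OF \<delta>1(1)])
    fix u v assume uv: "u $ k = 0" "v $ k = 0" "u \<in> ball z \<delta>1" "v \<in> ball z \<delta>1"
    define h where "h x = g x - G ?z \<bullet> x" for x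
    have u: "u \<in> ball ?z \<delta>1" "v \<in> ball ?z \<delta>1" using bz[OF uv(3)] bz[OF uv(4)] uv by (simp_all add: zero_coord_id)
    have "norm (h u - h v) \<le> \<epsilon> * norm (u - v)"
    proof (rule differentiable_bound[OF convex_ball _ _ u])
      fix x assume x: "x \<in> ball ?z \<delta>1"
      show "(h has_derivative (\<lambda>y. (G x - G ?z) \<bullet> y)) (at x within ball ?z \<delta>1)"
        unfolding h_def inner_diff_left
        by (intro has_derivative_diff g_has_derivative has_derivative_inner_right has_derivative_ident)
      show "onorm (\<lambda>y. (G x - G ?z) \<bullet> y) \<le> \<epsilon>"
      proof (rule onorm_le)
        fix y
        have "norm ((G x - G ?z) \<bullet> y) \<le> norm (G x - G ?z) * norm y"
          using Cauchy_Schwarz_ineq2 by simp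
        also have "\<dots> \<le> \<epsilon> * norm y"
          using \<delta>1(2)[of x] x by (intro mult_right_mono) (auto simp: dist_norm norm_minus_commute)
        finally show "norm ((G x - G ?z) \<bullet> y) \<le> \<epsilon> * norm y" .
      qed
    qed
    moreover have "param u - param v - dparam z (u - v) = R ((h u - h v) *\<^sub>R axis k 1)"
    proof -
      have uvk: "(u - v) $ k = 0" using uv by simp
      have "zero_coord k (G ?z) \<bullet> (u - v) = G ?z \<bullet> (u - v)"
        using zero_coord_inner[of "G ?z" "u - v"] by (simp only: zero_coord_id[OF uvk])
      then have "zero_coord k (G ?z) \<bullet> (u - v) = G ?z \<bullet> u - G ?z \<bullet> v" by (simp only: inner_diff_right)
      then show ?thesis
        unfolding param_def dparam_def zero_coord_id[OF uv(1)] zero_coord_id[OF uv(2)] zero_coord_id[OF uvk] h_def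
          \<open>zero_coord k (G ?z) \<bullet> (u - v) = G ?z \<bullet> u - G ?z \<bullet> v\<close>
        by (simp add: linear_add[OF linR] linear_diff[OF linR] linear_scale[OF linR] algebra_simps inner_diff_right)
    qed
    ultimately show "norm (param u - param v - dparam z (u - v)) \<le> \<epsilon> * norm (u - v)"
      by (simp add: R_norm)
  next
    fix u assume "u \<in> ball z \<delta>1"
    from bz[OF this] have "dist (G (zero_coord k u)) (G ?z) < \<epsilon>" by (intro \<delta>1(2)) (simp add: dist_commute)
    moreover have "conormal u - conormal z = - zero_coord k (G (zero_coord k u) - G ?z)"
      by (simp add: conormal_def)
    ultimately show "norm (conormal u - conormal z) \<le> \<epsilon>"
      using nz[of "G (zero_coord k u) - G ?z"] by (simp add: dist_norm del: zero_coord_simps)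
  qed
qed

text \<open>Serves twice: with \<open>c = 1\<close> and a unit normal for the area of tangent
  planes, and with \<open>c = z $ k\<close> and the vector from the apex for the Jacobian of
  \<open>cone_map\<close>.\<close>

lemma abs_det_dparam:
  "\<bar>det (matrix (\<lambda>h. c *\<^sub>R dparam z h + (h $ k) *\<^sub>R w))\<bar> = \<bar>c ^ (CARD('n) - 1) * (w \<bullet> R (conormal z))\<bar>"
proof -
  define p where "p = zero_coord k (G (zero_coord k z))"
  obtain w' where w': "w = R w'" using orthogonal_transformation_surj[OF R] by (metis surjE)
  define A where "A h = c *\<^sub>R (zero_coord k h + (p \<bullet> h) *\<^sub>R axis k 1) + (h $ k) *\<^sub>R w'" for h
  have linA: "linear A" unfolding A_def by (auto intro!: linearI simp: algebra_simps inner_right_distrib)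
  have "(\<lambda>h. c *\<^sub>R dparam z h + (h $ k) *\<^sub>R w) = R \<circ> A"
    by (auto simp: fun_eq_iff dparam_def A_def w' p_def linear_add[OF linR] linear_scale[OF linR])
  then have "\<bar>det (matrix (\<lambda>h. c *\<^sub>R dparam z h + (h $ k) *\<^sub>R w))\<bar> = \<bar>det (matrix A)\<bar>"
    using R by (simp add: matrix_compose[OF linA linR] det_mul abs_mult)
  also have "det (matrix A) = c ^ (CARD('n) - 1) * (w' \<bullet> (axis k 1 - p))"
    unfolding A_def by (rule det_graph_cone) (simp add: p_def)
  also have "w' \<bullet> (axis k 1 - p) = w \<bullet> R (conormal z)"
    by (simp add: w' R_inner conormal_def p_def)
  finally show ?thesis .
qed

text \<open>\<open>dparam z\<close> is completed to an invertible map \<open>A\<close> of the whole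
  space that sends the axis to the unit normal; the determinant of this completion is the length of
  the conormal.\<close>

lemma hausdorff_dparam_image:
  assumes E: "E \<in> sets borel" "\<And>v. v \<in> E \<Longrightarrow> v $ k = 0"
  shows "hausdorff_outer (CARD('n) - 1) (dparam z ` E)
    = hausdorff_factor (j :: 'n) * (ennreal (norm (conormal z)) * emeasure (hyperplane_measure k) E)"
proof -
  define N where "N = norm (conormal z)"
  have N: "N > 0" using norm_conormal_ge_1[of z] unfolding N_def by linarith
  define \<nu> where "\<nu> = R (conormal z) /\<^sub>R N"
  define A where "A h = 1 *\<^sub>R dparam z h + (h $ k) *\<^sub>R \<nu>" for h
  have linA: "linear A"
    unfolding A_def dparam_def
    by (auto intro!: linearI simp: algebra_simps inner_right_distrib linear_add[OF linR] linear_scale[OF linR])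
  have "\<bar>det (matrix A)\<bar> = \<bar>\<nu> \<bullet> R (conormal z)\<bar>"
    unfolding A_def abs_det_dparam by simp
  also have "\<dots> = N"
    using N by (simp add: \<nu>_def R_inner R_norm N_def dot_square_norm power2_eq_square)
  finally have det: "\<bar>det (matrix A)\<bar> = N" .
  have "inj A"
    using det N linA by (subst det_nz_iff_inj[symmetric]) auto
  have Ak: "A (axis k 1) = \<nu>"
    by (simp add: A_def dparam_def inner_axis linear_0[OF linR])
  have "A ` E = dparam z ` E"
    by (rule image_cong) (simp_all add: A_def E(2))
  moreover have "hausdorff_outer (CARD('n) - 1) (A ` E)
     = hausdorff_factor j * (ennreal \<bar>det (matrix A)\<bar> * emeasure (hyperplane_measure k) E)"
  proof (rule hausdorff_linear_image[OF linA \<open>inj A\<close> _ _ E])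
    show "norm (A (axis k 1)) = 1"
      using N unfolding Ak \<nu>_def norm_scaleR R_norm by (simp add: N_def)
    fix v :: "real ^ 'n" assume v: "v $ k = 0"
    let ?q = "zero_coord k (G (zero_coord k z))" and ?e = "axis k (1 :: real)"
    have "(v + (?q \<bullet> v) *\<^sub>R ?e) \<bullet> (?e - ?q) = v \<bullet> ?e - v \<bullet> ?q + (?q \<bullet> v) * (?e \<bullet> ?e - ?e \<bullet> ?q)"
      by (simp only: inner_add_left inner_diff_right inner_scaleR_left right_diff_distrib)
    also have "\<dots> = 0"
      using inner_axis_zero[OF v] inner_axis_zero[of ?q]
      by (simp add: inner_commute[of v ?q] inner_commute[of ?e ?q])
    finally have "dparam z v \<bullet> R (conormal z) = 0"
      unfolding dparam_def R_inner conormal_def zero_coord_id[OF v] .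
    then show "A v \<bullet> A (axis k 1) = 0"
      unfolding Ak by (simp add: A_def v \<nu>_def)
  qed
  ultimately show ?thesis by (simp add: det N_def)
qed

end

context C1_graph
begin

text \<open>Projection back to the hyperplane, defined and continuous on the whole space. Through it
  the graph is the set of fixed points of \<open>param\<close> after \<open>unparam\<close>, and
  images under \<open>param\<close> become preimages, which gives Borel measurability.\<close>

definition unparam :: "real ^ 'n \<Rightarrow> real ^ 'n" where
  "unparam y = zero_coord k (inv R (y - b))"

lemma unparam_param [simp]: "unparam (param u) = zero_coord k u"
proof -
  have "inv R (R x) = x" for x using R by (simp add: orthogonal_transformation_inj)
  then show ?thesis by (simp add: unparam_def param_def)
qed

lemma measurable_unparam [measurable]: "unparam \<in> borel_measurable borel"
proof -
  have "linear (inv R)" using R by (intro orthogonal_transformation_linear orthogonal_transformation_inv)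
  then have inv: "continuous_on UNIV (inv R)"
    by (intro linear_continuous_on linear_conv_bounded_linear[THEN iffD1])
  have "continuous_on UNIV (\<lambda>y. y - b)" by (intro continuous_intros)
  from continuous_on_compose2[OF inv this] have "continuous_on UNIV (\<lambda>y. inv R (y - b))" by simp
  from continuous_on_compose2[OF continuous_zero_coord[of UNIV] this]
  have "continuous_on UNIV unparam" by (simp add: unparam_def[abs_def])
  then show ?thesis by (rule borel_measurable_continuous_onI)
qed

definition graph :: "(real ^ 'n) set" where
  "graph = range param"

lemma mem_graph_iff: "y \<in> graph \<longleftrightarrow> param (unparam y) = y"
proof
  assume "y \<in> graph"
  then obtain u where "y = param u" by (auto simp: graph_def)
  then show "param (unparam y) = y" by simp
next
  assume "param (unparam y) = y"
  then show "y \<in> graph" unfolding graph_def by (metis rangeI)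
qed

lemma sets_graph [measurable]: "graph \<in> sets borel"
proof -
  have "graph = {y. param (unparam y) = y}" using mem_graph_iff by blast
  also have "\<dots> \<in> sets borel" by measurable
  finally show ?thesis .
qed

lemma param_image_eq:
  assumes "\<And>v. v \<in> E \<Longrightarrow> v $ k = 0"
  shows "param ` E = {y \<in> graph. unparam y \<in> E}"
proof (intro subset_antisym subsetI)
  fix y assume "y \<in> param ` E"
  then obtain v where "v \<in> E" "y = param v" by blast
  then show "y \<in> {y \<in> graph. unparam y \<in> E}"
    using assms by (simp add: graph_def zero_coord_id)
next
  fix y assume "y \<in> {y \<in> graph. unparam y \<in> E}"
  then have "unparam y \<in> E" "y = param (unparam y)" by (auto simp: mem_graph_iff)
  then show "y \<in> param ` E" by (rule image_eqI[rotated])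
qed

lemma sets_param_image:
  assumes E: "E \<in> sets borel" "\<And>v. v \<in> E \<Longrightarrow> v $ k = 0"
  shows "param ` E \<in> sets borel"
proof -
  note E(1) [measurable]
  have "{y \<in> graph. unparam y \<in> E} \<in> sets borel" by measurable
  then show ?thesis using param_image_eq[OF E(2)] by simp
qed

lemma inj_on_param:
  assumes "\<And>v. v \<in> E \<Longrightarrow> v $ k = 0"
  shows "inj_on param E"
proof (rule inj_onI)
  fix x y assume xy: "x \<in> E" "y \<in> E" "param x = param y"
  have "zero_coord k x = zero_coord k y" using arg_cong[OF xy(3), of unparam] by simp
  then show "x = y" using zero_coord_id[OF assms[OF xy(1)]] zero_coord_id[OF assms[OF xy(2)]] by simp
qed

definition area :: "(real ^ 'n) set \<Rightarrow> ennreal" where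
  "area E = (\<integral>\<^sup>+u. ennreal (norm (conormal u)) * indicator E u \<partial>hyperplane_measure k)"

text \<open>
  On a small ball \<open>param\<close> differs from its derivative at the centre by a factor between
  \<open>1 - \<epsilon>\<close> and \<open>1 + \<epsilon>\<close> in all distances, and \<open>conormal\<close> is almost constant.
\<close>

lemma area_local:
  assumes \<epsilon>: "0 < \<epsilon>" "\<epsilon> < 1"
  obtains \<delta> where "\<delta> > 0"
    "\<And>E. E \<in> sets borel \<Longrightarrow> (\<And>v. v \<in> E \<Longrightarrow> v $ k = 0) \<Longrightarrow> E \<subseteq> ball z \<delta> \<Longrightarrow>
       hausdorff_outer (CARD('n) - 1) (param ` E) \<le> ennreal (((1 + \<epsilon>) / (1 - \<epsilon>)) ^ CARD('n)) * (hausdorff_factor (j :: 'n) * area E) \<and>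
       hausdorff_factor j * area E \<le> ennreal (((1 + \<epsilon>) / (1 - \<epsilon>)) ^ CARD('n)) * hausdorff_outer (CARD('n) - 1) (param ` E)"
proof -
  let ?d = "CARD('n) - 1"
  \<comment> \<open>The power \<open>CARD('n)\<close> of \<open>K\<close> splits into n - 1 factors
    for the distortion of distances and one for the variation of
    \<open>norm (conormal u)\<close>.\<close>
  define K where "K = (1 + \<epsilon>) / (1 - \<epsilon>)"
  define N where "N u = norm (conormal u)" for u
  obtain \<delta> where \<delta>: "\<delta> > 0"
    "\<And>u v. u $ k = 0 \<Longrightarrow> v $ k = 0 \<Longrightarrow> u \<in> ball z \<delta> \<Longrightarrow> v \<in> ball z \<delta> \<Longrightarrow>
       norm (param u - param v - dparam z (u - v)) \<le> \<epsilon> * norm (u - v)"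
    "\<And>u. u \<in> ball z \<delta> \<Longrightarrow> norm (conormal u - conormal z) \<le> \<epsilon>"
    using param_approx[OF \<epsilon>(1), of z] by metis
  have N1: "N u \<ge> 1" for u unfolding N_def by (rule norm_conormal_ge_1)
  have d: "CARD('n) = Suc ?d" by simp
  show ?thesis
  proof (rule that[OF \<delta>(1)])
    fix E :: "(real ^ 'n) set"
    assume E: "E \<in> sets borel" "\<And>v. v \<in> E \<Longrightarrow> v $ k = 0" "E \<subseteq> ball z \<delta>"
    define h where "h = emeasure (hyperplane_measure k) E"
    define H where "H = hausdorff_outer ?d (param ` E)"
    \<comment> \<open>The absolute error \<open>\<epsilon>\<close> is also a relative one, because
      \<open>N z\<close> is at least 1.\<close>
    have Nle: "N u \<le> (1 + \<epsilon>) * N z" "(1 - \<epsilon>) * N z \<le> N u" if "u \<in> E" for u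
    proof -
      have "norm (conormal u - conormal z) \<le> \<epsilon>" using \<delta>(3) that E(3) by blast
      then have "\<bar>N u - N z\<bar> \<le> \<epsilon>"
        unfolding N_def using norm_triangle_ineq3[of "conormal u" "conormal z"] by linarith
      moreover have "\<epsilon> * 1 \<le> \<epsilon> * N z" using \<epsilon> N1 by (intro mult_left_mono) auto
      ultimately show "N u \<le> (1 + \<epsilon>) * N z" "(1 - \<epsilon>) * N z \<le> N u"
        by (auto simp: algebra_simps)
    qed
    have int_const: "(\<integral>\<^sup>+u. ennreal c * indicator E u \<partial>hyperplane_measure k) = ennreal c * h" for c
      unfolding h_def using E(1) by (intro nn_integral_cmult_indicator) simp
    have area_le: "area E \<le> ennreal ((1 + \<epsilon>) * N z) * h"
      unfolding area_def int_const[symmetric]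
      by (intro nn_integral_mono) (use Nle in \<open>auto simp: indicator_def N_def intro!: ennreal_leI\<close>)
    have area_ge: "ennreal ((1 - \<epsilon>) * N z) * h \<le> area E"
      unfolding area_def int_const[symmetric]
      by (intro nn_integral_mono) (use Nle in \<open>auto simp: indicator_def N_def intro!: ennreal_leI\<close>)
    have lin: "dparam z u - dparam z v = dparam z (u - v)" for u v
      unfolding dparam_def by (simp add: linear_diff[OF linR, symmetric] algebra_simps inner_diff_right)
    have dge: "norm (u - v) \<le> norm (dparam z (u - v))" if "u \<in> E" "v \<in> E" for u v
      by (rule dist_dparam_ge) (use that E(2) in simp)
    have ap: "norm (param u - param v - dparam z (u - v)) \<le> \<epsilon> * norm (dparam z (u - v))" if "u \<in> E" "v \<in> E" for u v
    proof -
      have "norm (param u - param v - dparam z (u - v)) \<le> \<epsilon> * norm (u - v)"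
        by (rule \<delta>(2)) (use that E in auto)
      also have "\<dots> \<le> \<epsilon> * norm (dparam z (u - v))" using \<epsilon> dge[OF that] by (intro mult_left_mono) auto
      finally show ?thesis .
    qed
    have lip1: "dist (param u) (param v) \<le> (1 + \<epsilon>) * dist (dparam z u) (dparam z v)" if "u \<in> E" "v \<in> E" for u v
      using ap[OF that] norm_triangle_ineq2[of "param u - param v" "dparam z (u - v)"]
      unfolding dist_norm lin by (simp add: algebra_simps)
    have lip2: "dist (dparam z u) (dparam z v) \<le> 1 / (1 - \<epsilon>) * dist (param u) (param v)" if "u \<in> E" "v \<in> E" for u v
    proof -
      have "(1 - \<epsilon>) * norm (dparam z (u - v)) \<le> norm (param u - param v)"
        using ap[OF that] norm_triangle_ineq2[of "dparam z (u - v)" "param u - param v"]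
        by (simp add: algebra_simps norm_minus_commute)
      then show ?thesis unfolding dist_norm lin using \<epsilon> by (simp add: field_simps)
    qed
    have HL: "hausdorff_outer ?d (dparam z ` E) = hausdorff_factor j * (ennreal (N z) * h)"
      unfolding N_def h_def by (rule hausdorff_dparam_image[OF E(1,2)])
    have "H \<le> ennreal ((1 + \<epsilon>) ^ ?d) * hausdorff_outer ?d (dparam z ` E)"
      unfolding H_def using \<epsilon> by (intro hausdorff_outer_image_le_image lip1) auto
    also have "\<dots> = ennreal ((1 + \<epsilon>) ^ ?d / (1 - \<epsilon>)) * (hausdorff_factor j * (ennreal ((1 - \<epsilon>) * N z) * h))"
    proof -
      have "ennreal ((1 + \<epsilon>) ^ ?d) * ennreal (N z) = ennreal ((1 + \<epsilon>) ^ ?d / (1 - \<epsilon>)) * ennreal ((1 - \<epsilon>) * N z)"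
        using \<epsilon> N1[of z] by (simp add: ennreal_mult[symmetric])
      then show ?thesis unfolding HL by (metis mult.assoc mult.left_commute)
    qed
    also have "\<dots> \<le> ennreal ((1 + \<epsilon>) ^ ?d / (1 - \<epsilon>)) * (hausdorff_factor j * area E)"
      by (intro mult_left_mono area_ge) auto
    also have "\<dots> \<le> ennreal (K ^ CARD('n)) * (hausdorff_factor j * area E)"
    proof (intro mult_right_mono ennreal_leI)
      have "(1 + \<epsilon>) ^ ?d / (1 - \<epsilon>) \<le> K ^ ?d * K"
      proof -
        have "1 + \<epsilon> \<le> K" "1 / (1 - \<epsilon>) \<le> K"
          using \<epsilon> by (simp_all add: K_def pos_le_divide_eq divide_right_mono mult_left_le)
        then have "(1 + \<epsilon>) ^ ?d * (1 / (1 - \<epsilon>)) \<le> K ^ ?d * K"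
          using \<epsilon> by (intro mult_mono power_mono) auto
        then show ?thesis by simp
      qed
      also have "K ^ ?d * K = K ^ CARD('n)" by (simp only: power_Suc2[symmetric] d[symmetric])
      finally show "(1 + \<epsilon>) ^ ?d / (1 - \<epsilon>) \<le> K ^ CARD('n)" .
    qed simp
    finally have 1: "H \<le> ennreal (K ^ CARD('n)) * (hausdorff_factor j * area E)" .
    have "hausdorff_factor j * area E \<le> hausdorff_factor j * (ennreal ((1 + \<epsilon>) * N z) * h)"
      by (intro mult_left_mono area_le) auto
    also have "\<dots> = ennreal (1 + \<epsilon>) * hausdorff_outer ?d (dparam z ` E)"
    proof -
      have "ennreal ((1 + \<epsilon>) * N z) = ennreal (1 + \<epsilon>) * ennreal (N z)"
        by (rule ennreal_mult) (use \<epsilon> N1[of z] in auto)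
      then show ?thesis unfolding HL by (metis mult.assoc mult.left_commute)
    qed
    also have "\<dots> \<le> ennreal (1 + \<epsilon>) * (ennreal ((1 / (1 - \<epsilon>)) ^ ?d) * H)"
      unfolding H_def using \<epsilon> by (intro mult_left_mono hausdorff_outer_image_le_image lip2) auto
    also have "\<dots> = ennreal ((1 + \<epsilon>) * (1 / (1 - \<epsilon>)) ^ ?d) * H"
      using \<epsilon> by (subst ennreal_mult) (simp_all add: mult.assoc)
    also have "\<dots> \<le> ennreal (K ^ CARD('n)) * H"
    proof (intro mult_right_mono ennreal_leI)
      have "1 + \<epsilon> \<le> K" "1 / (1 - \<epsilon>) \<le> K"
        using \<epsilon> by (simp_all add: K_def pos_le_divide_eq divide_right_mono mult_left_le)
      then have "(1 + \<epsilon>) * (1 / (1 - \<epsilon>)) ^ ?d \<le> K * K ^ ?d"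
        using \<epsilon> by (intro mult_mono power_mono) auto
      also have "K * K ^ ?d = K ^ CARD('n)" by (simp only: power_Suc[symmetric] d[symmetric])
      finally show "(1 + \<epsilon>) * (1 / (1 - \<epsilon>)) ^ ?d \<le> K ^ CARD('n)" .
    qed simp
    finally have 2: "hausdorff_factor j * area E \<le> ennreal (K ^ CARD('n)) * H" .
    show "hausdorff_outer ?d (param ` E) \<le> ennreal (((1 + \<epsilon>) / (1 - \<epsilon>)) ^ CARD('n)) * (hausdorff_factor j * area E) \<and>
       hausdorff_factor j * area E \<le> ennreal (((1 + \<epsilon>) / (1 - \<epsilon>)) ^ CARD('n)) * hausdorff_outer ?d (param ` E)"
      using 1 2 unfolding H_def K_def by blast
  qed
qed

lemma area_UN:
  assumes E: "\<And>i :: nat. E i \<in> sets borel" "disjoint_family E"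
  shows "area (\<Union>i. E i) = (\<Sum>i. area (E i))"
proof -
  let ?M = "density (hyperplane_measure k) (\<lambda>u. ennreal (norm (conormal u)))"
  have "area A = emeasure ?M A" if "A \<in> sets borel" for A
    unfolding area_def using that by (subst emeasure_density) auto
  moreover have "(\<Sum>i. emeasure ?M (E i)) = emeasure ?M (\<Union>i. E i)"
    using E by (intro suminf_emeasure) auto
  ultimately show ?thesis using E by simp
qed

lemma hausdorff_param_UN:
  assumes E: "\<And>i :: nat. E i \<in> sets borel" "disjoint_family E" "\<And>i v. v \<in> E i \<Longrightarrow> v $ k = 0"
  shows "hausdorff_outer d (param ` (\<Union>i. E i)) = (\<Sum>i. hausdorff_outer d (param ` E i))"
proof -
  have b: "param ` E i \<in> sets borel" for i by (rule sets_param_image) (use E in auto)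
  have inj: "inj_on param (\<Union>i. E i)" by (rule inj_on_param) (use E in auto)
  have "disjoint_family (\<lambda>i. param ` E i)"
    unfolding disjoint_family_on_def
  proof (intro ballI impI)
    fix m n :: nat assume "m \<noteq> n"
    then have "E m \<inter> E n = {}" using E(2) by (simp add: disjoint_family_on_def)
    moreover have "param ` (E m \<inter> E n) = param ` E m \<inter> param ` E n"
      by (rule inj_on_image_Int[OF inj]) auto
    ultimately show "param ` E m \<inter> param ` E n = {}" by simp
  qed
  then have "(\<Sum>i. emeasure (hausdorff_measure d) (param ` E i)) = emeasure (hausdorff_measure d) (\<Union>i. param ` E i)"
    using b by (intro suminf_emeasure) auto
  then show ?thesis
    using b by (simp add: emeasure_hausdorff_measure image_UN)
qed

text \<open>Countably many of the balls from the local estimate cover the space; the estimate is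
  summed over disjoint Borel pieces of \<open>E\<close> inside these balls. The resulting factor
  \<open>c\<close> tends to 1.\<close>

theorem hausdorff_param_image:
  assumes E: "E \<in> sets borel" "\<And>v. v \<in> E \<Longrightarrow> v $ k = 0"
  shows "hausdorff_outer (CARD('n) - 1) (param ` E) = hausdorff_factor (j :: 'n) * area E"
proof -
  let ?H = "\<lambda>E. hausdorff_outer (CARD('n) - 1) (param ` E)"
  have key: "?H E \<le> ennreal c * (hausdorff_factor j * area E) \<and> hausdorff_factor j * area E \<le> ennreal c * ?H E"
    if c: "c > 1" for c
  proof -
    obtain \<epsilon> where \<epsilon>: "0 < \<epsilon>" "\<epsilon> < 1" "((1 + \<epsilon>) / (1 - \<epsilon>)) ^ CARD('n) \<le> c"
      using ex_ratio_power_le[OF c, of "CARD('n)"] by metis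
    define K where "K = ennreal (((1 + \<epsilon>) / (1 - \<epsilon>)) ^ CARD('n))"
    have Kc: "K \<le> ennreal c" unfolding K_def using \<epsilon>(3) by (rule ennreal_leI)
    have "\<exists>\<delta>>0. \<forall>E. E \<in> sets borel \<longrightarrow> (\<forall>v. v \<in> E \<longrightarrow> v $ k = 0) \<longrightarrow> E \<subseteq> ball z \<delta> \<longrightarrow>
       ?H E \<le> K * (hausdorff_factor j * area E) \<and> hausdorff_factor j * area E \<le> K * ?H E" for z
      unfolding K_def by (rule area_local[OF \<epsilon>(1,2), of z j]) blast
    then obtain \<delta> where \<delta>: "\<And>z. \<delta> z > 0"
      "\<And>z E. E \<in> sets borel \<Longrightarrow> (\<And>v. v \<in> E \<Longrightarrow> v $ k = 0) \<Longrightarrow> E \<subseteq> ball z (\<delta> z) \<Longrightarrow>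
         ?H E \<le> K * (hausdorff_factor j * area E) \<and> hausdorff_factor j * area E \<le> K * ?H E"
      by metis
    define F where "F = range (\<lambda>z. ball z (\<delta> z))"
    obtain F' where F': "F' \<subseteq> F" "countable F'" "\<Union> F' = \<Union> F"
      using Lindelof[of F] unfolding F_def by blast
    have UF: "\<Union> F' = UNIV" unfolding F'(3) F_def using \<delta>(1) by (auto intro: centre_in_ball[THEN iffD2])
    then have "F' \<noteq> {}" by auto
    define B where "B = from_nat_into F'"
    have B: "B i \<in> F" "\<And>x. \<exists>i. x \<in> B i" for i
    proof -
      show "B i \<in> F" unfolding B_def by (rule subsetD[OF F'(1) from_nat_into[OF \<open>F' \<noteq> {}\<close>]])
      show "\<exists>i. x \<in> B i" for x
      proof -
        obtain b where "b \<in> F'" "x \<in> b" using UF by blast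
        obtain i where "from_nat_into F' i = b" using from_nat_into_surj[OF F'(2) \<open>b \<in> F'\<close>] by blast
        with \<open>x \<in> b\<close> show ?thesis unfolding B_def by blast
      qed
    qed
    define D where "D i = E \<inter> disjointed B i" for i
    have Bb: "B i \<in> sets borel" for i using B(1)[of i] by (auto simp: F_def)
    have Db: "D i \<in> sets borel" for i
      unfolding D_def using E(1) sets.range_disjointed_sets[of B borel] Bb by auto
    have disj: "disjoint_family D"
      using disjoint_family_disjointed[of B] unfolding D_def disjoint_family_on_def by blast
    have UD: "(\<Union>i. D i) = E"
    proof -
      have "(\<Union>i. D i) = E \<inter> (\<Union>i. B i)" unfolding D_def UN_disjointed_eq[of B, symmetric] by blast
      moreover have "(\<Union>i. B i) = UNIV" using B(2) by blast
      ultimately show ?thesis by simp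
    qed
    have D0: "v $ k = 0" if "v \<in> D i" for v i using that E(2) by (auto simp: D_def)
    have loc: "?H (D i) \<le> K * (hausdorff_factor j * area (D i)) \<and> hausdorff_factor j * area (D i) \<le> K * ?H (D i)" for i
    proof -
      obtain z where "B i = ball z (\<delta> z)" using B(1)[of i] by (auto simp: F_def)
      then have "D i \<subseteq> ball z (\<delta> z)" using disjointed_subset[of B i] by (auto simp: D_def)
      then show ?thesis by (intro \<delta>(2) Db D0)
    qed
    have H: "?H E = (\<Sum>i. ?H (D i))"
      using hausdorff_param_UN[of D "CARD('n) - 1", OF Db disj D0] unfolding UD .
    have A: "hausdorff_factor j * area E = (\<Sum>i. hausdorff_factor j * area (D i))"
      using area_UN[of D, OF Db disj] unfolding UD by simp
    have "?H E \<le> (\<Sum>i. K * (hausdorff_factor j * area (D i)))"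
      unfolding H by (intro suminf_le allI) (use loc in auto)
    also have "\<dots> = K * (hausdorff_factor j * area E)" unfolding A by simp
    also have "\<dots> \<le> ennreal c * (hausdorff_factor j * area E)" by (intro mult_right_mono Kc) simp
    finally have 1: "?H E \<le> ennreal c * (hausdorff_factor j * area E)" .
    have "hausdorff_factor j * area E \<le> (\<Sum>i. K * ?H (D i))"
      unfolding A by (intro suminf_le allI) (use loc in auto)
    also have "\<dots> = K * ?H E" unfolding H by simp
    also have "\<dots> \<le> ennreal c * ?H E" by (intro mult_right_mono Kc) simp
    finally show ?thesis using 1 by blast
  qed
  show ?thesis
    by (rule antisym) (rule ennreal_le_if_le_mult, use key in blast)+
qed

text \<open>The area formula for sets says that Hausdorff measure on the graph is the image under
  \<open>param\<close> of a density on the hyperplane; equal measures have equal integrals.\<close>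

theorem nn_integral_graph:
  assumes f [measurable]: "f \<in> borel_measurable borel"
  shows "(\<integral>\<^sup>+y. f y * indicator graph y \<partial>hausdorff_measure (CARD('n) - 1))
    = hausdorff_factor (j :: 'n) * (\<integral>\<^sup>+u. f (param u) * ennreal (norm (conormal u)) \<partial>hyperplane_measure k)"
proof -
  let ?H = "hausdorff_measure (CARD('n) - 1) :: (real ^ 'n) measure"
  let ?D = "density (hyperplane_measure k) (\<lambda>u. hausdorff_factor j * ennreal (norm (conormal u)))"
  have "density ?H (indicator graph) = distr ?D borel param"
  proof (rule measure_eqI)
    fix A assume "A \<in> sets (density ?H (indicator graph))"
    then have A [measurable]: "A \<in> sets borel" by simp
    \<comment> \<open>The condition \<open>u $ k = 0\<close> makes \<open>param\<close> injective on
      \<open>E\<close> and changes the preimage of \<open>A\<close> only by a null set.\<close>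
    define E where "E = {u. u $ k = 0 \<and> param u \<in> A}"
    have E [measurable]: "E \<in> sets borel" unfolding E_def by measurable
    have "emeasure (density ?H (indicator graph)) A = (\<integral>\<^sup>+y. indicator graph y * indicator A y \<partial>?H)"
      by (rule emeasure_density) auto
    also have "\<dots> = (\<integral>\<^sup>+y. indicator (graph \<inter> A) y \<partial>?H)"
      by (intro nn_integral_cong) (simp add: indicator_inter_arith)
    also have "\<dots> = emeasure ?H (graph \<inter> A)" by (rule nn_integral_indicator) auto
    also have "\<dots> = hausdorff_outer (CARD('n) - 1) (graph \<inter> A)" by (rule emeasure_hausdorff_measure) auto
    also have "graph \<inter> A = param ` E"
    proof (intro subset_antisym subsetI)
      fix y assume "y \<in> graph \<inter> A"
      then have "unparam y \<in> E" "y = param (unparam y)"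
        by (auto simp: mem_graph_iff E_def) (simp add: unparam_def)
      then show "y \<in> param ` E" by (rule image_eqI[rotated])
    qed (auto simp: E_def graph_def)
    also have "hausdorff_outer (CARD('n) - 1) (param ` E) = hausdorff_factor j * area E"
      by (rule hausdorff_param_image[OF E]) (simp add: E_def)
    also have "area E = (\<integral>\<^sup>+u. ennreal (norm (conormal u)) * indicator (param -` A) u \<partial>hyperplane_measure k)"
      unfolding area_def
      by (rule nn_integral_cong_AE, rule eventually_mono[OF AE_hyperplane_measure])
         (auto simp: E_def indicator_def)
    also have "hausdorff_factor j * \<dots> = (\<integral>\<^sup>+u. (hausdorff_factor j * ennreal (norm (conormal u))) * indicator (param -` A) u \<partial>hyperplane_measure k)"
      unfolding mult.assoc
      using measurable_sets_borel[OF measurable_param A] by (intro nn_integral_cmult[symmetric]) auto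
    also have "\<dots> = emeasure ?D (param -` A)"
      using measurable_sets_borel[OF measurable_param A] by (intro emeasure_density[symmetric]) auto
    also have "\<dots> = emeasure (distr ?D borel param) A"
      by (subst emeasure_distr) auto
    finally show "emeasure (density ?H (indicator graph)) A = emeasure (distr ?D borel param) A" .
  qed simp
  then have "(\<integral>\<^sup>+y. f y \<partial>density ?H (indicator graph)) = (\<integral>\<^sup>+y. f y \<partial>distr ?D borel param)" by simp
  moreover have "(\<integral>\<^sup>+y. f y \<partial>density ?H (indicator graph)) = (\<integral>\<^sup>+y. f y * indicator graph y \<partial>?H)"
    by (subst nn_integral_density) (auto simp: mult.commute)
  moreover have "(\<integral>\<^sup>+y. f y \<partial>distr ?D borel param) = (\<integral>\<^sup>+u. f (param u) \<partial>?D)"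
    by (rule nn_integral_distr) auto
  moreover have "(\<integral>\<^sup>+u. f (param u) \<partial>?D)
      = (\<integral>\<^sup>+u. hausdorff_factor j * (f (param u) * ennreal (norm (conormal u))) \<partial>hyperplane_measure k)"
    by (subst nn_integral_density) (auto simp: mult_ac)
  moreover have "\<dots> = hausdorff_factor j * (\<integral>\<^sup>+u. f (param u) * ennreal (norm (conormal u)) \<partial>hyperplane_measure k)"
    by (intro nn_integral_cmult) auto
  ultimately show ?thesis by simp
qed

end

section \<open>Cones over graphs\<close>

text \<open>The integral along one ray, and the source of the factor n in
  \<open>cone_energy\<close>.\<close>

lemma nn_integral_power_less:
  assumes n: "n > 0" and a: "a \<ge> 0"
  shows "(\<integral>\<^sup>+t. ennreal (t ^ (n - 1)) * indicator {t. 0 < t \<and> t ^ n < a} t \<partial>lborel) = ennreal (a / real n)"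
proof -
  define r where "r = root n a"
  have r: "r \<ge> 0" "r ^ n = a" using n a by (simp_all add: r_def)
  have "(\<integral>\<^sup>+t. ennreal (t ^ (n - 1)) * indicator {t. 0 < t \<and> t ^ n < a} t \<partial>lborel)
      = (\<integral>\<^sup>+t. ennreal (t ^ (n - 1)) * indicator {0..r} t \<partial>lborel)"
  proof (rule nn_integral_cong_AE)
    have "AE t in lborel. t \<noteq> (0 :: real)" "AE t in lborel. t \<noteq> r" by (rule AE_lborel_singleton)+
    then show "AE t in lborel. ennreal (t ^ (n - 1)) * indicator {t. 0 < t \<and> t ^ n < a} t = ennreal (t ^ (n - 1)) * indicator {0..r} t"
    proof eventually_elim
      case (elim t)
      have "0 < t \<and> t ^ n < a \<longleftrightarrow> 0 \<le> t \<and> t \<le> r"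
      proof
        assume t: "0 < t \<and> t ^ n < a"
        then have "t < r" using power_less_imp_less_base[of t n r] r by simp
        then show "0 \<le> t \<and> t \<le> r" using t by simp
      next
        assume t: "0 \<le> t \<and> t \<le> r"
        then have "0 < t" "t < r" using elim by auto
        then show "0 < t \<and> t ^ n < a" using power_strict_mono[of t r n] n r(2) by simp
      qed
      then show ?case by (simp add: indicator_def)
    qed
  qed
  also have "\<dots> = ennreal (r ^ n / real n - 0 ^ n / real n)"
  proof (rule nn_integral_FTC_Icc)
    show "((\<lambda>t. t ^ n / real n) has_real_derivative t ^ (n - 1)) (at t)" if "t \<in> {0..r}" for t :: real
      using n by (auto intro!: derivative_eq_intros)
  qed (use r in auto)
  also have "\<dots> = ennreal (a / real n)" using n r by (simp add: zero_power)
  finally show ?thesis .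
qed

definition energy_kernel :: "real ^ 'n \<Rightarrow> real ^ 'n \<Rightarrow> real ^ 'n \<Rightarrow> real ^ 'n \<Rightarrow> real" where
  "energy_kernel x \<nu> y \<mu> = \<bar>(\<nu> \<bullet> (y - x)) * ((y - x) \<bullet> \<mu>)\<bar> / norm (x - y) ^ (CARD('n) + 1)"

lemma energy_kernel_nonneg [simp]: "0 \<le> energy_kernel x \<nu> y \<mu>"
  by (simp add: energy_kernel_def)

text \<open>
  On the ray in direction \<open>w\<close> this set is the segment of length \<open>\<rho>\<close> with
  \<open>\<rho> ^ n = \<bar>\<nu> \<bullet> w\<bar> / norm w\<close>: the weight \<open>\<bar>\<nu> \<bullet> w\<bar>\<close> of the direction is
  encoded in the volume.
\<close>

definition weighted_cone :: "real ^ 'n \<Rightarrow> real ^ 'n \<Rightarrow> (real ^ 'n) set \<Rightarrow> (real ^ 'n) set" where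
  "weighted_cone x \<nu> A =
     {z. (\<exists>y\<in>A. \<exists>s>0. z = s *\<^sub>R (y - x)) \<and> norm z ^ (CARD('n) + 1) < \<bar>\<nu> \<bullet> z\<bar>}"

abbreviation kernel_integral :: "real ^ 'n \<Rightarrow> real ^ 'n \<Rightarrow> (real ^ 'n \<Rightarrow> real ^ 'n) \<Rightarrow> (real ^ 'n) set \<Rightarrow> ennreal" where
  "kernel_integral x \<nu> N A \<equiv>
     (\<integral>\<^sup>+y. ennreal (energy_kernel x \<nu> y (N y)) * indicator A y \<partial>hausdorff_measure (CARD('n) - 1))"

text \<open>The dimension undoes the division by n in the radial integral, and
  \<open>hausdorff_factor j\<close> converts hyperplane measure into Hausdorff measure.\<close>

abbreviation cone_energy :: "'n \<Rightarrow> real ^ 'n \<Rightarrow> real ^ 'n \<Rightarrow> (real ^ 'n) set \<Rightarrow> ennreal" where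
  "cone_energy j x \<nu> A \<equiv> hausdorff_factor j * (of_nat CARD('n) * emeasure lebesgue (weighted_cone x \<nu> A))"

context C1_graph
begin

text \<open>Extended off the graph through \<open>unparam\<close>, which makes it continuous on the
  whole space.\<close>

definition unit_normal :: "real ^ 'n \<Rightarrow> real ^ 'n" where
  "unit_normal y = R (conormal (unparam y)) /\<^sub>R norm (conormal (unparam y))"

text \<open>\<open>z $ k\<close> is the scale along the ray and the other coordinates select the
  point of the graph, so a cone over a piece of the graph is the image of an n-dimensional
  set.\<close>

definition cone_map :: "real ^ 'n \<Rightarrow> real ^ 'n \<Rightarrow> real ^ 'n" where
  "cone_map x z = (z $ k) *\<^sub>R (param z - x)"

lemma param_has_derivative: "(param has_derivative dparam z) (at z within S)"
proof -
  have Z: "bounded_linear (zero_coord k)"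
    by (intro linear_conv_bounded_linear[THEN iffD1] linear_zero_coord)
  have RR: "bounded_linear R" by (intro linear_conv_bounded_linear[THEN iffD1] linR)
  have dz: "(zero_coord k has_derivative zero_coord k) (at z within S)"
    using Z by (rule bounded_linear_imp_has_derivative)
  have "(g \<circ> zero_coord k has_derivative (\<lambda>h. G (zero_coord k z) \<bullet> h) \<circ> zero_coord k) (at z within S)"
    by (rule diff_chain_within[OF dz g_has_derivative])
  then have "((\<lambda>z. g (zero_coord k z)) has_derivative (\<lambda>h. zero_coord k (G (zero_coord k z)) \<bullet> h)) (at z within S)"
    by (simp add: o_def zero_coord_inner)
  then have "((\<lambda>z. zero_coord k z + g (zero_coord k z) *\<^sub>R axis k 1) has_derivative
      (\<lambda>h. zero_coord k h + (zero_coord k (G (zero_coord k z)) \<bullet> h) *\<^sub>R axis k 1)) (at z within S)"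
    by (intro has_derivative_add dz has_derivative_scaleR_left)
  from bounded_linear.has_derivative[OF RR this]
  have "((\<lambda>z. b + R (zero_coord k z + g (zero_coord k z) *\<^sub>R axis k 1)) has_derivative
      (\<lambda>h. 0 + R (zero_coord k h + (zero_coord k (G (zero_coord k z)) \<bullet> h) *\<^sub>R axis k 1))) (at z within S)"
    by (intro has_derivative_add has_derivative_const)
  then show ?thesis
    by (simp add: param_def[abs_def] dparam_def[abs_def])
qed

abbreviation cone_deriv :: "real ^ 'n \<Rightarrow> real ^ 'n \<Rightarrow> real ^ 'n \<Rightarrow> real ^ 'n" where
  "cone_deriv x z \<equiv> \<lambda>h. (z $ k) *\<^sub>R dparam z h + (h $ k) *\<^sub>R (param z - x)"

lemma cone_map_has_derivative:
  "(cone_map x has_derivative (\<lambda>h. (z $ k) *\<^sub>R dparam z h + (h $ k) *\<^sub>R (param z - x))) (at z within S)"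
proof -
  have "((\<lambda>z. z $ k) has_derivative (\<lambda>h. h $ k)) (at z within S)"
    by (intro bounded_linear_imp_has_derivative bounded_linear_vec_nth)
  moreover have "((\<lambda>z. param z - x) has_derivative (\<lambda>h. dparam z h - 0)) (at z within S)"
    by (intro has_derivative_diff has_derivative_const param_has_derivative)
  then have "((\<lambda>z. param z - x) has_derivative dparam z) (at z within S)" by simp
  ultimately have "((\<lambda>z. (z $ k) *\<^sub>R (param z - x)) has_derivative
      (\<lambda>h. (z $ k) *\<^sub>R dparam z h + (h $ k) *\<^sub>R (param z - x))) (at z within S)"
    by (rule has_derivative_scaleR)
  then show ?thesis by (simp add: cone_map_def[abs_def])
qed

definition cone_dom :: "real ^ 'n \<Rightarrow> real ^ 'n \<Rightarrow> (real ^ 'n) set \<Rightarrow> (real ^ 'n) set" where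
  "cone_dom x \<nu> A = {z. param z \<in> A \<and> 0 < z $ k \<and>
     norm (cone_map x z) ^ (CARD('n) + 1) < \<bar>\<nu> \<bullet> cone_map x z\<bar>}"

lemma sets_cone_dom:
  assumes [measurable]: "A \<in> sets borel"
  shows "cone_dom x \<nu> A \<in> sets borel"
  unfolding cone_dom_def cone_map_def by measurable

lemma param_add_axis [simp]: "param (u + t *\<^sub>R axis k 1) = param u"
  by (simp add: param_def)

lemma cone_map_image:
  assumes "A \<subseteq> graph"
  shows "cone_map x ` cone_dom x \<nu> A = weighted_cone x \<nu> A"
proof (intro subset_antisym subsetI)
  fix w assume "w \<in> cone_map x ` cone_dom x \<nu> A"
  then obtain z where z: "z \<in> cone_dom x \<nu> A" "w = cone_map x z" by blast
  have "param z \<in> A" "0 < z $ k" "w = (z $ k) *\<^sub>R (param z - x)"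
    using z by (simp_all add: cone_dom_def cone_map_def)
  then have "\<exists>y\<in>A. \<exists>s>0. w = s *\<^sub>R (y - x)" by blast
  then show "w \<in> weighted_cone x \<nu> A"
    using z by (simp add: weighted_cone_def cone_dom_def)
next
  fix w assume w: "w \<in> weighted_cone x \<nu> A"
  then obtain y s where ys: "y \<in> A" "s > 0" "w = s *\<^sub>R (y - x)" unfolding weighted_cone_def by blast
  have y: "param (unparam y) = y" using assms ys(1) mem_graph_iff by blast
  define z where "z = unparam y + s *\<^sub>R axis k 1"
  have "z $ k = s" by (simp add: z_def unparam_def)
  moreover have "param z = y" by (simp add: z_def y)
  ultimately have "cone_map x z = w" "z \<in> cone_dom x \<nu> A"
    using w ys by (auto simp: cone_map_def cone_dom_def weighted_cone_def)
  then show "w \<in> cone_map x ` cone_dom x \<nu> A" by blast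
qed

lemma measurable_unit_normal [measurable]: "unit_normal \<in> borel_measurable borel"
proof -
  have "R \<in> borel_measurable borel" using continuous_R by (rule borel_measurable_continuous_onI)
  note this [measurable]
  show ?thesis unfolding unit_normal_def[abs_def] by measurable
qed

lemma measurable_energy_kernel_normal [measurable]:
  "(\<lambda>y. energy_kernel x \<nu> y (unit_normal y)) \<in> borel_measurable borel"
  unfolding energy_kernel_def by measurable

text \<open>Fubini along the \<open>k\<close>-th axis. Over a fixed \<open>u\<close> the Jacobian is
  t^(n-1) times a constant and the truncation reads t^n < a; the constant times a/n is the kernel
  times the surface density, divided by n.\<close>

lemma nn_integral_cone_dom:
  assumes A: "A \<in> sets borel"
  shows "jacobian_integral (cone_deriv x) (cone_dom x \<nu> A)
    = (\<integral>\<^sup>+u. ennreal (energy_kernel x \<nu> (param u) (unit_normal (param u)) * norm (conormal u) / real CARD('n))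
        * indicator A (param u) \<partial>hyperplane_measure k)" (is "?l = ?r")
proof -
  let ?n = "CARD('n)"
  note A [measurable]
  have Rm [measurable]: "R \<in> borel_measurable borel" using continuous_R by (rule borel_measurable_continuous_onI)
  note sets_cone_dom[OF A, measurable]
  define f where "f z = ennreal \<bar>(z $ k) ^ (?n - 1) * ((param z - x) \<bullet> R (conormal z))\<bar> * indicator (cone_dom x \<nu> A) z" for z
  have "?l = (\<integral>\<^sup>+z. f z \<partial>lborel)"
    unfolding abs_det_dparam f_def ..
  also have "\<dots> = (\<integral>\<^sup>+u. \<integral>\<^sup>+t. f (u + t *\<^sub>R axis k 1) \<partial>lborel \<partial>hyperplane_measure k)"
    by (rule nn_integral_lborel_hyperplane_pair) (unfold f_def, measurable)
  also have "\<dots> = ?r"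
  proof (rule nn_integral_cong_AE, rule eventually_mono[OF AE_hyperplane_measure])
    fix u :: "real ^ 'n" assume u: "u $ k = 0"
    define w where "w = param u - x"
    define c where "c = \<bar>w \<bullet> R (conormal u)\<bar>"
    \<comment> \<open>The truncation at \<open>t *\<^sub>R w\<close>, solved for
      \<open>t ^ n\<close>: one of the n + 1 factors \<open>t\<close> cancels against the linear
      right-hand side. At \<open>w = 0\<close> the value is 0, since division by 0 yields 0.\<close>
    define a where "a = \<bar>\<nu> \<bullet> w\<bar> / norm w ^ (?n + 1)"
    have a: "a \<ge> 0" by (simp add: a_def)
    have cone: "u + t *\<^sub>R axis k 1 \<in> cone_dom x \<nu> A \<longleftrightarrow> param u \<in> A \<and> w \<noteq> 0 \<and> 0 < t \<and> t ^ ?n < a" for t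
    proof (cases "0 < t \<and> w \<noteq> 0")
      case True
      then have "norm (t *\<^sub>R w) ^ (?n + 1) < \<bar>\<nu> \<bullet> (t *\<^sub>R w)\<bar> \<longleftrightarrow> t * (t ^ ?n * norm w ^ (?n + 1)) < t * \<bar>\<nu> \<bullet> w\<bar>"
        by (simp add: power_mult_distrib abs_mult mult_ac)
      also have "\<dots> \<longleftrightarrow> t ^ ?n * norm w ^ (?n + 1) < \<bar>\<nu> \<bullet> w\<bar>"
        using True by (intro mult_less_cancel_left_pos) auto
      also have "\<dots> \<longleftrightarrow> t ^ ?n < a"
        unfolding a_def using True by (intro pos_less_divide_eq[symmetric]) auto
      finally show ?thesis using True u by (simp add: cone_dom_def cone_map_def w_def)
    next
      case False
      then show ?thesis using u by (auto simp: cone_dom_def cone_map_def w_def)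
    qed
    have cn: "conormal (u + t *\<^sub>R axis k 1) = conormal u" for t
      by (simp add: conormal_def)
    have "f (u + t *\<^sub>R axis k 1) = (ennreal c * (indicator A (param u) * indicator (- {0}) w)) *
        (ennreal (t ^ (?n - 1)) * indicator {t. 0 < t \<and> t ^ ?n < a} t)" for t
    proof (cases "u + t *\<^sub>R axis k 1 \<in> cone_dom x \<nu> A")
      case True
      then have t: "param u \<in> A" "w \<noteq> 0" "0 < t" "t ^ ?n < a" using cone by auto
      have "f (u + t *\<^sub>R axis k 1) = ennreal (t ^ (?n - 1) * c)"
        using True t u by (simp add: f_def cn w_def c_def abs_mult)
      then show ?thesis using t by (simp add: ennreal_mult c_def mult.commute)
    next
      case False
      then have "f (u + t *\<^sub>R axis k 1) = 0" by (simp add: f_def)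
      moreover have "indicator A (param u) * indicator (- {0}) w * indicator {t. 0 < t \<and> t ^ ?n < a} t = (0 :: ennreal)"
        using False cone by (auto simp: indicator_def)
      ultimately show ?thesis by (auto simp: mult_ac)
    qed
    then have "(\<integral>\<^sup>+t. f (u + t *\<^sub>R axis k 1) \<partial>lborel) =
       (\<integral>\<^sup>+t. (ennreal c * (indicator A (param u) * indicator (- {0}) w)) *
        (ennreal (t ^ (?n - 1)) * indicator {t. 0 < t \<and> t ^ ?n < a} t) \<partial>lborel)" by simp
    also have "\<dots> = (ennreal c * (indicator A (param u) * indicator (- {0}) w)) *
       (\<integral>\<^sup>+t. ennreal (t ^ (?n - 1)) * indicator {t. 0 < t \<and> t ^ ?n < a} t \<partial>lborel)"
      by (rule nn_integral_cmult) measurable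
    also have "\<dots> = (ennreal c * (indicator A (param u) * indicator (- {0}) w)) * ennreal (a / real ?n)"
      by (subst nn_integral_power_less) (use a in auto)
    also have "\<dots> = ennreal (c * a / real ?n) * indicator A (param u)"
    proof (cases "w = 0")
      case False
      then show ?thesis using a by (auto simp: indicator_def ennreal_mult[symmetric] c_def)
    qed (simp add: a_def)
    \<comment> \<open>\<open>c\<close> contains the unnormalized normal, so passing to
      \<open>unit_normal\<close> leaves the factor \<open>norm (conormal u)\<close>.\<close>
    also have "c * a = energy_kernel x \<nu> (param u) (unit_normal (param u)) * norm (conormal u)"
    proof -
      have "w \<bullet> unit_normal (param u) = (w \<bullet> R (conormal u)) / norm (conormal u)"
        by (simp add: unit_normal_def divide_inverse_commute)
      moreover have "norm (conormal u) > 0" using norm_conormal_ge_1[of u] by linarith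
      ultimately show ?thesis
        by (simp add: energy_kernel_def c_def a_def w_def abs_mult norm_minus_commute)
    qed
    finally show "(\<integral>\<^sup>+t. f (u + t *\<^sub>R axis k 1) \<partial>lborel)
      = ennreal (energy_kernel x \<nu> (param u) (unit_normal (param u)) * norm (conormal u) / real ?n) * indicator A (param u)" .
  qed
  finally show ?thesis .
qed

lemma nn_integral_energy_kernel:
  assumes A: "A \<in> sets borel" "A \<subseteq> graph"
  shows "kernel_integral x \<nu> unit_normal A
    = hausdorff_factor (j :: 'n) * (of_nat CARD('n) *
     jacobian_integral (cone_deriv x) (cone_dom x \<nu> A))"
proof -
  let ?n = "CARD('n)"
  note A(1) [measurable]
  let ?f = "\<lambda>y. ennreal (energy_kernel x \<nu> y (unit_normal y)) * indicator A y"
  have "(\<integral>\<^sup>+y. ?f y \<partial>hausdorff_measure (?n - 1)) = (\<integral>\<^sup>+y. ?f y * indicator graph y \<partial>hausdorff_measure (?n - 1))"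
    using A(2) by (intro nn_integral_cong) (auto simp: indicator_def)
  also have "\<dots> = hausdorff_factor j * (\<integral>\<^sup>+u. ?f (param u) * ennreal (norm (conormal u)) \<partial>hyperplane_measure k)"
    by (rule nn_integral_graph) measurable
  also have "(\<integral>\<^sup>+u. ?f (param u) * ennreal (norm (conormal u)) \<partial>hyperplane_measure k)
    = (\<integral>\<^sup>+u. of_nat ?n * (ennreal (energy_kernel x \<nu> (param u) (unit_normal (param u)) * norm (conormal u) / real ?n)
        * indicator A (param u)) \<partial>hyperplane_measure k)"
  proof (intro nn_integral_cong)
    fix u
    have "ennreal (energy_kernel x \<nu> (param u) (unit_normal (param u))) * ennreal (norm (conormal u))
      = ennreal (real ?n) * ennreal (energy_kernel x \<nu> (param u) (unit_normal (param u)) * norm (conormal u) / real ?n)"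
      by (simp add: ennreal_mult[symmetric])
    then show "?f (param u) * ennreal (norm (conormal u))
      = of_nat ?n * (ennreal (energy_kernel x \<nu> (param u) (unit_normal (param u)) * norm (conormal u) / real ?n)
        * indicator A (param u))"
      by (auto simp: indicator_def ennreal_of_nat_eq_real_of_nat)
  qed
  also have "\<dots> = of_nat ?n * (\<integral>\<^sup>+u. ennreal (energy_kernel x \<nu> (param u) (unit_normal (param u)) * norm (conormal u) / real ?n)
        * indicator A (param u) \<partial>hyperplane_measure k)"
    by (rule nn_integral_cmult) measurable
  finally show ?thesis unfolding nn_integral_cone_dom[OF A(1)] .
qed

lemma sets_weighted_cone:
  assumes "A \<in> sets borel" "A \<subseteq> graph"
  shows "weighted_cone x \<nu> A \<in> sets lebesgue"
  unfolding cone_map_image[OF assms(2), symmetric]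
  by (rule sets_differentiable_image[OF _ cone_map_has_derivative]) (use sets_cone_dom[OF assms(1)] in simp)

text \<open>The integral of the Jacobian counts points of the cone with multiplicity, the volume of
  the image counts them once.\<close>

theorem weighted_cone_le:
  assumes A: "A \<in> sets borel" "A \<subseteq> graph"
  shows "cone_energy (j :: 'n) x \<nu> A
    \<le> kernel_integral x \<nu> unit_normal A"
  unfolding nn_integral_energy_kernel[OF A, of x \<nu> j] cone_map_image[OF A(2), symmetric]
  by (intro mult_left_mono emeasure_differentiable_image_le[OF _ cone_map_has_derivative])
    (use sets_cone_dom[OF A(1)] in simp_all)

text \<open>Rays orthogonal to \<open>\<nu>\<close> contain no point of the truncated cone, so
  uniqueness of intersection for all other rays already makes \<open>cone_map\<close> injective on
  \<open>cone_dom\<close>.\<close>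

theorem weighted_cone_eq:
  assumes A: "A \<in> sets borel" "A \<subseteq> graph"
    and inj: "\<And>y y' s. y \<in> A \<Longrightarrow> y' \<in> A \<Longrightarrow> s > 0 \<Longrightarrow> \<nu> \<bullet> (y - x) \<noteq> 0 \<Longrightarrow> y' - x = s *\<^sub>R (y - x) \<Longrightarrow> y = y'"
  shows "cone_energy (j :: 'n) x \<nu> A
    = kernel_integral x \<nu> unit_normal A"
proof -
  have "inj_on (cone_map x) (cone_dom x \<nu> A)"
  proof (rule inj_onI)
    fix z z' assume z: "z \<in> cone_dom x \<nu> A" "z' \<in> cone_dom x \<nu> A" "cone_map x z = cone_map x z'"
    define y y' where "y = param z" and "y' = param z'"
    have yA: "y \<in> A" "y' \<in> A" and pos: "z $ k > 0" "z' $ k > 0"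
      using z by (auto simp: cone_dom_def y_def y'_def)
    have eq: "(z $ k) *\<^sub>R (y - x) = (z' $ k) *\<^sub>R (y' - x)" using z(3) by (simp add: cone_map_def y_def y'_def)
    have "\<nu> \<bullet> cone_map x z \<noteq> 0"
    proof
      assume "\<nu> \<bullet> cone_map x z = 0"
      then have "norm (cone_map x z) ^ (CARD('n) + 1) < 0" using z(1) by (simp add: cone_dom_def)
      then show False using zero_le_power[OF norm_ge_zero, of "cone_map x z" "CARD('n) + 1"] by linarith
    qed
    then have \<nu>: "\<nu> \<bullet> (y - x) \<noteq> 0" by (auto simp: cone_map_def y_def)
    have "y' - x = (1 / z' $ k) *\<^sub>R ((z' $ k) *\<^sub>R (y' - x))" using pos by simp
    also have "\<dots> = (z $ k / z' $ k) *\<^sub>R (y - x)" unfolding eq[symmetric] by simp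
    finally have "y = y'" using pos by (intro inj[OF yA _ \<nu>, of "z $ k / z' $ k"]) auto
    moreover have "y - x \<noteq> 0" using \<nu> by auto
    ultimately have "z $ k = z' $ k" using eq by simp
    moreover have "zero_coord k z = zero_coord k z'"
      using arg_cong[OF \<open>y = y'\<close>, of unparam] by (simp add: y_def y'_def)
    ultimately have "zero_coord k z + (z $ k) *\<^sub>R axis k 1 = zero_coord k z' + (z' $ k) *\<^sub>R axis k 1"
      by (simp only:)
    then show "z = z'" unfolding zero_coord_decomp .
  qed
  then have "emeasure lebesgue (cone_map x ` cone_dom x \<nu> A) =
     jacobian_integral (cone_deriv x) (cone_dom x \<nu> A)"
    using sets_cone_dom[OF A(1)] by (intro emeasure_differentiable_image_eq[OF _ cone_map_has_derivative]) simp_all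
  then show ?thesis
    unfolding nn_integral_energy_kernel[OF A, of x \<nu> j] cone_map_image[OF A(2), symmetric] by simp
qed

end

section \<open>Charts and normals\<close>

context C1_graph
begin

text \<open>Defining function of the graph: in a chart the domain is the region where it is
  negative, and its gradient is the rotated conormal.\<close>

definition height :: "real ^ 'n \<Rightarrow> real" where
  "height y = inv R (y - b) $ k - g (unparam y)"

lemma inv_R: "inv R (R x) = x" "R (inv R x) = x"
  using R by (simp_all add: orthogonal_transformation_inj orthogonal_transformation_surj surj_f_inv_f)

lemma linear_inv_R: "linear (inv R)"
  using R by (intro orthogonal_transformation_linear orthogonal_transformation_inv)

lemma inner_inv_R: "x \<bullet> inv R y = R x \<bullet> y"
  using R_inner[of x "inv R y"] by (simp add: inv_R)

lemma height_eq_0_iff: "height y = 0 \<longleftrightarrow> y \<in> graph"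
proof -
  define z where "z = inv R (y - b)"
  have y: "y = b + R z" by (simp add: z_def inv_R)
  have "unparam y = zero_coord k z" by (simp add: unparam_def z_def)
  then have "param (unparam y) = y \<longleftrightarrow> R (zero_coord k z + g (zero_coord k z) *\<^sub>R axis k 1) = R z"
    by (simp add: param_def y)
  also have "\<dots> \<longleftrightarrow> zero_coord k z + g (zero_coord k z) *\<^sub>R axis k 1 = z"
    using orthogonal_transformation_inj[OF R] by (simp add: inj_eq)
  also have "\<dots> \<longleftrightarrow> zero_coord k z + g (zero_coord k z) *\<^sub>R axis k 1 = zero_coord k z + (z $ k) *\<^sub>R axis k 1"
    unfolding zero_coord_decomp ..
  also have "\<dots> \<longleftrightarrow> g (zero_coord k z) = z $ k"
    by (simp add: axis_eq_0_iff)
  finally show ?thesis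
    unfolding mem_graph_iff height_def \<open>unparam y = zero_coord k z\<close> z_def[symmetric] by auto
qed

lemma height_has_derivative: "(height has_derivative (\<lambda>h. R (conormal (unparam y)) \<bullet> h)) (at y within S)"
proof -
  have BR: "bounded_linear (inv R)" by (intro linear_conv_bounded_linear[THEN iffD1] linear_inv_R)
  have Z: "bounded_linear (zero_coord k)"
    by (intro linear_conv_bounded_linear[THEN iffD1] linear_zero_coord)
  have "((\<lambda>y. y - b) has_derivative (\<lambda>h. h - 0)) (at y within S)"
    by (intro has_derivative_diff has_derivative_const has_derivative_ident)
  from bounded_linear.has_derivative[OF BR this]
  have d1: "((\<lambda>y. inv R (y - b)) has_derivative (\<lambda>h. inv R h)) (at y within S)" by simp
  from bounded_linear.has_derivative[OF Z this]
  have d2: "(unparam has_derivative (\<lambda>h. zero_coord k (inv R h))) (at y within S)"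
    by (simp add: unparam_def[abs_def])
  have "(g \<circ> unparam has_derivative (\<lambda>h. G (unparam y) \<bullet> h) \<circ> (\<lambda>h. zero_coord k (inv R h))) (at y within S)"
    by (rule diff_chain_within[OF d2 g_has_derivative])
  then have d3: "((\<lambda>y. g (unparam y)) has_derivative (\<lambda>h. G (unparam y) \<bullet> zero_coord k (inv R h))) (at y within S)"
    by (simp add: o_def)
  have d4: "((\<lambda>y. inv R (y - b) $ k) has_derivative (\<lambda>h. inv R h $ k)) (at y within S)"
    by (rule bounded_linear.has_derivative[OF bounded_linear_vec_nth d1])
  have uz: "zero_coord k (unparam y) = unparam y" by (simp add: unparam_def)
  have "inv R h $ k - G (unparam y) \<bullet> zero_coord k (inv R h) = R (conormal (unparam y)) \<bullet> h" for h
  proof -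
    have "R (conormal (unparam y)) \<bullet> h = conormal (unparam y) \<bullet> inv R h" by (simp add: inner_inv_R)
    also have "\<dots> = inv R h $ k - zero_coord k (G (unparam y)) \<bullet> inv R h"
      by (simp add: conormal_def uz inner_diff_left inner_axis')
    finally show ?thesis by (simp add: zero_coord_inner)
  qed
  then show ?thesis
    using has_derivative_diff[OF d4 d3] by (simp add: height_def[abs_def])
qed

lemma continuous_height: "continuous_on S height"
  by (rule has_derivative_continuous_on) (rule height_has_derivative)

lemma continuous_unparam: "continuous_on S unparam"
proof -
  have inv: "continuous_on UNIV (inv R)"
    by (intro linear_continuous_on linear_conv_bounded_linear[THEN iffD1] linear_inv_R)
  have "continuous_on S (\<lambda>y. y - b)" by (intro continuous_intros)
  from continuous_on_compose2[OF inv this] have "continuous_on S (\<lambda>y. inv R (y - b))" by simp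
  from continuous_on_compose2[OF continuous_zero_coord[of UNIV] this]
  show ?thesis by (simp add: unparam_def[abs_def])
qed

lemma norm_conormal_pos: "norm (conormal u) > 0"
  using norm_conormal_ge_1[of u] by linarith

lemma continuous_unit_normal: "continuous_on S unit_normal"
proof -
  have c: "continuous_on S (\<lambda>y. conormal (unparam y))"
    by (rule continuous_on_compose2[OF continuous_conormal[of UNIV] continuous_unparam]) simp
  have Rc: "continuous_on S (\<lambda>y. R (conormal (unparam y)))"
    by (rule continuous_on_compose2[OF continuous_R[of UNIV] c]) simp
  have "norm (conormal (unparam y)) \<noteq> 0" for y using norm_conormal_pos[of "unparam y"] by linarith
  then show ?thesis
    unfolding unit_normal_def[abs_def] by (intro continuous_intros c Rc) auto
qed

lemma norm_unit_normal: "norm (unit_normal y) = 1"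
  using norm_conormal_pos[of "unparam y"] by (simp add: unit_normal_def R_norm)

lemma R_conormal: "R (conormal (unparam y)) = norm (conormal (unparam y)) *\<^sub>R unit_normal y"
  using norm_conormal_pos[of "unparam y"] by (simp add: unit_normal_def)

text \<open>The derivative of \<open>height\<close> along \<open>v\<close> at a graph point is a
  positive multiple of \<open>v \<bullet> unit_normal y\<close>, so its sign decides on which side
  of the graph the ray starts.\<close>

lemma eventually_height_along:
  assumes y: "y \<in> graph"
  shows "v \<bullet> unit_normal y < 0 \<Longrightarrow> eventually (\<lambda>t. height (y + t *\<^sub>R v) < 0) (at_right 0)"
    and "v \<bullet> unit_normal y > 0 \<Longrightarrow> eventually (\<lambda>t. height (y + t *\<^sub>R v) > 0) (at_right 0)"
proof -
  let ?N = "norm (conormal (unparam y))"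
  have "((\<lambda>t. y + t *\<^sub>R v) has_derivative (\<lambda>t. 0 + t *\<^sub>R v)) (at 0)"
    by (intro has_derivative_add has_derivative_const has_derivative_scaleR_left has_derivative_ident)
  then have "(height \<circ> (\<lambda>t. y + t *\<^sub>R v) has_derivative (\<lambda>h. R (conormal (unparam y)) \<bullet> h) \<circ> (\<lambda>t. 0 + t *\<^sub>R v)) (at 0)"
    using height_has_derivative[of y] by (intro diff_chain_at) simp_all
  then have "((\<lambda>t. height (y + t *\<^sub>R v)) has_derivative (\<lambda>t. (R (conormal (unparam y)) \<bullet> v) * t)) (at 0)"
    by (simp add: o_def mult.commute)
  then have der: "((\<lambda>t. height (y + t *\<^sub>R v)) has_real_derivative (?N * (v \<bullet> unit_normal y))) (at 0)"
    by (simp add: has_field_derivative_def R_conormal inner_commute)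
  have h0: "height (y + 0 *\<^sub>R v) = 0" using y by (simp add: height_eq_0_iff)
  show "eventually (\<lambda>t. height (y + t *\<^sub>R v) < 0) (at_right 0)" if "v \<bullet> unit_normal y < 0"
  proof -
    have "?N * (v \<bullet> unit_normal y) < 0" using norm_conormal_pos that by (rule mult_pos_neg)
    from DERIV_neg_dec_right[OF der this] obtain d where d: "d > 0"
      "\<And>h. 0 < h \<Longrightarrow> h < d \<Longrightarrow> height (y + (0 + h) *\<^sub>R v) < height (y + 0 *\<^sub>R v)" by blast
    show ?thesis
      unfolding eventually_at_right_field
      by (rule exI[of _ d]) (use d h0 in auto)
  qed
  show "eventually (\<lambda>t. height (y + t *\<^sub>R v) > 0) (at_right 0)" if "v \<bullet> unit_normal y > 0"
  proof -
    have "0 < ?N * (v \<bullet> unit_normal y)" using norm_conormal_pos that by (rule mult_pos_pos)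
    from DERIV_pos_inc_right[OF der this] obtain d where d: "d > 0"
      "\<And>h. 0 < h \<Longrightarrow> h < d \<Longrightarrow> height (y + 0 *\<^sub>R v) < height (y + (0 + h) *\<^sub>R v)" by blast
    show ?thesis
      unfolding eventually_at_right_field
      by (rule exI[of _ d]) (use d h0 in auto)
  qed
qed

end

locale C1_chart = C1_graph k R b g G
  for k :: "'n::finite" and R :: "real ^ 'n \<Rightarrow> real ^ 'n" and b g G +
  fixes \<Omega> :: "(real ^ 'n) set" and x0 :: "real ^ 'n" and r :: real
  assumes open_\<Omega>: "open \<Omega>"
    and chart: "\<Omega> \<inter> ball x0 r = {y \<in> ball x0 r. height y < 0}"
begin

lemma mem_\<Omega>_iff: "y \<in> ball x0 r \<Longrightarrow> y \<in> \<Omega> \<longleftrightarrow> height y < 0"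
  using chart by blast

lemma eventually_in_ball:
  assumes "y \<in> ball x0 r"
  shows "eventually (\<lambda>t. y + t *\<^sub>R v \<in> ball x0 r) (at_right 0)"
proof -
  have "((\<lambda>t. y + t *\<^sub>R v) \<longlongrightarrow> y + 0 *\<^sub>R v) (at_right 0)" by (intro tendsto_intros)
  then have "((\<lambda>t. y + t *\<^sub>R v) \<longlongrightarrow> y) (at_right 0)" by simp
  then show ?thesis using topological_tendstoD[OF _ open_ball assms] by blast
qed

lemma eventually_inside:
  assumes "y \<in> ball x0 r" "y \<in> graph" "v \<bullet> unit_normal y < 0"
  shows "eventually (\<lambda>t. y + t *\<^sub>R v \<in> \<Omega>) (at_right 0)"
  using eventually_in_ball[OF assms(1), of v] eventually_height_along(1)[OF assms(2,3)]
  by eventually_elim (simp add: mem_\<Omega>_iff)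

lemma height_pos_not_closure:
  assumes y: "y \<in> ball x0 r" "height y > 0"
  shows "y \<notin> closure \<Omega>"
proof -
  have "open ({y. height y > 0} \<inter> ball x0 r)"
    using continuous_height[of UNIV] by (intro open_Int open_ball) (simp add: open_Collect_less continuous_on_const)
  moreover have "({y. height y > 0} \<inter> ball x0 r) \<inter> \<Omega> = {}" using mem_\<Omega>_iff by force
  ultimately have "({y. height y > 0} \<inter> ball x0 r) \<inter> closure \<Omega> = {}"
    by (simp add: open_Int_closure_eq_empty)
  then show ?thesis using y by blast
qed

lemma eventually_outside:
  assumes "y \<in> ball x0 r" "y \<in> graph" "v \<bullet> unit_normal y > 0"
  shows "eventually (\<lambda>t. y + t *\<^sub>R v \<notin> closure \<Omega>) (at_right 0)"
  using eventually_in_ball[OF assms(1), of v] eventually_height_along(2)[OF assms(2,3)]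
  by eventually_elim (rule height_pos_not_closure)

text \<open>A graph point is approached from the domain by moving against the normal. Conversely,
  nonzero height puts a point either into the open domain or outside its closure.\<close>

lemma frontier_chart: "y \<in> ball x0 r \<Longrightarrow> y \<in> frontier \<Omega> \<longleftrightarrow> y \<in> graph"
proof -
  assume y: "y \<in> ball x0 r"
  have fr: "frontier \<Omega> = closure \<Omega> - \<Omega>" using open_\<Omega> by (simp add: frontier_def interior_open)
  show "y \<in> frontier \<Omega> \<longleftrightarrow> y \<in> graph"
  proof
    assume yf: "y \<in> frontier \<Omega>"
    have "\<not> height y < 0" using yf y mem_\<Omega>_iff fr by auto
    moreover have "\<not> height y > 0" using height_pos_not_closure[OF y] yf fr by blast
    ultimately show "y \<in> graph" by (simp add: height_eq_0_iff[symmetric])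
  next
    assume yg: "y \<in> graph"
    then have "y \<notin> \<Omega>" using mem_\<Omega>_iff[OF y] height_eq_0_iff[of y] by simp
    moreover have "y \<in> closure \<Omega>"
    proof (rule Lim_in_closed_set[OF closed_closure])
      have "(- unit_normal y) \<bullet> unit_normal y < 0"
        using norm_unit_normal[of y] by (simp add: dot_square_norm)
      then have "eventually (\<lambda>t. y + t *\<^sub>R (- unit_normal y) \<in> \<Omega>) (at_right 0)"
        by (rule eventually_inside[OF y yg])
      then show "eventually (\<lambda>t. y + t *\<^sub>R (- unit_normal y) \<in> closure \<Omega>) (at_right 0)"
        by (rule eventually_mono) (use closure_subset in blast)
      have "((\<lambda>t. y + t *\<^sub>R (- unit_normal y)) \<longlongrightarrow> y + 0 *\<^sub>R (- unit_normal y)) (at_right 0)"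
        by (intro tendsto_intros)
      then show "((\<lambda>t. y + t *\<^sub>R (- unit_normal y)) \<longlongrightarrow> y) (at_right 0)" by simp
    qed (rule trivial_limit_at_right_real)
    ultimately show "y \<in> frontier \<Omega>" by (simp add: fr)
  qed
qed

text \<open>\<open>height\<close> vanishes along a curve in the boundary, so its derivative along
  the curve is 0.\<close>

lemma tangent_orthogonal:
  assumes y: "y \<in> ball x0 r" "y \<in> frontier \<Omega>" and v: "v \<in> tangent_vectors (frontier \<Omega>) y"
  shows "v \<bullet> unit_normal y = 0"
proof -
  obtain \<gamma> \<epsilon> where \<gamma>: "\<gamma> 0 = y" "\<epsilon> > 0" "\<And>t. \<bar>t\<bar> < \<epsilon> \<Longrightarrow> \<gamma> t \<in> frontier \<Omega>"
    "(\<gamma> has_vector_derivative v) (at (0 :: real))"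
    using v unfolding tangent_vectors_def by blast
  have "isCont \<gamma> 0" using \<gamma>(4) has_vector_derivative_continuous by blast
  then have "(\<gamma> \<longlongrightarrow> y) (at 0)" using \<gamma>(1) by (simp add: isCont_def)
  then have "eventually (\<lambda>t. \<gamma> t \<in> ball x0 r) (at 0)" using topological_tendstoD[OF _ open_ball y(1)] by blast
  then obtain d where d: "d > 0" "\<And>t. t \<noteq> 0 \<Longrightarrow> \<bar>t\<bar> < d \<Longrightarrow> \<gamma> t \<in> ball x0 r"
    unfolding eventually_at by (auto simp: dist_norm)
  have zero: "height (\<gamma> t) = 0" if "\<bar>t\<bar> < min d \<epsilon>" for t
  proof -
    have "\<gamma> t \<in> ball x0 r" using d(2)[of t] that y(1) \<gamma>(1) by (cases "t = 0") auto
    moreover have "\<gamma> t \<in> frontier \<Omega>" using \<gamma>(3) that by simp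
    ultimately show ?thesis using frontier_chart height_eq_0_iff by blast
  qed
  have "(height \<circ> \<gamma> has_derivative (\<lambda>h. R (conormal (unparam y)) \<bullet> h) \<circ> (\<lambda>t. t *\<^sub>R v)) (at 0)"
    using \<gamma>(4) height_has_derivative[of y UNIV] \<gamma>(1)
    by (intro diff_chain_at) (simp_all add: has_vector_derivative_def)
  then have D1: "(height \<circ> \<gamma> has_real_derivative (R (conormal (unparam y)) \<bullet> v)) (at 0)"
    by (simp add: has_field_derivative_def o_def mult.commute[of _ "_ \<bullet> _"])
  have "((\<lambda>_. 0) has_real_derivative 0) (at (0::real))" by simp
  then have D2: "(height \<circ> \<gamma> has_real_derivative 0) (at 0)"
    by (rule has_field_derivative_transform_within[of _ _ _ _ "min d \<epsilon>"]) (use d(1) \<gamma>(2) zero in \<open>auto simp: dist_norm\<close>)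
  have "R (conormal (unparam y)) \<bullet> v = 0" using DERIV_unique[OF D1 D2] .
  then have "norm (conormal (unparam y)) * (unit_normal y \<bullet> v) = 0" unfolding R_conormal by simp
  then show ?thesis using norm_conormal_pos[of "unparam y"] by (simp add: inner_commute)
qed

lemma dparam_tangent:
  assumes y: "y \<in> ball x0 r" "y \<in> frontier \<Omega>"
  shows "dparam (unparam y) h \<in> tangent_vectors (frontier \<Omega>) y"
proof -
  define \<gamma> where "\<gamma> t = param (unparam y + t *\<^sub>R h)" for t :: real
  have yp: "param (unparam y) = y" using y frontier_chart mem_graph_iff by blast
  have "((\<lambda>t. unparam y + t *\<^sub>R h) has_derivative (\<lambda>t. 0 + t *\<^sub>R h)) (at 0)"
    by (intro has_derivative_add has_derivative_const has_derivative_scaleR_left has_derivative_ident)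
  then have "(param \<circ> (\<lambda>t. unparam y + t *\<^sub>R h) has_derivative dparam (unparam y) \<circ> (\<lambda>t. 0 + t *\<^sub>R h)) (at 0)"
    using param_has_derivative[of "unparam y" UNIV] by (intro diff_chain_at) simp_all
  moreover have "dparam (unparam y) (t *\<^sub>R h) = t *\<^sub>R dparam (unparam y) h" for t
    unfolding dparam_def by (simp add: linear_scale[OF linR, symmetric] scaleR_add_right)
  ultimately have \<gamma>D: "(\<gamma> has_vector_derivative dparam (unparam y) h) (at 0)"
    by (simp add: \<gamma>_def[abs_def] o_def has_vector_derivative_def)
  have \<gamma>0: "\<gamma> 0 = y" by (simp add: \<gamma>_def yp)
  have "isCont \<gamma> 0" using \<gamma>D has_vector_derivative_continuous by blast
  then have "(\<gamma> \<longlongrightarrow> y) (at 0)" using \<gamma>0 by (simp add: isCont_def)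
  then have "eventually (\<lambda>t. \<gamma> t \<in> ball x0 r) (at 0)" using topological_tendstoD[OF _ open_ball y(1)] by blast
  then obtain d where d: "d > 0" "\<And>t. t \<noteq> 0 \<Longrightarrow> \<bar>t\<bar> < d \<Longrightarrow> \<gamma> t \<in> ball x0 r"
    unfolding eventually_at by (auto simp: dist_norm)
  have "\<gamma> t \<in> frontier \<Omega>" if "\<bar>t\<bar> < d" for t
  proof -
    have "\<gamma> t \<in> ball x0 r" using d(2)[of t] that y(1) \<gamma>0 by (cases "t = 0") auto
    then show ?thesis using frontier_chart by (simp add: \<gamma>_def graph_def)
  qed
  then show ?thesis using \<gamma>0 \<gamma>D d(1) unfolding tangent_vectors_def by blast
qed

text \<open>Orthogonality to the tangent vectors coming from \<open>dparam\<close> makes every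
  candidate a multiple of \<open>unit_normal y\<close>; unit length leaves only the sign, and the
  side condition fixes the sign.\<close>

lemma outward_unit_normal_eq:
  assumes y: "y \<in> ball x0 r" "y \<in> frontier \<Omega>"
  shows "outward_unit_normal \<Omega> y = unit_normal y"
proof -
  have yg: "y \<in> graph" using y frontier_chart by blast
  let ?\<nu> = "unit_normal y"
  have \<nu>\<nu>: "?\<nu> \<bullet> ?\<nu> = 1" using norm_unit_normal[of y] by (simp add: dot_square_norm)
  have inside: "eventually (\<lambda>t. y + t *\<^sub>R (- ?\<nu>) \<in> \<Omega>) (at_right 0)"
    by (rule eventually_inside[OF y(1) yg]) (simp add: \<nu>\<nu>)
  have "eventually (\<lambda>t. y + t *\<^sub>R ?\<nu> \<notin> closure \<Omega>) (at_right 0)"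
    by (rule eventually_outside[OF y(1) yg]) (simp add: \<nu>\<nu>)
  then have outside: "eventually (\<lambda>t. y + t *\<^sub>R ?\<nu> \<notin> \<Omega>) (at_right 0)"
    by (rule eventually_mono) (use closure_subset in blast)
  show ?thesis
    unfolding outward_unit_normal_def
  proof (rule the_equality)
    show "norm ?\<nu> = 1 \<and> (\<forall>v\<in>tangent_vectors (frontier \<Omega>) y. v \<bullet> ?\<nu> = 0) \<and>
        (\<forall>\<^sub>F t in at_right 0. y - t *\<^sub>R ?\<nu> \<in> \<Omega> \<and> y + t *\<^sub>R ?\<nu> \<notin> \<Omega>)"
      using norm_unit_normal tangent_orthogonal[OF y] eventually_conj[OF inside outside] by simp
  next
    fix \<mu> assume \<mu>: "norm \<mu> = 1 \<and> (\<forall>v\<in>tangent_vectors (frontier \<Omega>) y. v \<bullet> \<mu> = 0) \<and>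
        (\<forall>\<^sub>F t in at_right 0. y - t *\<^sub>R \<mu> \<in> \<Omega> \<and> y + t *\<^sub>R \<mu> \<notin> \<Omega>)"
    define m where "m = inv R \<mu>"
    have Rm: "R m = \<mu>" by (simp add: m_def inv_R)
    define q where "q = zero_coord k (G (zero_coord k (unparam y)))"
    \<comment> \<open>Test vector for which orthogonality of its image under \<open>dparam\<close>
      to \<open>\<mu>\<close> reads \<open>h \<bullet> h = 0\<close>.\<close>
    define h where "h = zero_coord k m + (m $ k) *\<^sub>R q"
    have hk: "h $ k = 0" by (simp add: h_def q_def)
    have "dparam (unparam y) h \<bullet> \<mu> = 0" using \<mu> dparam_tangent[OF y] by blast
    then have "(h + (q \<bullet> h) *\<^sub>R axis k 1) \<bullet> m = 0"
      unfolding dparam_def q_def[symmetric] zero_coord_id[OF hk] Rm[symmetric] R_inner .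
    then have "h \<bullet> m + (q \<bullet> h) * (m $ k) = 0" by (simp add: inner_add_left inner_axis')
    moreover have "h \<bullet> zero_coord k m = h \<bullet> m" by (rule inner_zero_coord[OF hk])
    ultimately have "h \<bullet> h = 0"
      by (subst (2) h_def) (simp add: inner_add_right inner_commute mult.commute)
    then have "h = 0" by simp
    then have "zero_coord k m = - ((m $ k) *\<^sub>R q)" by (simp add: h_def eq_neg_iff_add_eq_0)
    then have "m = (m $ k) *\<^sub>R conormal (unparam y)"
      using zero_coord_decomp[of k m] by (simp add: conormal_def q_def scaleR_diff_right)
    then have "\<mu> = (m $ k) *\<^sub>R R (conormal (unparam y))"
      using Rm linear_scale[OF linR] by metis
    then have "\<mu> = (m $ k * norm (conormal (unparam y))) *\<^sub>R ?\<nu>" by (simp add: R_conormal)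
    then obtain c where c: "\<mu> = c *\<^sub>R ?\<nu>" by blast
    have "\<bar>c\<bar> = 1" using \<mu> norm_unit_normal[of y] by (simp add: c)
    moreover have "c \<noteq> - 1"
    proof
      assume "c = - 1"
      then have "eventually (\<lambda>t. y + t *\<^sub>R ?\<nu> \<in> \<Omega>) (at_right 0)"
        using \<mu> by (auto simp: c elim: eventually_mono)
      then have "eventually (\<lambda>t. False) (at_right (0 :: real))" using outside by eventually_elim simp
      then show False by simp
    qed
    ultimately have "c = 1" by linarith
    then show "\<mu> = ?\<nu>" by (simp add: c)
  qed
qed

end

lemma C1_boundary_chart:
  fixes \<Omega> :: "(real ^ 'n::finite) set"
  assumes "open \<Omega>" "C1_boundary \<Omega>" "x \<in> frontier \<Omega>"
  shows "\<exists>r>0. \<exists>k R b g G. C1_chart k R b g G \<Omega> x r"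
proof -
  obtain r T k g where r: "r > 0" and T: "rigid_motion T" and g: "C1_fun g"
    and eq: "\<Omega> \<inter> ball x r = {y \<in> ball x r. T y $ k < g (zero_coord k (T y))}"
    using assms(2,3) unfolding C1_boundary_def by blast
  obtain a f where f: "orthogonal_transformation f" and Tf: "T = (\<lambda>x. a + f x)"
    using T unfolding rigid_motion_def by blast
  obtain G where G: "\<forall>z. GDERIV g z :> G z" "continuous_on UNIV G"
    using g unfolding C1_fun_def by blast
  \<comment> \<open>\<open>T\<close> flattens the boundary whereas \<open>param\<close> maps back
    into space, so the rotation \<open>R\<close> and the shift \<open>b\<close> are those of the
    inverse of \<open>T\<close>.\<close>
  define R where "R = inv f"
  define b where "b = - R a"
  have R: "orthogonal_transformation R" unfolding R_def using f by (rule orthogonal_transformation_inv)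
  have invR: "inv R = f" unfolding R_def using orthogonal_transformation_bij[OF f] by (rule inv_inv_eq)
  have fR: "f (R z) = z" for z unfolding R_def using orthogonal_transformation_surj[OF f] by (rule surj_f_inv_f)
  interpret C1_graph k R b g G by unfold_locales (use R G in auto)
  have Ty: "inv R (y - b) = T y" for y
    unfolding invR Tf b_def using linear_add[OF orthogonal_transformation_linear[OF f]] by (simp add: fR add.commute)
  have "height y < 0 \<longleftrightarrow> T y $ k < g (zero_coord k (T y))" for y
    by (simp add: height_def unparam_def Ty)
  then have "C1_chart k R b g G \<Omega> x r"
    by unfold_locales (use assms(1) eq in auto)
  then show ?thesis using r by blast
qed

lemma
  fixes \<Omega> :: "(real ^ 'n::finite) set"
  assumes \<Omega>: "open \<Omega>" "C1_boundary \<Omega>" and x: "x \<in> frontier \<Omega>"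
  shows norm_outward_unit_normal: "norm (outward_unit_normal \<Omega> x) = 1"
    and eventually_inside_domain: "v \<bullet> outward_unit_normal \<Omega> x < 0 \<Longrightarrow> eventually (\<lambda>t. x + t *\<^sub>R v \<in> \<Omega>) (at_right 0)"
    and eventually_outside_domain: "v \<bullet> outward_unit_normal \<Omega> x > 0 \<Longrightarrow> eventually (\<lambda>t. x + t *\<^sub>R v \<notin> closure \<Omega>) (at_right 0)"
proof -
  obtain r k R b g G where r: "r > 0" and C: "C1_chart k R b g G \<Omega> x r"
    using C1_boundary_chart[OF \<Omega> x] by blast
  interpret C1_chart k R b g G \<Omega> x r by (rule C)
  have xb: "x \<in> ball x r" using r by simp
  have xg: "x \<in> graph" using frontier_chart[OF xb] x by blast
  have eq: "outward_unit_normal \<Omega> x = unit_normal x" by (rule outward_unit_normal_eq[OF xb x])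
  show "norm (outward_unit_normal \<Omega> x) = 1" unfolding eq by (rule norm_unit_normal)
  show "v \<bullet> outward_unit_normal \<Omega> x < 0 \<Longrightarrow> eventually (\<lambda>t. x + t *\<^sub>R v \<in> \<Omega>) (at_right 0)"
    unfolding eq by (rule eventually_inside[OF xb xg])
  show "v \<bullet> outward_unit_normal \<Omega> x > 0 \<Longrightarrow> eventually (\<lambda>t. x + t *\<^sub>R v \<notin> closure \<Omega>) (at_right 0)"
    unfolding eq by (rule eventually_outside[OF xb xg])
qed

lemma continuous_on_outward_unit_normal:
  fixes \<Omega> :: "(real ^ 'n::finite) set"
  assumes \<Omega>: "open \<Omega>" "C1_boundary \<Omega>"
  shows "continuous_on (frontier \<Omega>) (outward_unit_normal \<Omega>)"
  unfolding continuous_on_eq_continuous_within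
proof
  fix x assume x: "x \<in> frontier \<Omega>"
  obtain r k R b g G where r: "r > 0" and C: "C1_chart k R b g G \<Omega> x r"
    using C1_boundary_chart[OF \<Omega> x] by blast
  interpret C1_chart k R b g G \<Omega> x r by (rule C)
  have "continuous (at x within frontier \<Omega>) unit_normal"
    using continuous_unit_normal[of "frontier \<Omega>"] x by (simp add: continuous_on_eq_continuous_within)
  then show "continuous (at x within frontier \<Omega>) (outward_unit_normal \<Omega>)"
  proof (rule continuous_transform_within[OF _ r x])
    fix y assume "y \<in> frontier \<Omega>" "dist y x < r"
    then show "unit_normal y = outward_unit_normal \<Omega> y"
      by (intro outward_unit_normal_eq[symmetric]) (simp_all add: dist_commute)
  qed
qed

text \<open>A segment that leaves the domain contains a boundary point \<open>x\<close>, and both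
  its ends lie in the half space at \<open>x\<close>. Then the end \<open>a\<close> lies on the
  bounding hyperplane, and a small shift of \<open>a\<close> along the normal stays in the domain
  but leaves the half space.\<close>

lemma convex_if_supporting:
  fixes \<Omega> :: "(real ^ 'n::finite) set"
  assumes \<Omega>: "open \<Omega>" "C1_boundary \<Omega>"
    and supp: "\<And>x y. x \<in> frontier \<Omega> \<Longrightarrow> y \<in> \<Omega> \<Longrightarrow> (y - x) \<bullet> outward_unit_normal \<Omega> x \<le> 0"
  shows "convex \<Omega>"
  unfolding convex_contains_segment
proof (intro ballI)
  fix a b assume ab: "a \<in> \<Omega>" "b \<in> \<Omega>"
  show "closed_segment a b \<subseteq> \<Omega>"
  proof (rule ccontr)
    assume "\<not> closed_segment a b \<subseteq> \<Omega>"
    then have "closed_segment a b \<inter> frontier \<Omega> \<noteq> {}"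
      using ab by (intro connected_Int_frontier connected_segment) auto
    then obtain x where x: "x \<in> closed_segment a b" "x \<in> frontier \<Omega>" by blast
    obtain t where t: "0 \<le> t" "t \<le> 1" "x = (1 - t) *\<^sub>R a + t *\<^sub>R b"
      using x(1) unfolding in_segment by blast
    have "x \<notin> \<Omega>" using x(2) \<Omega>(1) by (simp add: frontier_def interior_open)
    then have "t \<noteq> 1" using t ab by auto
    define \<nu> where "\<nu> = outward_unit_normal \<Omega> x"
    have "(1 - t) * ((a - x) \<bullet> \<nu>) + t * ((b - x) \<bullet> \<nu>) = ((1 - t) *\<^sub>R (a - x) + t *\<^sub>R (b - x)) \<bullet> \<nu>"
      by (simp add: inner_add_left)
    also have "(1 - t) *\<^sub>R (a - x) + t *\<^sub>R (b - x) = 0"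
      unfolding t(3) by (simp add: algebra_simps)
    finally have sum0: "(1 - t) * ((a - x) \<bullet> \<nu>) + t * ((b - x) \<bullet> \<nu>) = 0" by simp
    moreover have "t * ((b - x) \<bullet> \<nu>) \<le> 0"
      using supp[OF x(2) ab(2)] t(1) unfolding \<nu>_def by (rule mult_nonneg_nonpos[rotated])
    ultimately have "0 \<le> (1 - t) * ((a - x) \<bullet> \<nu>)" by linarith
    then have a0: "0 \<le> (a - x) \<bullet> \<nu>" using t(2) \<open>t \<noteq> 1\<close> by (simp add: zero_le_mult_iff)
    obtain e where e: "e > 0" "ball a e \<subseteq> \<Omega>" using \<Omega>(1) ab(1) by (meson open_contains_ball)
    have "norm \<nu> = 1" unfolding \<nu>_def by (rule norm_outward_unit_normal[OF \<Omega> x(2)])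
    then have "a + (e / 2) *\<^sub>R \<nu> \<in> ball a e" using e(1) by (simp add: dist_norm)
    then have "(a + (e / 2) *\<^sub>R \<nu> - x) \<bullet> \<nu> \<le> 0"
      using supp[OF x(2)] e(2) unfolding \<nu>_def by blast
    moreover have "(a + (e / 2) *\<^sub>R \<nu> - x) \<bullet> \<nu> = (a - x) \<bullet> \<nu> + e / 2"
      using \<open>norm \<nu> = 1\<close> by (simp add: inner_add_left inner_diff_left dot_square_norm)
    ultimately show False using a0 e(1) by linarith
  qed
qed

text \<open>Otherwise the segment from \<open>x\<close> to \<open>y\<close> would leave the closure
  at once, although the closure is convex and contains both ends.\<close>

lemma supporting_if_convex:
  fixes \<Omega> :: "(real ^ 'n::finite) set"
  assumes \<Omega>: "open \<Omega>" "C1_boundary \<Omega>" and "convex \<Omega>"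
    and x: "x \<in> frontier \<Omega>" and y: "y \<in> closure \<Omega>"
  shows "(y - x) \<bullet> outward_unit_normal \<Omega> x \<le> 0"
proof (rule ccontr)
  assume "\<not> (y - x) \<bullet> outward_unit_normal \<Omega> x \<le> 0"
  then have "eventually (\<lambda>t. x + t *\<^sub>R (y - x) \<notin> closure \<Omega>) (at_right 0)"
    by (intro eventually_outside_domain[OF \<Omega> x]) simp
  moreover have "eventually (\<lambda>t. t \<in> {0 <..< 1 :: real}) (at_right 0)"
    by (rule eventually_at_right_real) simp
  ultimately have "eventually (\<lambda>t :: real. False) (at_right 0)"
  proof eventually_elim
    case (elim t)
    have "x \<in> closure \<Omega>" using x by (simp add: frontier_def)
    then have "(1 - t) *\<^sub>R x + t *\<^sub>R y \<in> closure \<Omega>"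
      using convex_closure[OF \<open>convex \<Omega>\<close>] y elim by (intro convexD) auto
    moreover have "(1 - t) *\<^sub>R x + t *\<^sub>R y = x + t *\<^sub>R (y - x)" by (simp add: algebra_simps)
    ultimately show ?case using elim by simp
  qed
  then show False by simp
qed

section \<open>Finiteness and positivity of the surface measure\<close>

lemma emeasure_Int_nn_integral:
  assumes "A \<in> sets M" "B \<in> sets M"
  shows "emeasure M (A \<inter> B) = (\<integral>\<^sup>+y. indicator B y * indicator A y \<partial>M)"
proof -
  have "(\<integral>\<^sup>+y. indicator B y * indicator A y \<partial>M) = (\<integral>\<^sup>+y. indicator (A \<inter> B) y \<partial>M)"
    by (intro nn_integral_cong) (simp add: indicator_inter_arith mult.commute)
  then show ?thesis using assms by simp
qed

text \<open>The parameters of graph points in a ball stay in a fixed ball, where the density is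
  bounded by compactness.\<close>

lemma (in C1_graph) hausdorff_graph_ball_finite:
  "emeasure (hausdorff_measure (CARD('n) - 1)) (graph \<inter> ball x r) < \<infinity>"
proof -
  let ?H = "hausdorff_measure (CARD('n) - 1) :: (real ^ 'n) measure"
  define C where "C = norm (x - b) + r"
  have [measurable]: "ball x r \<in> sets borel" by simp
  have nz: "norm (zero_coord k z) \<le> norm z" for z :: "real ^ 'n"
    by (rule norm_le_componentwise_cart) (simp add: zero_coord_def)
  have "continuous_on (cball 0 C) (\<lambda>u. norm (conormal u))" by (intro continuous_on_norm continuous_conormal)
  then have "bounded ((\<lambda>u. norm (conormal u)) ` cball 0 C)"
    by (intro compact_imp_bounded compact_continuous_image compact_cball)
  then obtain B where "\<forall>v\<in>(\<lambda>u. norm (conormal u)) ` cball 0 C. norm v \<le> B"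
    unfolding bounded_iff by blast
  then have B: "norm (conormal u) \<le> B" if "u \<in> cball 0 C" for u using that by force
  have inC: "zero_coord k u \<in> cball 0 C" if "param u \<in> ball x r" for u
  proof -
    have "norm (zero_coord k u) = norm (unparam (param u))" by simp
    also have "\<dots> \<le> norm (inv R (param u - b))" unfolding unparam_def by (rule nz)
    also have "\<dots> = norm (param u - b)" using R_norm[of "inv R (param u - b)"] by (simp add: inv_R)
    also have "\<dots> \<le> norm (x - b) + norm (param u - x)" using norm_triangle_ineq[of "x - b" "param u - x"] by simp
    also have "\<dots> \<le> C" using that by (simp add: C_def dist_norm norm_minus_commute)
    finally show ?thesis by simp
  qed
  have "emeasure ?H (graph \<inter> ball x r) = (\<integral>\<^sup>+y. indicator (ball x r) y * indicator graph y \<partial>?H)"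
    by (rule emeasure_Int_nn_integral) auto
  also have "\<dots> = hausdorff_factor k * (\<integral>\<^sup>+u. indicator (ball x r) (param u) * ennreal (norm (conormal u)) \<partial>hyperplane_measure k)"
    by (rule nn_integral_graph) measurable
  also have "\<dots> \<le> hausdorff_factor k * (\<integral>\<^sup>+u. ennreal B * indicator (cball 0 C) u \<partial>hyperplane_measure k)"
  proof (intro mult_left_mono nn_integral_mono_AE eventually_mono[OF AE_hyperplane_measure])
    fix u :: "real ^ 'n" assume "u $ k = 0"
    then show "indicator (ball x r) (param u) * ennreal (norm (conormal u)) \<le> ennreal B * indicator (cball 0 C) u"
      using inC[of u] B[of u] by (auto simp: indicator_def zero_coord_id intro!: ennreal_leI)
  qed simp
  also have "\<dots> = hausdorff_factor k * (ennreal B * emeasure (hyperplane_measure k) (cball 0 C))"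
    by (subst nn_integral_cmult_indicator) auto
  also have "\<dots> < \<infinity>"
  proof -
    show ?thesis
      using emeasure_hyperplane_measure_cball_finite[of k C]
        hausdorff_hyperplane_cube_finite[of k] by (simp add: hausdorff_factor_def ennreal_mult_less_top)
  qed
  finally show ?thesis .
qed

text \<open>Finitely many charts cover the compact boundary. Finiteness gives access to Tonelli's
  theorem and allows the total to be cancelled in the equality case.\<close>

lemma hausdorff_frontier_finite:
  fixes \<Omega> :: "(real ^ 'n::finite) set"
  assumes \<Omega>: "open \<Omega>" "bounded \<Omega>" "C1_boundary \<Omega>"
  shows "emeasure (hausdorff_measure (CARD('n) - 1)) (frontier \<Omega>) < \<infinity>"
proof -
  let ?H = "hausdorff_measure (CARD('n) - 1) :: (real ^ 'n) measure"
  have "\<exists>r>0. emeasure ?H (frontier \<Omega> \<inter> ball x r) < \<infinity>" if x: "x \<in> frontier \<Omega>" for x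
  proof -
    obtain r k R b g G where r: "r > 0" and C: "C1_chart k R b g G \<Omega> x r"
      using C1_boundary_chart[OF \<Omega>(1,3) x] by blast
    interpret C1_chart k R b g G \<Omega> x r by (rule C)
    have "frontier \<Omega> \<inter> ball x r = graph \<inter> ball x r" using frontier_chart by blast
    then show ?thesis using hausdorff_graph_ball_finite[of x r] r by auto
  qed
  then obtain r where r: "\<And>x. x \<in> frontier \<Omega> \<Longrightarrow> r x > 0 \<and> emeasure ?H (frontier \<Omega> \<inter> ball x (r x)) < \<infinity>"
    by metis
  have "compact (frontier \<Omega>)" using \<Omega>(2) by (simp add: compact_frontier_bounded)
  moreover have "frontier \<Omega> \<subseteq> (\<Union>x\<in>frontier \<Omega>. ball x (r x))" using r by force
  ultimately obtain F where F: "F \<subseteq> frontier \<Omega>" "finite F" "frontier \<Omega> \<subseteq> (\<Union>x\<in>F. ball x (r x))"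
    using compactE_image[of "frontier \<Omega>" "frontier \<Omega>" "\<lambda>x. ball x (r x)"] by (metis open_ball)
  have fb: "frontier \<Omega> \<inter> ball x \<rho> \<in> sets ?H" for x \<rho> by (simp add: borel_closed)
  have "emeasure ?H (frontier \<Omega>) \<le> emeasure ?H (\<Union>x\<in>F. frontier \<Omega> \<inter> ball x (r x))"
  proof (rule emeasure_mono)
    show "(\<Union>x\<in>F. frontier \<Omega> \<inter> ball x (r x)) \<in> sets ?H" by (rule sets.finite_UN[OF F(2) fb])
  qed (use F(3) in blast)
  also have "\<dots> \<le> (\<Sum>x\<in>F. emeasure ?H (frontier \<Omega> \<inter> ball x (r x)))"
    by (intro emeasure_subadditive_finite F(2)) (use fb in blast)
  also have "\<dots> < \<infinity>"
    using F r by (auto simp: less_top[symmetric] ennreal_sum_less_top subset_iff)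
  finally show ?thesis .
qed

lemma emeasure_lborel_open_pos:
  fixes S :: "'a::euclidean_space set"
  assumes "open S" "S \<noteq> {}"
  shows "0 < emeasure lborel S"
proof (rule ccontr)
  assume "\<not> 0 < emeasure lborel S"
  then have "S \<in> null_sets lborel" using assms(1) by (intro null_setsI) auto
  then have "negligible S" by (simp add: negligible_iff_null_sets null_sets_completionI)
  then show False using open_not_negligible assms by blast
qed

text \<open>The parameters of a boundary patch form a nonempty open subset of the hyperplane, and
  the density is at least 1. In the equality case this excludes strict pointwise inequality on a
  patch.\<close>

lemma hausdorff_frontier_ball_pos:
  fixes \<Omega> :: "(real ^ 'n::finite) set"
  assumes \<Omega>: "open \<Omega>" "C1_boundary \<Omega>" and x: "x \<in> frontier \<Omega>" and \<rho>: "\<rho> > 0"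
  shows "0 < emeasure (hausdorff_measure (CARD('n) - 1)) (frontier \<Omega> \<inter> ball x \<rho>)"
proof -
  let ?H = "hausdorff_measure (CARD('n) - 1) :: (real ^ 'n) measure"
  obtain r k R b g G where r: "r > 0" and C: "C1_chart k R b g G \<Omega> x r"
    using C1_boundary_chart[OF \<Omega> x] by blast
  interpret C1_chart k R b g G \<Omega> x r by (rule C)
  define s where "s = min r \<rho>"
  have s: "s > 0" "s \<le> r" "s \<le> \<rho>" using r \<rho> by (auto simp: s_def)
  have [measurable]: "ball x s \<in> sets borel" by simp
  \<comment> \<open>Slab of unit thickness over the parameter set: it is open in the full space, and
    its volume is the hyperplane measure of that set.\<close>
  define O' where "O' = {z. param z \<in> ball x s \<and> 0 < z $ k \<and> z $ k < 1}"
  have "open O'"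
  proof -
    have "O' = param -` ball x s \<inter> {z. 0 < z $ k} \<inter> {z. z $ k < 1}" by (auto simp: O'_def)
    moreover have "open (param -` ball x s)" using continuous_param[of UNIV] by (simp add: continuous_on_open_vimage open_vimage)
    moreover have "open {z :: real ^ 'n. 0 < z $ k}" "open {z :: real ^ 'n. z $ k < 1}"
      by (intro open_Collect_less continuous_intros)+
    ultimately show ?thesis by (simp add: open_Int)
  qed
  moreover have "unparam x + (1 / 2) *\<^sub>R axis k 1 \<in> O'"
  proof -
    have "x \<in> graph" using frontier_chart[of x] x r by simp
    then show ?thesis using s by (simp add: O'_def mem_graph_iff) (simp add: unparam_def)
  qed
  ultimately have "0 < emeasure lborel O'" by (intro emeasure_lborel_open_pos) auto
  also have "emeasure lborel O' = (\<integral>\<^sup>+u. indicator (ball x s) (param u) \<partial>hyperplane_measure k)"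
  proof -
    have "(\<integral>\<^sup>+u. indicator (ball x s) (param u) \<partial>hyperplane_measure k)
      = (\<integral>\<^sup>+z. indicator (ball x s) (param (zero_coord k z)) * indicator {z. 0 < z $ k \<and> z $ k < 1} z \<partial>lborel)"
      by (rule nn_integral_hyperplane_measure) measurable
    also have "\<dots> = (\<integral>\<^sup>+z. indicator O' z \<partial>lborel)"
      by (intro nn_integral_cong) (auto simp: O'_def indicator_def)
    finally show ?thesis using \<open>open O'\<close> by simp
  qed
  also have "\<dots> \<le> (\<integral>\<^sup>+u. indicator (ball x s) (param u) * ennreal (norm (conormal u)) \<partial>hyperplane_measure k)"
    by (intro nn_integral_mono) (auto simp: indicator_def norm_conormal_ge_1)
  finally have "0 < hausdorff_factor k * (\<integral>\<^sup>+u. indicator (ball x s) (param u) * ennreal (norm (conormal u)) \<partial>hyperplane_measure k)"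
    using hausdorff_hyperplane_cube_pos[of k] by (simp add: ennreal_zero_less_mult_iff hausdorff_factor_def)
  also have "\<dots> = (\<integral>\<^sup>+y. indicator (ball x s) y * indicator graph y \<partial>?H)"
    by (rule nn_integral_graph[symmetric]) measurable
  also have "\<dots> = emeasure ?H (graph \<inter> ball x s)"
    by (rule emeasure_Int_nn_integral[symmetric]) auto
  also have "\<dots> \<le> emeasure ?H (frontier \<Omega> \<inter> ball x \<rho>)"
  proof (rule emeasure_mono)
    show "graph \<inter> ball x s \<subseteq> frontier \<Omega> \<inter> ball x \<rho>" using frontier_chart s by auto
  qed (auto intro!: borel_closed sets.Int)
  finally show ?thesis .
qed

section \<open>Cones over the boundary\<close>

lemma
  fixes \<Omega> :: "(real ^ 'n::finite) set"
  assumes C: "C1_chart k R b g G \<Omega> x0 r"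
    and A: "A \<in> sets borel" "A \<subseteq> frontier \<Omega> \<inter> ball x0 r"
  shows chart_sets_weighted_cone: "weighted_cone x \<nu> A \<in> sets lebesgue"
    and chart_weighted_cone_le: "cone_energy (j :: 'n) x \<nu> A
      \<le> kernel_integral x \<nu> (outward_unit_normal \<Omega>) A"
    and chart_weighted_cone_eq: "(\<And>y y' s. y \<in> A \<Longrightarrow> y' \<in> A \<Longrightarrow> s > 0 \<Longrightarrow> \<nu> \<bullet> (y - x) \<noteq> 0 \<Longrightarrow> y' - x = s *\<^sub>R (y - x) \<Longrightarrow> y = y') \<Longrightarrow>
      cone_energy j x \<nu> A
      = kernel_integral x \<nu> (outward_unit_normal \<Omega>) A"
proof -
  interpret C1_chart k R b g G \<Omega> x0 r by (rule C)
  have Ag: "A \<subseteq> graph" using A(2) frontier_chart by blast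
  have int: "kernel_integral x \<nu> (outward_unit_normal \<Omega>) A
      = kernel_integral x \<nu> unit_normal A"
  proof (intro nn_integral_cong)
    fix y
    show "ennreal (energy_kernel x \<nu> y (outward_unit_normal \<Omega> y)) * indicator A y
      = ennreal (energy_kernel x \<nu> y (unit_normal y)) * indicator A y"
    proof (cases "y \<in> A")
      case True
      then have "y \<in> ball x0 r" "y \<in> frontier \<Omega>" using A(2) by auto
      then show ?thesis by (simp only: outward_unit_normal_eq)
    qed simp
  qed
  show "weighted_cone x \<nu> A \<in> sets lebesgue" by (rule sets_weighted_cone[OF A(1) Ag])
  show "cone_energy j x \<nu> A
      \<le> kernel_integral x \<nu> (outward_unit_normal \<Omega>) A"
    unfolding int by (rule weighted_cone_le[OF A(1) Ag])
  show "cone_energy j x \<nu> A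
      = kernel_integral x \<nu> (outward_unit_normal \<Omega>) A"
    if inj: "\<And>y y' s. y \<in> A \<Longrightarrow> y' \<in> A \<Longrightarrow> s > 0 \<Longrightarrow> \<nu> \<bullet> (y - x) \<noteq> 0 \<Longrightarrow> y' - x = s *\<^sub>R (y - x) \<Longrightarrow> y = y'"
    unfolding int by (rule weighted_cone_eq[OF A(1) Ag inj])
qed

text \<open>Disjoint Borel pieces inside single charts allow the chart formulas to be summed over
  the boundary.\<close>

lemma frontier_chart_partition:
  fixes \<Omega> :: "(real ^ 'n::finite) set"
  assumes \<Omega>: "open \<Omega>" "C1_boundary \<Omega>" and ne: "frontier \<Omega> \<noteq> {}"
  shows "\<exists>A :: nat \<Rightarrow> (real ^ 'n) set. (\<forall>i. A i \<in> sets borel) \<and> disjoint_family A \<and> (\<Union>i. A i) = frontier \<Omega> \<and>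
    (\<forall>i. \<exists>k R b g G x r. C1_chart k R b g G \<Omega> x r \<and> A i \<subseteq> frontier \<Omega> \<inter> ball x r)"
proof -
  define F where "F = {ball x r | x r. \<exists>k R b g G. C1_chart k R b g G \<Omega> x r}"
  have cover: "frontier \<Omega> \<subseteq> \<Union> F"
  proof
    fix x assume "x \<in> frontier \<Omega>"
    from C1_boundary_chart[OF \<Omega> this] obtain r where r: "r > 0" "\<exists>k R b g G. C1_chart k R b g G \<Omega> x r" by blast
    then have "ball x r \<in> F" unfolding F_def by blast
    moreover have "x \<in> ball x r" using r by simp
    ultimately show "x \<in> \<Union> F" by blast
  qed
  have "\<And>S. S \<in> F \<Longrightarrow> open S" by (auto simp: F_def)
  then obtain F' where F': "F' \<subseteq> F" "countable F'" "\<Union> F' = \<Union> F" using Lindelof[of F] by blast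
  have ne': "F' \<noteq> {}" using cover ne F'(3) by auto
  define B where "B = from_nat_into F'"
  have BF: "B i \<in> F" for i unfolding B_def by (rule subsetD[OF F'(1) from_nat_into[OF ne']])
  have UB: "(\<Union>i. B i) = \<Union> F'" unfolding B_def using range_from_nat_into[OF ne' F'(2)] by simp
  define A where "A i = frontier \<Omega> \<inter> disjointed B i" for i
  show ?thesis
  proof (intro exI[of _ A] conjI allI)
    have Bb: "range B \<subseteq> sets borel" using BF \<open>\<And>S. S \<in> F \<Longrightarrow> open S\<close> by auto
    then have "range (disjointed B) \<subseteq> sets borel" by (rule sets.range_disjointed_sets)
    then have "disjointed B i \<in> sets borel" for i by blast
    then show "A i \<in> sets borel" for i
      unfolding A_def by (rule sets.Int[rotated]) (simp add: borel_closed)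
    show "disjoint_family A"
      using disjoint_family_disjointed[of B] unfolding A_def disjoint_family_on_def by blast
    have "(\<Union>i. A i) = frontier \<Omega> \<inter> (\<Union>i. B i)" unfolding A_def UN_disjointed_eq[of B, symmetric] by blast
    moreover have "frontier \<Omega> \<subseteq> (\<Union>i. B i)" unfolding UB F'(3) by (rule cover)
    ultimately show "(\<Union>i. A i) = frontier \<Omega>" by (simp only: Int_absorb2)
    show "\<exists>k R b g G x r. C1_chart k R b g G \<Omega> x r \<and> A i \<subseteq> frontier \<Omega> \<inter> ball x r" for i
    proof -
      have "\<exists>x r. B i = ball x r \<and> (\<exists>k R b g G. C1_chart k R b g G \<Omega> x r)" using BF[of i] unfolding F_def by simp
      then obtain x r k R b g G where C: "C1_chart k R b g G \<Omega> x r" and Bi: "B i = ball x r" by blast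
      have "A i \<subseteq> frontier \<Omega> \<inter> ball x r" using disjointed_subset[of B i] Bi by (auto simp: A_def)
      then show ?thesis using C by blast
    qed
  qed
qed

lemma measurable_outward_unit_normal:
  fixes \<Omega> :: "(real ^ 'n::finite) set"
  assumes \<Omega>: "open \<Omega>" "C1_boundary \<Omega>"
  shows "outward_unit_normal \<Omega> \<in> borel_measurable (restrict_space borel (frontier \<Omega>))"
  by (intro borel_measurable_continuous_on_restrict continuous_on_outward_unit_normal assms)

text \<open>The normal is controlled on the boundary only, so measurability is shown on the
  restricted space and extended by the indicator.\<close>

lemma measurable_kernel_indicator:
  fixes \<Omega> :: "(real ^ 'n::finite) set"
  assumes \<Omega>: "open \<Omega>" "C1_boundary \<Omega>" and B: "B \<in> sets borel" "B \<subseteq> frontier \<Omega>"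
  shows "(\<lambda>y. ennreal (energy_kernel x \<nu> y (outward_unit_normal \<Omega> y)) * indicator B y) \<in> borel_measurable borel"
proof -
  have "(\<lambda>y. ennreal (energy_kernel x \<nu> y (outward_unit_normal \<Omega> y))) \<in> borel_measurable (restrict_space borel (frontier \<Omega>))"
  proof -
    note measurable_outward_unit_normal[OF \<Omega>, measurable]
    have [measurable]: "(\<lambda>y. y) \<in> borel_measurable (restrict_space borel (frontier \<Omega>))"
      by (rule measurable_restrict_space1) simp
    show ?thesis unfolding energy_kernel_def by measurable
  qed
  then have "(\<lambda>y. ennreal (energy_kernel x \<nu> y (outward_unit_normal \<Omega> y)) * indicator (frontier \<Omega>) y) \<in> borel_measurable borel"
    by (rule borel_measurable_restrict_space_iff_ennreal[THEN iffD1, rotated]) (simp add: borel_closed)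
  then have "(\<lambda>y. ennreal (energy_kernel x \<nu> y (outward_unit_normal \<Omega> y)) * indicator (frontier \<Omega>) y * indicator B y) \<in> borel_measurable borel"
    using B(1) by measurable
  moreover have "ennreal (energy_kernel x \<nu> y (outward_unit_normal \<Omega> y)) * indicator (frontier \<Omega>) y * indicator B y
     = ennreal (energy_kernel x \<nu> y (outward_unit_normal \<Omega> y)) * indicator B y" for y
    using B(2) by (auto simp: indicator_def)
  ultimately show ?thesis by simp
qed

lemma weighted_cone_UN: "weighted_cone x \<nu> (\<Union>i. A i) = (\<Union>i. weighted_cone x \<nu> (A i))"
  unfolding weighted_cone_def by blast

text \<open>The chart formulas are summed over the pieces. Subadditivity gives the inequality;
  equality needs disjoint cones over different pieces, which the condition on rays provides.\<close>

lemma
  fixes \<Omega> :: "(real ^ 'n::finite) set"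
  assumes \<Omega>: "open \<Omega>" "C1_boundary \<Omega>" and ne: "frontier \<Omega> \<noteq> {}"
    and B: "B \<in> sets borel" "B \<subseteq> frontier \<Omega>"
  shows frontier_sets_weighted_cone: "weighted_cone x \<nu> B \<in> sets lebesgue"
    and frontier_weighted_cone_le: "cone_energy (j :: 'n) x \<nu> B
      \<le> kernel_integral x \<nu> (outward_unit_normal \<Omega>) B"
    and frontier_weighted_cone_eq: "(\<And>y y' s. y \<in> B \<Longrightarrow> y' \<in> B \<Longrightarrow> s > 0 \<Longrightarrow> \<nu> \<bullet> (y - x) \<noteq> 0 \<Longrightarrow> y' - x = s *\<^sub>R (y - x) \<Longrightarrow> y = y') \<Longrightarrow>
      cone_energy j x \<nu> B
      = kernel_integral x \<nu> (outward_unit_normal \<Omega>) B"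
proof -
  let ?H = "hausdorff_measure (CARD('n) - 1) :: (real ^ 'n) measure"
  let ?k = "\<lambda>y. ennreal (energy_kernel x \<nu> y (outward_unit_normal \<Omega> y))"
  obtain A :: "nat \<Rightarrow> (real ^ 'n) set" where A': "\<forall>i. A i \<in> sets borel" "disjoint_family A" "(\<Union>i. A i) = frontier \<Omega>"
    "\<forall>i. \<exists>k R b g G x r. C1_chart k R b g G \<Omega> x r \<and> A i \<subseteq> frontier \<Omega> \<inter> ball x r"
    using frontier_chart_partition[OF \<Omega> ne] by (elim exE conjE)
  note A = A'(1)[rule_format] A'(2,3) A'(4)[rule_format]
  define D where "D i = B \<inter> A i" for i
  have D: "D i \<in> sets borel" for i using A(1) B(1) by (simp add: D_def)
  have UD: "(\<Union>i. D i) = B" using A(3) B(2) by (auto simp: D_def)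
  have disD: "disjoint_family D" using A(2) by (auto simp: D_def disjoint_family_on_def)
  have ch: "\<exists>k R b g G x r. C1_chart k R b g G \<Omega> x r \<and> D i \<subseteq> frontier \<Omega> \<inter> ball x r" for i
    using A(4)[of i] B(2) unfolding D_def by blast
  have wcD: "weighted_cone x \<nu> (D i) \<in> sets lebesgue" for i
  proof -
    obtain k R b g G x0 r where C: "C1_chart k R b g G \<Omega> x0 r" "D i \<subseteq> frontier \<Omega> \<inter> ball x0 r" using ch[of i] by blast
    show ?thesis by (rule chart_sets_weighted_cone[OF C(1) D C(2)])
  qed
  have wc: "weighted_cone x \<nu> B = (\<Union>i. weighted_cone x \<nu> (D i))"
    unfolding UD[symmetric] by (rule weighted_cone_UN)
  show "weighted_cone x \<nu> B \<in> sets lebesgue"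
    unfolding wc using wcD by (intro sets.countable_UN) auto
  have le: "cone_energy j x \<nu> (D i) \<le> kernel_integral x \<nu> (outward_unit_normal \<Omega>) (D i)" for i
  proof -
    obtain k R b g G x0 r where C: "C1_chart k R b g G \<Omega> x0 r" "D i \<subseteq> frontier \<Omega> \<inter> ball x0 r" using ch[of i] by blast
    show ?thesis by (rule chart_weighted_cone_le[OF C(1) D C(2)])
  qed
  have int: "kernel_integral x \<nu> (outward_unit_normal \<Omega>) B = (\<Sum>i. \<integral>\<^sup>+y. ?k y * indicator (D i) y \<partial>?H)"
  proof -
    have m: "(\<lambda>y. ?k y * indicator (D i) y) \<in> borel_measurable ?H" for i
      using measurable_kernel_indicator[OF \<Omega> D[of i], of x \<nu>] B(2) by (simp add: D_def le_infI1)
    have "?k y * indicator B y = (\<Sum>i. ?k y * indicator (D i) y)" for y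
      using suminf_indicator[OF disD, of y] unfolding UD by simp
    then show ?thesis using nn_integral_suminf[OF m] by simp
  qed
  have "emeasure lebesgue (weighted_cone x \<nu> B) \<le> (\<Sum>i. emeasure lebesgue (weighted_cone x \<nu> (D i)))"
    unfolding wc using wcD by (intro emeasure_subadditive_countably) auto
  then have "cone_energy j x \<nu> B
     \<le> hausdorff_factor j * (of_nat CARD('n) * (\<Sum>i. emeasure lebesgue (weighted_cone x \<nu> (D i))))"
    by (intro mult_left_mono) auto
  also have "\<dots> = (\<Sum>i. cone_energy j x \<nu> (D i))" by simp
  also have "\<dots> \<le> (\<Sum>i. \<integral>\<^sup>+y. ?k y * indicator (D i) y \<partial>?H)" by (intro suminf_le allI le) auto
  finally show "cone_energy j x \<nu> B \<le> kernel_integral x \<nu> (outward_unit_normal \<Omega>) B"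
    unfolding int .
  show "cone_energy j x \<nu> B = kernel_integral x \<nu> (outward_unit_normal \<Omega>) B"
    if inj: "\<And>y y' s. y \<in> B \<Longrightarrow> y' \<in> B \<Longrightarrow> s > 0 \<Longrightarrow> \<nu> \<bullet> (y - x) \<noteq> 0 \<Longrightarrow> y' - x = s *\<^sub>R (y - x) \<Longrightarrow> y = y'"
  proof -
    have DB: "D i \<subseteq> B" for i by (auto simp: D_def)
    have eq: "cone_energy j x \<nu> (D i) = kernel_integral x \<nu> (outward_unit_normal \<Omega>) (D i)" for i
    proof -
      obtain k R b g G x0 r where C: "C1_chart k R b g G \<Omega> x0 r" "D i \<subseteq> frontier \<Omega> \<inter> ball x0 r" using ch[of i] by blast
      show ?thesis
      proof (rule chart_weighted_cone_eq[OF C(1) D C(2)])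
        fix y y' s assume "y \<in> D i" "y' \<in> D i" "s > 0" "\<nu> \<bullet> (y - x) \<noteq> 0" "y' - x = s *\<^sub>R (y - x)"
        then show "y = y'" using DB[of i] by (intro inj[of y y' s]) auto
      qed
    qed
    have disj: "disjoint_family (\<lambda>i. weighted_cone x \<nu> (D i))"
      unfolding disjoint_family_on_def
    proof (intro ballI impI)
      fix i j :: nat assume "i \<noteq> j"
      show "weighted_cone x \<nu> (D i) \<inter> weighted_cone x \<nu> (D j) = {}"
      proof (rule ccontr)
        assume "weighted_cone x \<nu> (D i) \<inter> weighted_cone x \<nu> (D j) \<noteq> {}"
        then obtain z where z: "z \<in> weighted_cone x \<nu> (D i)" "z \<in> weighted_cone x \<nu> (D j)" by blast
        obtain y s where y: "y \<in> D i" "s > 0" "z = s *\<^sub>R (y - x)" using z(1) unfolding weighted_cone_def by blast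
        obtain y' s' where y': "y' \<in> D j" "s' > 0" "z = s' *\<^sub>R (y' - x)" using z(2) unfolding weighted_cone_def by blast
        have "norm z ^ (CARD('n) + 1) < \<bar>\<nu> \<bullet> z\<bar>" using z(1) unfolding weighted_cone_def by blast
        then have "\<nu> \<bullet> z \<noteq> 0" using zero_le_power[OF norm_ge_zero, of z "CARD('n) + 1"] by linarith
        then have "\<nu> \<bullet> (y - x) \<noteq> 0" unfolding y(3) by simp
        moreover have "y' - x = (s / s') *\<^sub>R (y - x)"
        proof -
          have "y' - x = (1 / s') *\<^sub>R z" using y'(2) by (simp add: y'(3))
          then show ?thesis by (simp add: y(3))
        qed
        ultimately have "y = y'" using y y' DB by (intro inj[of y y' "s / s'"]) auto
        then have "y \<in> D i \<inter> D j" using y y' by simp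
        then show False using disD \<open>i \<noteq> j\<close> by (auto simp: disjoint_family_on_def)
      qed
    qed
    have "emeasure lebesgue (weighted_cone x \<nu> B) = (\<Sum>i. emeasure lebesgue (weighted_cone x \<nu> (D i)))"
      unfolding wc using wcD disj by (intro suminf_emeasure[symmetric]) auto
    then have "cone_energy j x \<nu> B
       = (\<Sum>i. cone_energy j x \<nu> (D i))" by simp
    then show ?thesis unfolding int eq .
  qed
qed

section \<open>The cone of inward directions\<close>

definition inner_cone :: "real ^ 'n \<Rightarrow> (real ^ 'n) set" where
  "inner_cone \<nu> = {z. norm z ^ (CARD('n) + 1) < - (\<nu> \<bullet> z)}"

lemma open_inner_cone: "open (inner_cone \<nu>)"
  unfolding inner_cone_def by (intro open_Collect_less continuous_intros)

text \<open>A rotation carries one normal to the other. Hence the constant of the theorem depends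
  neither on the boundary point nor on the domain.\<close>

lemma emeasure_inner_cone_eq:
  fixes \<nu> \<mu> :: "real ^ 'n::finite"
  assumes "norm \<nu> = 1" "norm \<mu> = 1"
  shows "emeasure lborel (inner_cone \<nu>) = emeasure lborel (inner_cone \<mu>)"
proof -
  have "\<exists>R. orthogonal_transformation R \<and> R \<mu> = \<nu>"
    by (rule orthogonal_transformation_exists[of \<mu> \<nu>]) (use assms in auto)
  then obtain R :: "real ^ 'n \<Rightarrow> real ^ 'n" where R: "orthogonal_transformation R" "R \<mu> = \<nu>" by blast
  have eq: "R z \<in> inner_cone \<nu> \<longleftrightarrow> z \<in> inner_cone \<mu>" for z
    using R orthogonal_transformation_norm[OF R(1), of z]
    by (simp add: inner_cone_def orthogonal_transformation_def flip: R(2))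
  have im: "R ` inner_cone \<mu> = inner_cone \<nu>"
  proof (intro subset_antisym subsetI)
    fix w assume w: "w \<in> inner_cone \<nu>"
    obtain z where "w = R z" using orthogonal_transformation_surj[OF R(1)] by (rule surjE)
    then show "w \<in> R ` inner_cone \<mu>" using w eq by blast
  qed (use eq in blast)
  have b: "inner_cone \<mu> \<in> sets borel" "inner_cone \<nu> \<in> sets borel" using open_inner_cone by (auto intro: borel_open)
  have "emeasure lebesgue (R ` inner_cone \<mu>) = ennreal \<bar>det (matrix R)\<bar> * emeasure lborel (inner_cone \<mu>)"
    by (rule emeasure_lborel_linear_image[OF orthogonal_transformation_linear[OF R(1)] orthogonal_transformation_inj[OF R(1)] b(1)])
  then show ?thesis using R(1) b by (simp add: im)
qed

lemma
  fixes \<nu> :: "real ^ 'n::finite"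
  assumes \<nu>: "norm \<nu> = 1"
  shows emeasure_inner_cone_pos: "0 < emeasure lborel (inner_cone \<nu>)"
    and emeasure_inner_cone_finite: "emeasure lborel (inner_cone \<nu>) < \<infinity>"
proof -
  have n: "CARD('n) > 0" by simp
  \<comment> \<open>The factor 1/2 works in every dimension n of at least 1, since (1/2)^(n+1) <
    1/2.\<close>
  have "- (1 / 2) *\<^sub>R \<nu> \<in> inner_cone \<nu>"
  proof -
    have "(1 / 2 :: real) ^ CARD('n) < 1" using power_strict_decreasing[of 0 "CARD('n)" "1 / 2 :: real"] by simp
    then have "(1 / 2 :: real) ^ (CARD('n) + 1) < 1 / 2" by simp
    then show ?thesis using \<nu> by (simp add: inner_cone_def dot_square_norm power_one_over)
  qed
  then show "0 < emeasure lborel (inner_cone \<nu>)" by (intro emeasure_lborel_open_pos open_inner_cone) auto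
  have "inner_cone \<nu> \<subseteq> ball 0 1"
  proof
    fix z assume "z \<in> inner_cone \<nu>"
    then have z: "norm z ^ (CARD('n) + 1) < - (\<nu> \<bullet> z)" by (simp add: inner_cone_def)
    also have "\<dots> \<le> norm z" using Cauchy_Schwarz_ineq2[of \<nu> z] \<nu> by simp
    finally have "norm z * norm z ^ CARD('n) < norm z * 1" by simp
    then have "norm z ^ CARD('n) < 1" by (rule mult_left_less_imp_less) simp
    then have "norm z < 1" using one_le_power[of "norm z" "CARD('n)"] by linarith
    then show "z \<in> ball 0 1" by simp
  qed
  then have "emeasure lborel (inner_cone \<nu>) \<le> emeasure lborel (ball 0 1 :: (real ^ 'n) set)"
    by (rule emeasure_mono) simp
  also have "\<dots> < \<infinity>" by (rule emeasure_bounded_finite) simp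
  finally show "emeasure lborel (inner_cone \<nu>) < \<infinity>" .
qed

text \<open>\<open>a\<close> and \<open>b\<close> come in either order, so the lemma covers a ray
  that leaves the domain as well as one that enters it.\<close>

lemma ray_in_weighted_cone:
  fixes \<Omega> :: "(real ^ 'n::finite) set"
  assumes a: "a > 0" "x + a *\<^sub>R z \<in> \<Omega>" and b: "b > 0" "x + b *\<^sub>R z \<notin> \<Omega>"
    and z: "norm z ^ (CARD('n) + 1) < \<bar>\<nu> \<bullet> z\<bar>"
  shows "z \<in> weighted_cone x \<nu> (frontier \<Omega>)"
proof -
  have "closed_segment (x + a *\<^sub>R z) (x + b *\<^sub>R z) \<inter> frontier \<Omega> \<noteq> {}"
    using a b by (intro connected_Int_frontier connected_segment) auto
  then obtain y where y: "y \<in> closed_segment (x + a *\<^sub>R z) (x + b *\<^sub>R z)" "y \<in> frontier \<Omega>" by blast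
  then obtain t where t: "0 \<le> t" "t \<le> 1" "y = (1 - t) *\<^sub>R (x + a *\<^sub>R z) + t *\<^sub>R (x + b *\<^sub>R z)"
    unfolding in_segment by blast
  define s where "s = (1 - t) * a + t * b"
  have "s > 0"
  proof (cases "t = 0")
    case False
    then have "0 < t * b" "0 \<le> (1 - t) * a" using t a b by auto
    then show ?thesis by (simp add: s_def)
  qed (use a in \<open>simp add: s_def\<close>)
  moreover have "y - x = s *\<^sub>R z" unfolding t(3) s_def by (simp add: algebra_simps)
  ultimately have "z = (1 / s) *\<^sub>R (y - x)" "1 / s > 0" by simp_all
  then show ?thesis using y(2) z unfolding weighted_cone_def by blast
qed

lemma inner_cone_subset_weighted_cone:
  fixes \<Omega> :: "(real ^ 'n::finite) set"
  assumes \<Omega>: "open \<Omega>" "bounded \<Omega>" "C1_boundary \<Omega>" and x: "x \<in> frontier \<Omega>"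
  shows "inner_cone (outward_unit_normal \<Omega> x) \<subseteq> weighted_cone x (outward_unit_normal \<Omega> x) (frontier \<Omega>)"
proof
  let ?\<nu> = "outward_unit_normal \<Omega> x"
  fix z assume "z \<in> inner_cone ?\<nu>"
  then have z: "norm z ^ (CARD('n) + 1) < - (?\<nu> \<bullet> z)" by (simp add: inner_cone_def)
  have "0 \<le> norm z ^ (CARD('n) + 1)" by simp
  with z have neg: "z \<bullet> ?\<nu> < 0" by (simp only: inner_commute)
  then have "z \<noteq> 0" by auto
  have "eventually (\<lambda>t. x + t *\<^sub>R z \<in> \<Omega> \<and> t \<in> {0<..<1}) (at_right 0)"
    by (intro eventually_conj eventually_inside_domain[OF \<Omega>(1,3) x neg] eventually_at_right_real) simp
  then obtain a where a: "x + a *\<^sub>R z \<in> \<Omega>" "a > 0"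
    using eventually_happens'[OF trivial_limit_at_right_real] by fastforce
  obtain B where B: "\<And>y. y \<in> \<Omega> \<Longrightarrow> norm y \<le> B" using \<Omega>(2) unfolding bounded_iff by blast
  \<comment> \<open>So far out that \<open>x + b *\<^sub>R z\<close> lies beyond the bound
    \<open>B\<close> even after the triangle inequality subtracts \<open>norm x\<close>.\<close>
  define b where "b = (\<bar>B\<bar> + norm x + 1) / norm z"
  have "b > 0" unfolding b_def using \<open>z \<noteq> 0\<close> by (intro divide_pos_pos) (simp_all add: add_nonneg_pos)
  have "norm (b *\<^sub>R z) = \<bar>B\<bar> + norm x + 1" using \<open>z \<noteq> 0\<close> \<open>b > 0\<close> by (simp add: b_def)
  then have "norm (x + b *\<^sub>R z) > B" using norm_triangle_ineq2[of "b *\<^sub>R z" "- x"] by (simp add: add.commute)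
  then have "x + b *\<^sub>R z \<notin> \<Omega>" using B by force
  then show "z \<in> weighted_cone x ?\<nu> (frontier \<Omega>)"
    using z neg by (intro ray_in_weighted_cone[OF a(2,1) \<open>b > 0\<close>]) (simp_all add: inner_commute)
qed

text \<open>
  A direction that leaves \<open>\<Omega>\<close> at \<open>x\<close> but later enters it again contributes volume outside the
  cone of inward directions.
\<close>

lemma weighted_cone_gt:
  fixes \<Omega> :: "(real ^ 'n::finite) set"
  assumes \<Omega>: "open \<Omega>" "bounded \<Omega>" "C1_boundary \<Omega>" and x: "x \<in> frontier \<Omega>"
    and y: "y \<in> \<Omega>" "(y - x) \<bullet> outward_unit_normal \<Omega> x > 0"
  shows "emeasure lborel (inner_cone (outward_unit_normal \<Omega> x))
     < emeasure lebesgue (weighted_cone x (outward_unit_normal \<Omega> x) (frontier \<Omega>))"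
proof -
  define \<nu> where "\<nu> = outward_unit_normal \<Omega> x"
  have \<nu>1: "norm \<nu> = 1" unfolding \<nu>_def by (rule norm_outward_unit_normal[OF \<Omega>(1,3) x])
  \<comment> \<open>Outward directions whose ray meets the domain, truncated like the cone. The set
    is open, and the sign of \<open>\<nu> \<bullet> z\<close> separates it from
    \<open>inner_cone\<close>.\<close>
  define W where "W = {z. norm z ^ (CARD('n) + 1) < \<nu> \<bullet> z} \<inter> (\<Union>s\<in>{0<..}. (\<lambda>z. x + s *\<^sub>R z) -` \<Omega>)"
  have "open W"
    unfolding W_def
    by (intro open_Int open_UN ballI open_vimage \<Omega>(1) open_Collect_less continuous_intros)
  moreover have "W \<noteq> {}"
  proof -
    define w where "w = y - x"
    have w: "\<nu> \<bullet> w > 0" using y(2) by (simp add: w_def \<nu>_def inner_commute)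
    \<comment> \<open>Short multiples of \<open>w\<close> satisfy the truncation: its left side has
      order n + 1 in the scale, its right side order 1.\<close>
    have "((\<lambda>t. t ^ CARD('n) * norm w ^ (CARD('n) + 1)) \<longlongrightarrow> 0 ^ CARD('n) * norm w ^ (CARD('n) + 1)) (at_right (0 :: real))"
      by (intro tendsto_intros)
    then have "((\<lambda>t. t ^ CARD('n) * norm w ^ (CARD('n) + 1)) \<longlongrightarrow> 0) (at_right (0 :: real))"
      by (simp add: zero_power)
    then have "eventually (\<lambda>t :: real. t ^ CARD('n) * norm w ^ (CARD('n) + 1) < \<nu> \<bullet> w) (at_right 0)"
      using w by (rule order_tendstoD)
    then have "eventually (\<lambda>t :: real. t ^ CARD('n) * norm w ^ (CARD('n) + 1) < \<nu> \<bullet> w \<and> t \<in> {0<..<1}) (at_right 0)"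
      by (intro eventually_conj eventually_at_right_real) simp_all
    then obtain t :: real where t: "t ^ CARD('n) * norm w ^ (CARD('n) + 1) < \<nu> \<bullet> w" "t > 0"
      using eventually_happens'[OF trivial_limit_at_right_real] by fastforce
    have "t * (t ^ CARD('n) * norm w ^ (CARD('n) + 1)) < t * (\<nu> \<bullet> w)"
      using t by (intro mult_strict_left_mono)
    then have "norm (t *\<^sub>R w) ^ (CARD('n) + 1) < \<nu> \<bullet> (t *\<^sub>R w)"
      using t(2) by (simp add: power_mult_distrib mult_ac)
    moreover have "x + (1 / t) *\<^sub>R (t *\<^sub>R w) \<in> \<Omega>" using t(2) y(1) by (simp add: w_def)
    moreover have "1 / t \<in> {0<..}" using t(2) by simp
    ultimately have "t *\<^sub>R w \<in> W" unfolding W_def by blast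
    then show ?thesis by blast
  qed
  ultimately have Wpos: "0 < emeasure lborel W" and Wb: "W \<in> sets borel"
    by (auto intro: emeasure_lborel_open_pos borel_open)
  have "W \<subseteq> weighted_cone x \<nu> (frontier \<Omega>)"
  proof
    fix z assume "z \<in> W"
    then obtain s where z: "norm z ^ (CARD('n) + 1) < \<nu> \<bullet> z" and s: "s > 0" "x + s *\<^sub>R z \<in> \<Omega>"
      unfolding W_def by blast
    have "0 \<le> norm z ^ (CARD('n) + 1)" by simp
    with z have pos: "z \<bullet> outward_unit_normal \<Omega> x > 0" unfolding \<nu>_def[symmetric] by (simp only: inner_commute)
    have "eventually (\<lambda>t. x + t *\<^sub>R z \<notin> closure \<Omega> \<and> t \<in> {0<..<1}) (at_right 0)"
      by (intro eventually_conj eventually_outside_domain[OF \<Omega>(1,3) x pos] eventually_at_right_real) simp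
    then obtain b where b: "x + b *\<^sub>R z \<notin> closure \<Omega>" "b > 0"
      using eventually_happens'[OF trivial_limit_at_right_real] by fastforce
    then have "x + b *\<^sub>R z \<notin> \<Omega>" using closure_subset by blast
    then show "z \<in> weighted_cone x \<nu> (frontier \<Omega>)"
      using z by (intro ray_in_weighted_cone[OF s b(2)]) simp_all
  qed
  moreover have "inner_cone \<nu> \<subseteq> weighted_cone x \<nu> (frontier \<Omega>)"
    unfolding \<nu>_def by (rule inner_cone_subset_weighted_cone[OF \<Omega> x])
  ultimately have sub: "inner_cone \<nu> \<union> W \<subseteq> weighted_cone x \<nu> (frontier \<Omega>)" by blast
  have disj: "inner_cone \<nu> \<inter> W = {}"
  proof -
    have False if "z \<in> inner_cone \<nu>" "z \<in> W" for z
    proof -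
      have "norm z ^ (CARD('n) + 1) < - (\<nu> \<bullet> z)" "norm z ^ (CARD('n) + 1) < \<nu> \<bullet> z"
        using that by (auto simp: inner_cone_def W_def)
      moreover have "0 \<le> norm z ^ (CARD('n) + 1)" by simp
      ultimately show False by linarith
    qed
    then show ?thesis by blast
  qed
  have ib: "inner_cone \<nu> \<in> sets borel" using open_inner_cone by (rule borel_open)
  \<comment> \<open>Finite volume of \<open>inner_cone\<close> keeps the inequality strict in the
    extended reals.\<close>
  have "emeasure lborel (inner_cone \<nu>) + 0 < emeasure lborel (inner_cone \<nu>) + emeasure lborel W"
    using emeasure_inner_cone_finite[OF \<nu>1] Wpos by (simp add: ennreal_add_left_cancel_less)
  also have "\<dots> = emeasure lborel (inner_cone \<nu> \<union> W)"
    using ib Wb disj by (intro plus_emeasure) auto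
  also have "\<dots> = emeasure lebesgue (inner_cone \<nu> \<union> W)" using ib Wb by simp
  also have "\<dots> \<le> emeasure lebesgue (weighted_cone x \<nu> (frontier \<Omega>))"
    using sub x by (intro emeasure_mono frontier_sets_weighted_cone[OF \<Omega>(1,3)]) (auto intro: borel_closed)
  finally show ?thesis by (simp add: \<nu>_def)
qed

section \<open>The energy of a domain\<close>

definition pointwise_energy :: "(real ^ 'n) set \<Rightarrow> real ^ 'n \<Rightarrow> ennreal" where
  "pointwise_energy \<Omega> x = (\<integral>\<^sup>+y. ennreal (energy_kernel x (outward_unit_normal \<Omega> x) y (outward_unit_normal \<Omega> y))
     * indicator (frontier \<Omega>) y \<partial>hausdorff_measure (CARD('n) - 1))"

text \<open>The kernel vanishes on the supporting hyperplane at \<open>x\<close>. The remaining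
  boundary \<open>B\<close> lies strictly on the inner side and is met at most once by each ray from
  \<open>x\<close>, so its energy is given by the volume of a subset of
  \<open>inner_cone\<close>.\<close>

lemma pointwise_energy_convex_le:
  fixes \<Omega> :: "(real ^ 'n::finite) set"
  assumes \<Omega>: "open \<Omega>" "C1_boundary \<Omega>" and cvx: "convex \<Omega>" and x: "x \<in> frontier \<Omega>"
  shows "pointwise_energy \<Omega> x \<le> hausdorff_factor (j :: 'n) * (of_nat CARD('n) * emeasure lborel (inner_cone (outward_unit_normal \<Omega> x)))"
proof -
  define \<nu> where "\<nu> = outward_unit_normal \<Omega> x"
  let ?H = "hausdorff_measure (CARD('n) - 1) :: (real ^ 'n) measure"
  define B where "B = frontier \<Omega> \<inter> {y. (y - x) \<bullet> \<nu> < 0}"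
  have B: "B \<in> sets borel" "B \<subseteq> frontier \<Omega>"
    unfolding B_def by (auto intro!: sets.Int borel_closed borel_open open_Collect_less continuous_intros)
  have "pointwise_energy \<Omega> x = kernel_integral x \<nu> (outward_unit_normal \<Omega>) B"
    unfolding pointwise_energy_def \<nu>_def[symmetric]
  proof (intro nn_integral_cong)
    fix y
    show "ennreal (energy_kernel x \<nu> y (outward_unit_normal \<Omega> y)) * indicator (frontier \<Omega>) y
      = ennreal (energy_kernel x \<nu> y (outward_unit_normal \<Omega> y)) * indicator B y"
    proof (cases "y \<in> frontier \<Omega> \<and> y \<notin> B")
      case True
      then have "y \<in> closure \<Omega>" by (simp add: frontier_def)
      then have "(y - x) \<bullet> \<nu> \<le> 0" unfolding \<nu>_def by (rule supporting_if_convex[OF \<Omega> cvx x])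
      then have "\<nu> \<bullet> (y - x) = 0" using True by (simp add: B_def inner_commute)
      then show ?thesis by (simp add: energy_kernel_def)
    next
      case False
      then have "y \<in> frontier \<Omega> \<longleftrightarrow> y \<in> B" using B(2) by blast
      then show ?thesis by (simp add: indicator_def)
    qed
  qed
  also have "\<dots> = cone_energy j x \<nu> B"
  proof (rule frontier_weighted_cone_eq[OF \<Omega> _ B, symmetric])
    show "frontier \<Omega> \<noteq> {}" using x by blast
    \<comment> \<open>If \<open>y'\<close> lay beyond \<open>y\<close> on the same ray,
      \<open>y\<close> would lie between \<open>y'\<close> and a point \<open>p\<close> of the
      domain near \<open>x\<close>, and convexity would make \<open>y\<close> interior.\<close>
    have no: False if yB: "y \<in> B" "y' \<in> B" and s: "s > 1" and yy: "y' - x = s *\<^sub>R (y - x)" for y y' s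
    proof -
      have "(y - x) \<bullet> outward_unit_normal \<Omega> x < 0" using yB(1) by (simp add: B_def \<nu>_def)
      then have "eventually (\<lambda>t. x + t *\<^sub>R (y - x) \<in> \<Omega> \<and> t \<in> {0<..<1}) (at_right 0)"
        by (intro eventually_conj eventually_inside_domain[OF \<Omega> x] eventually_at_right_real) simp_all
      then obtain t where t: "x + t *\<^sub>R (y - x) \<in> \<Omega>" "0 < t" "t < 1"
        using eventually_happens'[OF trivial_limit_at_right_real] by fastforce
      define p where "p = x + t *\<^sub>R (y - x)"
      \<comment> \<open>Solution of \<open>(1 - u) * t + u * s = 1\<close>, the weight that places
        \<open>y\<close> between \<open>p\<close> and \<open>y'\<close>.\<close>
      define u where "u = (1 - t) / (s - t)"
      have u: "0 < u" "u < 1" using t s by (simp_all add: u_def)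
      have y': "y' = x + s *\<^sub>R (y - x)" using yy by (simp add: algebra_simps)
      have "(1 - u) * t + u * s = 1"
      proof -
        have "(1 - u) * t + u * s = t + u * (s - t)" by (simp add: algebra_simps)
        also have "u * (s - t) = 1 - t" using s t by (simp add: u_def)
        finally show ?thesis by simp
      qed
      moreover have "(1 - u) *\<^sub>R (x + t *\<^sub>R w) + u *\<^sub>R (x + s *\<^sub>R w) = x + ((1 - u) * t + u * s) *\<^sub>R w" for w
        by (simp add: algebra_simps)
      ultimately have "y = (1 - u) *\<^sub>R p + u *\<^sub>R y'" unfolding p_def y' by simp
      moreover have "p \<noteq> y'"
      proof
        assume "p = y'"
        then have "(s - t) *\<^sub>R (y - x) = 0" unfolding p_def y' by (simp add: algebra_simps)
        then have "y = x" using s t by simp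
        then show False using yB(1) by (simp add: B_def)
      qed
      ultimately have "y \<in> open_segment p y'" unfolding in_segment using u by blast
      moreover have "p \<in> interior \<Omega>" "y' \<in> closure \<Omega>"
        using t(1) yB(2) \<Omega>(1) B(2) by (auto simp: p_def interior_open frontier_def)
      ultimately have "y \<in> interior \<Omega>" using in_interior_closure_convex_segment[OF cvx] by blast
      then show False using yB(1) B(2) by (auto simp: frontier_def)
    qed
    fix y y' s assume *: "y \<in> B" "y' \<in> B" "s > 0" "\<nu> \<bullet> (y - x) \<noteq> 0" "y' - x = s *\<^sub>R (y - x)"
    consider "s > 1" | "s = 1" | "s < 1" by linarith
    then show "y = y'"
    proof cases
      case 1 then show ?thesis using no * by blast
    next
      case 2 then show ?thesis using * by simp
    next
      case 3
      have "y - x = (1 / s) *\<^sub>R (y' - x)" using * by simp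
      moreover have "1 / s > 1" using 3 * by simp
      ultimately show ?thesis using no * by blast
    qed
  qed
  also have "\<dots> \<le> hausdorff_factor j * (of_nat CARD('n) * emeasure lebesgue (inner_cone \<nu>))"
  proof (intro mult_left_mono emeasure_mono)
    show "weighted_cone x \<nu> B \<subseteq> inner_cone \<nu>"
    proof
      fix z assume "z \<in> weighted_cone x \<nu> B"
      then obtain y s where z: "y \<in> B" "s > 0" "z = s *\<^sub>R (y - x)" "norm z ^ (CARD('n) + 1) < \<bar>\<nu> \<bullet> z\<bar>"
        unfolding weighted_cone_def by blast
      have "\<nu> \<bullet> (y - x) < 0" using z(1) by (simp add: B_def inner_commute)
      then have "\<nu> \<bullet> z < 0" using z(2) by (simp add: z(3) mult_pos_neg)
      then show "z \<in> inner_cone \<nu>" using z(4) by (simp add: inner_cone_def)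
    qed
    show "inner_cone \<nu> \<in> sets lebesgue" using borel_open[OF open_inner_cone[of \<nu>]] by simp
  qed simp_all
  also have "emeasure lebesgue (inner_cone \<nu>) = emeasure lborel (inner_cone \<nu>)"
    using open_inner_cone[of \<nu>] by (simp add: borel_open)
  finally show ?thesis by (simp add: \<nu>_def)
qed

lemma
  fixes \<Omega> :: "(real ^ 'n::finite) set"
  assumes \<Omega>: "open \<Omega>" "bounded \<Omega>" "C1_boundary \<Omega>"
  shows finite_surface_measure: "finite_measure (surface_measure \<Omega>)"
    and measurable_pointwise_energy: "pointwise_energy \<Omega> \<in> borel_measurable (surface_measure \<Omega>)"
    and normal_energy_eq: "normal_energy \<Omega> = (\<integral>\<^sup>+x. pointwise_energy \<Omega> x \<partial>surface_measure \<Omega>)"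
proof -
  let ?H = "hausdorff_measure (CARD('n) - 1) :: (real ^ 'n) measure"
  let ?\<sigma> = "surface_measure \<Omega>"
  have M: "frontier \<Omega> \<in> sets ?H" by (simp add: borel_closed)
  have space: "space ?\<sigma> = frontier \<Omega>" by (simp add: surface_measure_def space_restrict_space)
  have em: "emeasure ?\<sigma> (frontier \<Omega>) = emeasure ?H (frontier \<Omega>)"
    unfolding surface_measure_def using M by (intro emeasure_restrict_space) auto
  show fin: "finite_measure ?\<sigma>"
    using hausdorff_frontier_finite[OF \<Omega>] by (intro finite_measureI) (simp add: space em)
  interpret finite_measure ?\<sigma> by (rule fin)
  have sets\<sigma>: "sets ?\<sigma> = sets (restrict_space borel (frontier \<Omega>))"
    unfolding surface_measure_def by (rule sets_restrict_space_cong) simp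
  have \<nu> [measurable]: "outward_unit_normal \<Omega> \<in> borel_measurable ?\<sigma>"
    using measurable_outward_unit_normal[OF \<Omega>(1,3)] measurable_cong_sets[OF sets\<sigma> refl] by blast
  have [measurable]: "(\<lambda>y. y) \<in> borel_measurable ?\<sigma>"
    unfolding surface_measure_def by (rule measurable_restrict_space1) (simp add: measurable_def)
  define K where "K = (\<lambda>(x, y). ennreal (energy_kernel x (outward_unit_normal \<Omega> x) y (outward_unit_normal \<Omega> y)))"
  have K: "K \<in> borel_measurable (?\<sigma> \<Otimes>\<^sub>M ?\<sigma>)" unfolding K_def energy_kernel_def by measurable
  have inner: "(\<integral>\<^sup>+y. K (x, y) \<partial>?\<sigma>) = pointwise_energy \<Omega> x" for x
    unfolding surface_measure_def pointwise_energy_def K_def prod.case using M by (intro nn_integral_restrict_space) simp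
  show "pointwise_energy \<Omega> \<in> borel_measurable ?\<sigma>"
    using borel_measurable_nn_integral_fst[OF K] by (simp add: inner)
  have "normal_energy \<Omega> = (\<integral>\<^sup>+p. K p \<partial>(?\<sigma> \<Otimes>\<^sub>M ?\<sigma>))"
    unfolding normal_energy_def K_def energy_kernel_def ..
  also have "\<dots> = (\<integral>\<^sup>+x. \<integral>\<^sup>+y. K (x, y) \<partial>?\<sigma> \<partial>?\<sigma>)" by (rule nn_integral_fst[OF K, symmetric])
  finally show "normal_energy \<Omega> = (\<integral>\<^sup>+x. pointwise_energy \<Omega> x \<partial>?\<sigma>)" unfolding inner .
qed

theorem mainTheorem1:
  shows "\<exists>c::real. c > 0 \<and>
    (\<forall>\<Omega> :: (real ^ 'n) set. is_domain \<Omega> \<and> bounded \<Omega> \<and> C1_boundary \<Omega> \<longrightarrow>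
       normal_energy \<Omega> \<ge> ennreal c * emeasure (surface_measure \<Omega>) (frontier \<Omega>) \<and>
       (normal_energy \<Omega> = ennreal c * emeasure (surface_measure \<Omega>) (frontier \<Omega>)
          \<longleftrightarrow> convex \<Omega>))"
proof -
  \<comment> \<open>The area formula holds with the factor of an arbitrary coordinate, so a single
    choice serves all charts of all domains.\<close>
  define j :: 'n where "j = undefined"
  define e :: "real ^ 'n" where "e = axis j 1"
  have e: "norm e = 1" by (simp add: e_def)
  \<comment> \<open>The energy seen from each boundary point of a convex domain; the unit vector
    \<open>e\<close> stands in for the normal.\<close>
  define C where "C = hausdorff_factor j * (of_nat CARD('n) * emeasure lborel (inner_cone e))"
  have \<kappa>: "0 < hausdorff_factor j" "hausdorff_factor j < \<infinity>"
    unfolding hausdorff_factor_def by (rule hausdorff_hyperplane_cube_pos hausdorff_hyperplane_cube_finite)+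
  have Cpos: "0 < C"
    unfolding C_def using \<kappa>(1) emeasure_inner_cone_pos[OF e] by (simp add: ennreal_zero_less_mult_iff)
  have Cfin: "C < \<infinity>"
    unfolding C_def using \<kappa>(2) emeasure_inner_cone_finite[OF e]
    by (simp add: ennreal_mult_less_top of_nat_less_top)
  define c where "c = enn2real C"
  have Cc: "ennreal c = C" unfolding c_def using Cfin by (simp add: less_top)
  have "c > 0" unfolding c_def using Cpos Cfin by (simp add: enn2real_positive_iff)
  moreover have "C * emeasure (surface_measure \<Omega>) (frontier \<Omega>) \<le> normal_energy \<Omega> \<and>
      (normal_energy \<Omega> = C * emeasure (surface_measure \<Omega>) (frontier \<Omega>) \<longleftrightarrow> convex \<Omega>)"
    if "is_domain \<Omega>" and bdd: "bounded \<Omega>" and C1: "C1_boundary \<Omega>" for \<Omega> :: "(real ^ 'n) set"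
  proof -
    have op: "open \<Omega>" using \<open>is_domain \<Omega>\<close> by (simp add: is_domain_def)
    let ?\<sigma> = "surface_measure \<Omega>"
    interpret finite_measure ?\<sigma> by (rule finite_surface_measure[OF op bdd C1])
    note [measurable] = measurable_pointwise_energy[OF op bdd C1]
    have space: "space ?\<sigma> = frontier \<Omega>" by (simp add: surface_measure_def space_restrict_space)
    have E: "normal_energy \<Omega> = (\<integral>\<^sup>+x. pointwise_energy \<Omega> x \<partial>?\<sigma>)"
      by (rule normal_energy_eq[OF op bdd C1])
    have const: "(\<integral>\<^sup>+x. C \<partial>?\<sigma>) = C * emeasure ?\<sigma> (frontier \<Omega>)" by (simp add: space)
    have \<nu>: "C = hausdorff_factor j * (of_nat CARD('n) * emeasure lborel (inner_cone (outward_unit_normal \<Omega> x)))"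
      if "x \<in> frontier \<Omega>" for x
      unfolding C_def emeasure_inner_cone_eq[OF e norm_outward_unit_normal[OF op C1 that]] ..
    have fr: "frontier \<Omega> \<in> sets borel" by (simp add: borel_closed)
    have cone_le: "cone_energy j x (outward_unit_normal \<Omega> x) (frontier \<Omega>)
        \<le> pointwise_energy \<Omega> x" if "x \<in> frontier \<Omega>" for x
      unfolding pointwise_energy_def using that by (intro frontier_weighted_cone_le[OF op C1 _ fr]) auto
    have lower: "C \<le> pointwise_energy \<Omega> x" if x: "x \<in> frontier \<Omega>" for x
    proof -
      have "emeasure lborel (inner_cone (outward_unit_normal \<Omega> x)) = emeasure lebesgue (inner_cone (outward_unit_normal \<Omega> x))"
        using open_inner_cone[of "outward_unit_normal \<Omega> x"] by (simp add: borel_open)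
      also have "\<dots> \<le> emeasure lebesgue (weighted_cone x (outward_unit_normal \<Omega> x) (frontier \<Omega>))"
        using x by (intro emeasure_mono inner_cone_subset_weighted_cone[OF op bdd C1] frontier_sets_weighted_cone[OF op C1 _ fr]) auto
      finally have "C \<le> cone_energy j x (outward_unit_normal \<Omega> x) (frontier \<Omega>)"
        unfolding \<nu>[OF x] by (intro mult_left_mono) simp_all
      then show ?thesis using cone_le[OF x] by (rule order_trans)
    qed
    have ge: "C * emeasure ?\<sigma> (frontier \<Omega>) \<le> normal_energy \<Omega>"
      unfolding E const[symmetric] by (intro nn_integral_mono) (simp add: space lower)
    moreover have "normal_energy \<Omega> = C * emeasure ?\<sigma> (frontier \<Omega>)" if "convex \<Omega>"
    proof (rule antisym[OF _ ge])
      show "normal_energy \<Omega> \<le> C * emeasure ?\<sigma> (frontier \<Omega>)"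
        unfolding E const[symmetric]
      proof (intro nn_integral_mono)
        fix x assume "x \<in> space ?\<sigma>"
        then have x: "x \<in> frontier \<Omega>" by (simp add: space)
        show "pointwise_energy \<Omega> x \<le> C"
          unfolding \<nu>[OF x] by (rule pointwise_energy_convex_le[OF op C1 that x])
      qed
    qed
    moreover have "convex \<Omega>" if eq: "normal_energy \<Omega> = C * emeasure ?\<sigma> (frontier \<Omega>)"
    proof (rule ccontr)
      assume "\<not> convex \<Omega>"
      then obtain x y where xy: "x \<in> frontier \<Omega>" "y \<in> \<Omega>" "(y - x) \<bullet> outward_unit_normal \<Omega> x > 0"
        using convex_if_supporting[OF op C1] by (meson not_le)
      \<comment> \<open>Continuity of the normal carries the violation of support at
        \<open>x\<close> over to a boundary patch \<open>U\<close>, with the same point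
        \<open>y\<close>.\<close>
      have "continuous_on (frontier \<Omega>) (\<lambda>x. (y - x) \<bullet> outward_unit_normal \<Omega> x)"
        by (intro continuous_intros continuous_on_outward_unit_normal[OF op C1])
      then have "((\<lambda>x. (y - x) \<bullet> outward_unit_normal \<Omega> x) \<longlongrightarrow> (y - x) \<bullet> outward_unit_normal \<Omega> x) (at x within frontier \<Omega>)"
        using xy(1) by (simp add: continuous_on_def)
      then have "eventually (\<lambda>x. (y - x) \<bullet> outward_unit_normal \<Omega> x > 0) (at x within frontier \<Omega>)"
        using xy(3) by (rule order_tendstoD)
      then obtain \<rho> where \<rho>: "\<rho> > 0" "\<And>x'. x' \<in> frontier \<Omega> \<Longrightarrow> x' \<noteq> x \<Longrightarrow> dist x' x < \<rho> \<Longrightarrow> (y - x') \<bullet> outward_unit_normal \<Omega> x' > 0"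
        unfolding eventually_at by blast
      define U where "U = frontier \<Omega> \<inter> ball x \<rho>"
      have strict: "C < pointwise_energy \<Omega> x'" if "x' \<in> U" for x'
      proof -
        have x': "x' \<in> frontier \<Omega>" "(y - x') \<bullet> outward_unit_normal \<Omega> x' > 0"
          using that \<rho>(2)[of x'] xy by (auto simp: U_def dist_commute)
        have "C < cone_energy j x' (outward_unit_normal \<Omega> x') (frontier \<Omega>)"
          unfolding \<nu>[OF x'(1)]
          using weighted_cone_gt[OF op bdd C1 x'(1) xy(2) x'(2)] \<kappa>
          by (intro ennreal_mult_strict_left_mono) (auto simp: less_top of_nat_less_top)
        then show ?thesis using cone_le[OF x'(1)] by (rule less_le_trans)
      qed
      \<comment> \<open>Pointwise excess over \<open>C\<close>. Equality of the integrals together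
        with finiteness of the total forces it to vanish almost everywhere, yet it is positive on
        \<open>U\<close>, a set of positive measure.\<close>
      define J where "J x = pointwise_energy \<Omega> x - C" for x
      have J [measurable]: "J \<in> borel_measurable ?\<sigma>" unfolding J_def by measurable
      have "normal_energy \<Omega> = (\<integral>\<^sup>+x. C + J x \<partial>?\<sigma>)"
        unfolding E by (intro nn_integral_cong) (simp add: J_def space lower diff_add_cancel_ennreal add.commute[of C])
      also have "\<dots> = C * emeasure ?\<sigma> (frontier \<Omega>) + (\<integral>\<^sup>+x. J x \<partial>?\<sigma>)"
        unfolding const[symmetric] by (rule nn_integral_add) auto
      finally have "C * emeasure ?\<sigma> (frontier \<Omega>) + (\<integral>\<^sup>+x. J x \<partial>?\<sigma>) = C * emeasure ?\<sigma> (frontier \<Omega>) + 0"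
        using eq by simp
      moreover have "C * emeasure ?\<sigma> (frontier \<Omega>) \<noteq> top"
        using Cfin emeasure_finite[of "frontier \<Omega>"] by (simp add: ennreal_mult_eq_top_iff less_top)
      ultimately have "(\<integral>\<^sup>+x. J x \<partial>?\<sigma>) = 0" by (simp add: ennreal_add_left_cancel)
      then have "AE x in ?\<sigma>. J x = 0" by (simp add: nn_integral_0_iff_AE)
      then have "AE x in ?\<sigma>. x \<notin> U"
      proof (rule eventually_mono)
        fix x assume "J x = 0"
        then show "x \<notin> U" using strict[of x] Cfin by (auto simp: J_def ennreal_minus_eq_0 not_le[symmetric] diff_eq_0_iff_ennreal)
      qed
      moreover have "U \<in> sets ?\<sigma>"
        unfolding U_def surface_measure_def by (subst sets_restrict_space_iff) (auto simp: borel_closed intro!: sets.Int)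
      ultimately have "emeasure ?\<sigma> U = 0" by (intro AE_iff_measurable[THEN iffD1, of U]) (auto simp: space U_def)
      moreover have "emeasure ?\<sigma> U = emeasure (hausdorff_measure (CARD('n) - 1)) U"
        unfolding surface_measure_def U_def by (intro emeasure_restrict_space) (auto simp: borel_closed)
      ultimately show False
        using hausdorff_frontier_ball_pos[OF op C1 xy(1) \<rho>(1)] by (simp add: U_def)
    qed
    ultimately show ?thesis by blast
  qed
  ultimately show ?thesis unfolding Cc[symmetric] by blast
qed

end
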